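(* Let $d\ge 3$, $k\ge 2$, $j\ge 1$ be integers and let $\{\Omega_n\}_{n\in\mathbb N}$ be a sequence of finite connected $d$-regular graphs which has logarithmic girth and is, for every $1<p<\infty$, a $p$-expander with respect to $L^p$-spaces. Let $\Omega=\bigsqcup_n\Omega_n$. Let $G$ be an a-$FL^p$-menable group, where $1<p<\infty$. Then $\Gamma_\alpha$ has hereditary super-rigidity with respect to $G$ for almost every $\alpha\in\mathcal A(\Omega,T^j)$; that is, for almost every $\alpha\in\mathcal A(\Omega,T^j)$, every group homomorphism from a finite index subgroup of $\Gamma_\alpha$ to $G$ has finite image.
   Context: Graphs. $|\Omega|$ is the number of vertices of a finite graph $\Omega$, and its girth is the edge-length of its shortest non-trivial cycle. A sequence $\{\Omega_n\}$ of finite graphs has logarithmic girth if there is $C>0$ with $\mathrm{girth}(\Omega_n)\ge C\log|\Omega_n|$ for all $n$. A sequence of $d$-regular finite connected graphs $\Omega_n=(V_n,E_n)$ is a $p$-expander with respect to a metric space $(Y,d_Y)$ if $|V_n|\to\infty$ and there is a constant $C$ such that for every $n$ and every $f:V_n\to Y$, $$\frac1{|V_n|^2}\sum_{u,v\in V_n}d_Y(f(u),f(v))^p\le\frac{C}{|E_n|}\sum_{\overline{uv}\in E_n}d_Y(f(u),f(v))^p,$$ where $\overline{uv}$ denotes an edge between $u$ and $v$. Random monster group. $F_k$ is the free group of rank $k$ with symmetric generating set $T$ of size $2k$ (a free basis and its inverses), and $T^j\subset F_k$ is the set of elements of the form $t_1\cdots t_j$ with $t_i\in T$. A symmetric $F_k$-labelling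 of a graph is a map $\alpha$ from its oriented edges to $F_k$ with $\alpha(e^{-1})=\alpha(e)^{-1}$ for every edge $e$. $\mathcal A(\Omega,T^j)$ is the set of symmetric $F_k$-labellings of $\Omega$ with values in $T^j$; for $\Omega=\bigsqcup_n\Omega_n$ it is given the product of the uniform probability distributions on the finite sets $\mathcal A(\Omega_n,T^j)$, and "almost every" refers to this probability. For $\alpha\in\mathcal A(\Omega,T^j)$, $\Gamma_\alpha$ is the quotient of $F_k$ by the normal closure of all elements $\alpha(e_1)\cdots\alpha(e_m)$, where $e_1\cdots e_m$ is a closed path in $\Omega$. A discrete group $G$ is a-$FL^p$-menable if there is a proper affine isometric action of $G$ on an $L^p$-space for some $p\in(1,\infty)$. *)

theory Defs
  imports
    "HOL-Probability.Probability"
    "HOL-Algebra.Algebra"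
    "Graph_Theory.Graph_Theory"
begin

section \<open>Graphs\<close>

text \<open>
  A graph is a digraph together with a fixed-point free involution \<open>r\<close> of its arcs that
  exchanges tail and head (\<^locale>\<open>bidirected_digraph\<close>). The arcs are the oriented edges and
  \<open>r e\<close> is the inverse of \<open>e\<close>, so an unoriented edge is a pair \<open>{e, r e}\<close> and the degree of a
  vertex is its \<^const>\<open>out_degree\<close>. Loops and parallel edges are permitted; simple graphs are
  the special case of symmetric loop-free digraphs without parallel arcs.
\<close>

definition fin_conn_regular :: "nat \<Rightarrow> ('v, 'e) pre_digraph \<Rightarrow> ('e \<Rightarrow> 'e) \<Rightarrow> bool" where
  "fin_conn_regular d G r \<longleftrightarrow>
     fin_digraph G \<and> bidirected_digraph G r \<and> Digraph_Component.connected G \<and>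
     (\<forall>v\<in>verts G. out_degree G v = d)"

text \<open>
  \<^const>\<open>pre_digraph.cycle\<close> admits the backtracking walk \<open>e, r e\<close>, which is not a cycle of the
  undirected graph. The girth of a forest is \<open>\<infinity>\<close>.
\<close>

definition girth :: "('v, 'e) pre_digraph \<Rightarrow> ('e \<Rightarrow> 'e) \<Rightarrow> enat" where
  "girth G r = (INF p \<in> {p. pre_digraph.cycle G p \<and> (\<nexists>e. p = [e, r e])}. enat (length p))"

definition logarithmic_girth ::
    "(nat \<Rightarrow> ('v, 'e) pre_digraph) \<Rightarrow> (nat \<Rightarrow> 'e \<Rightarrow> 'e) \<Rightarrow> bool" where
  "logarithmic_girth \<Omega> r \<longleftrightarrow>
     (\<exists>C>0. \<forall>n. ereal (C * ln (real (card (verts (\<Omega> n))))) \<le> ereal_of_enat (girth (\<Omega> n) (r n)))"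

text \<open>
  The metric space is given by its carrier \<open>Y\<close> and its distance \<open>dY\<close>. Every unoriented edge
  corresponds to exactly two arcs, so averaging over edges is the same as averaging over arcs.
\<close>

definition p_expander ::
    "real \<Rightarrow> 'y set \<Rightarrow> ('y \<Rightarrow> 'y \<Rightarrow> real) \<Rightarrow> (nat \<Rightarrow> ('v, 'e) pre_digraph) \<Rightarrow> bool" where
  "p_expander p Y dY \<Omega> \<longleftrightarrow>
     filterlim (\<lambda>n. card (verts (\<Omega> n))) at_top sequentially \<and>
     (\<exists>C::real. \<forall>n. \<forall>f. f ` verts (\<Omega> n) \<subseteq> Y \<longrightarrow>
        1 / (real (card (verts (\<Omega> n))))\<^sup>2 *
          (\<Sum>u\<in>verts (\<Omega> n). \<Sum>v\<in>verts (\<Omega> n). dY (f u) (f v) powr p)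
        \<le> C / real (card (arcs (\<Omega> n))) *
          (\<Sum>e\<in>arcs (\<Omega> n). dY (f (tail (\<Omega> n) e)) (f (head (\<Omega> n) e)) powr p))"


section \<open>\<open>L\<^sup>p\<close>-spaces\<close>

text \<open>
  \<open>L\<^sup>p(M)\<close> is the set of almost-everywhere classes of real-valued \<open>p\<close>-integrable functions on an
  arbitrary measure space \<open>M\<close>. The operations on classes are computed on representatives and do
  not depend on their choice.
\<close>

definition Lp_fun :: "real \<Rightarrow> 'b measure \<Rightarrow> ('b \<Rightarrow> real) set" where
  "Lp_fun p M = {f \<in> borel_measurable M. integrable M (\<lambda>x. \<bar>f x\<bar> powr p)}"

definition Lp_rel :: "real \<Rightarrow> 'b measure \<Rightarrow> (('b \<Rightarrow> real) \<times> ('b \<Rightarrow> real)) set" where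
  "Lp_rel p M = {(f, g). f \<in> Lp_fun p M \<and> g \<in> Lp_fun p M \<and> (AE x in M. f x = g x)}"

definition Lp_space :: "real \<Rightarrow> 'b measure \<Rightarrow> ('b \<Rightarrow> real) set set" where
  "Lp_space p M = Lp_fun p M // Lp_rel p M"

definition Lp_rep :: "('b \<Rightarrow> real) set \<Rightarrow> 'b \<Rightarrow> real" where
  "Lp_rep F = (SOME f. f \<in> F)"

definition Lp_dist :: "real \<Rightarrow> 'b measure \<Rightarrow> ('b \<Rightarrow> real) set \<Rightarrow> ('b \<Rightarrow> real) set \<Rightarrow> real" where
  "Lp_dist p M F G = (LINT x|M. \<bar>Lp_rep F x - Lp_rep G x\<bar> powr p) powr (1 / p)"

text \<open>The point \<open>(1 - t) F + t G\<close> of the affine line through \<open>F\<close> and \<open>G\<close>.\<close>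

definition Lp_line ::
    "real \<Rightarrow> 'b measure \<Rightarrow> real \<Rightarrow> ('b \<Rightarrow> real) set \<Rightarrow> ('b \<Rightarrow> real) set \<Rightarrow> ('b \<Rightarrow> real) set" where
  "Lp_line p M t F G = Lp_rel p M `` {\<lambda>x. (1 - t) * Lp_rep F x + t * Lp_rep G x}"

text \<open>
  Both sides of the Poincare inequality involve only finitely many points of the target, and
  every separable \<open>L\<^sup>p\<close>-space embeds isometrically into \<open>L\<^sup>p([0,1])\<close>. Hence nothing is lost by
  letting \<open>M\<close> range over the measures on the reals only. The constant may depend on \<open>M\<close>.
\<close>

definition p_expander_Lp :: "real \<Rightarrow> (nat \<Rightarrow> ('v, 'e) pre_digraph) \<Rightarrow> bool" where
  "p_expander_Lp p \<Omega> \<longleftrightarrow> (\<forall>M :: real measure. p_expander p (Lp_space p M) (Lp_dist p M) \<Omega>)"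


section \<open>a-\<open>FL\<^sup>p\<close>-menability and super-rigidity\<close>

definition affine_isometric_action ::
    "real \<Rightarrow> 'b measure \<Rightarrow> 'g monoid \<Rightarrow> ('g \<Rightarrow> ('b \<Rightarrow> real) set \<Rightarrow> ('b \<Rightarrow> real) set) \<Rightarrow> bool" where
  "affine_isometric_action p M G \<phi> \<longleftrightarrow>
     group_action G (Lp_space p M) \<phi> \<and>
     (\<forall>g\<in>carrier G. \<forall>x\<in>Lp_space p M. \<forall>y\<in>Lp_space p M.
        Lp_dist p M (\<phi> g x) (\<phi> g y) = Lp_dist p M x y \<and>
        (\<forall>t. \<phi> g (Lp_line p M t x y) = Lp_line p M t (\<phi> g x) (\<phi> g y)))"

text \<open>Metric properness: orbits of the discrete group \<open>G\<close> tend to infinity.\<close>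

definition proper_action ::
    "real \<Rightarrow> 'b measure \<Rightarrow> 'g monoid \<Rightarrow> ('g \<Rightarrow> ('b \<Rightarrow> real) set \<Rightarrow> ('b \<Rightarrow> real) set) \<Rightarrow> bool" where
  "proper_action p M G \<phi> \<longleftrightarrow>
     (\<forall>x\<in>Lp_space p M. \<forall>R. finite {g \<in> carrier G. Lp_dist p M (\<phi> g x) x \<le> R})"

text \<open>
  A definition cannot quantify over all types; the type argument names the type \<open>'b\<close> of points
  of the underlying measure space. A theorem about arbitrary \<open>'b\<close> covers all \<open>L\<^sup>p\<close>-spaces.
\<close>

definition a_FLp_menable :: "'b itself \<Rightarrow> real \<Rightarrow> 'g monoid \<Rightarrow> bool" where
  "a_FLp_menable (_ :: 'b itself) p G \<longleftrightarrow>
     group G \<and>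
     (\<exists>(M :: 'b measure) \<phi>. affine_isometric_action p M G \<phi> \<and> proper_action p M G \<phi>)"

definition hereditary_super_rigidity :: "'a monoid \<Rightarrow> 'g monoid \<Rightarrow> bool" where
  "hereditary_super_rigidity \<Gamma> G \<longleftrightarrow>
     (\<forall>H. subgroup H \<Gamma> \<and> finite (rcosets\<^bsub>\<Gamma>\<^esub> H) \<longrightarrow>
        (\<forall>h \<in> hom (\<Gamma>\<lparr>carrier := H\<rparr>) G. finite (h ` H)))"


section \<open>Free groups\<close>

text \<open>
  Elements of the free group of rank \<open>k\<close> are the reduced words in the letters \<open>(i, b)\<close> with
  \<open>i < k\<close>, where \<open>(i, True)\<close> stands for the \<open>i\<close>-th basis element and \<open>(i, False)\<close> for its inverse.
\<close>

type_synonym word = "(nat \<times> bool) list"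

definition letter_inv :: "nat \<times> bool \<Rightarrow> nat \<times> bool" where
  "letter_inv x = (fst x, \<not> snd x)"

definition reduced_word :: "word \<Rightarrow> bool" where
  "reduced_word w \<longleftrightarrow> (\<forall>i. Suc i < length w \<longrightarrow> w ! Suc i \<noteq> letter_inv (w ! i))"

text \<open>Left multiplication of a reduced word by a letter, with cancellation.\<close>

fun cons_reduce :: "nat \<times> bool \<Rightarrow> word \<Rightarrow> word" where
  "cons_reduce x [] = [x]"
| "cons_reduce x (y # w) = (if y = letter_inv x then w else x # y # w)"

definition free_group :: "nat \<Rightarrow> word monoid" where
  "free_group k =
     \<lparr>carrier = {w. reduced_word w \<and> fst ` set w \<subseteq> {..<k}},
      mult = foldr cons_reduce,
      one = []\<rparr>"

lemma letter_inv_inv [simp]: "letter_inv (letter_inv x) = x"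
  by (simp add: letter_inv_def)

lemma reduced_Nil: "reduced_word []" by (simp add: reduced_word_def)

lemma reduced_Cons: "reduced_word (x # w) \<longleftrightarrow> reduced_word w \<and> (w = [] \<or> hd w \<noteq> letter_inv x)"
proof (cases w)
  case Nil then show ?thesis by (simp add: reduced_word_def)
next
  case (Cons y v)
  have "reduced_word (x # w) \<longleftrightarrow> (\<forall>i. i < length w \<longrightarrow> w ! i \<noteq> letter_inv ((x # w) ! i))"
    by (simp add: reduced_word_def)
  also have "\<dots> \<longleftrightarrow> (\<forall>i<Suc (length v). w ! i \<noteq> letter_inv ((x # w) ! i))"
    using Cons by simp
  also have "\<dots> \<longleftrightarrow> hd w \<noteq> letter_inv x \<and> reduced_word w"
    unfolding All_less_Suc2 using Cons by (simp add: reduced_word_def)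
  finally show ?thesis using Cons by auto
qed

lemma reduced_cons_reduce: "reduced_word w \<Longrightarrow> reduced_word (cons_reduce x w)"
  by (cases w) (auto simp: reduced_Cons reduced_Nil)

lemma cons_reduce_inv: "reduced_word w \<Longrightarrow> cons_reduce x (cons_reduce (letter_inv x) w) = w"
proof (cases w)
  case (Cons y v)
  assume "reduced_word w"
  then show ?thesis using Cons by (cases v) (auto simp: reduced_Cons)
qed simp

lemma reduced_foldr: "reduced_word w \<Longrightarrow> reduced_word (foldr cons_reduce u w)"
  by (induction u) (auto intro: reduced_cons_reduce)

lemma foldr_cons_reduce_Nil: "reduced_word w \<Longrightarrow> foldr cons_reduce w [] = w"
proof (induction w)
  case (Cons x w) then show ?case by (cases w) (auto simp: reduced_Cons)
qed simp

lemma foldr_cons_reduce: 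
  assumes "reduced_word w" shows "foldr cons_reduce (cons_reduce x v) w = cons_reduce x (foldr cons_reduce v w)"
  using assms by (cases v) (auto simp: cons_reduce_inv reduced_foldr)

lemma foldr_assoc:
  assumes "reduced_word w" 
  shows "foldr cons_reduce (foldr cons_reduce u v) w = foldr cons_reduce u (foldr cons_reduce v w)"
  using assms by (induction u) (auto simp: foldr_cons_reduce)

lemma set_cons_reduce: "set (cons_reduce x w) \<subseteq> insert x (set w)"
  by (cases w) auto

lemma set_foldr: "set (foldr cons_reduce u v) \<subseteq> set u \<union> set v"
  by (induction u) (use set_cons_reduce in fastforce)+

lemma left_inv: "reduced_word v \<Longrightarrow> foldr cons_reduce (rev (map letter_inv u)) (foldr cons_reduce u v) = v"
proof (induction u arbitrary: v)
  case (Cons x u)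
  have "cons_reduce (letter_inv x) (cons_reduce x (foldr cons_reduce u v)) = foldr cons_reduce u v"
    using cons_reduce_inv[of "foldr cons_reduce u v" "letter_inv x"] Cons.prems by (simp add: reduced_foldr)
  then show ?case using Cons by simp
qed simp

lemma group_free_group: "group (free_group k)"
proof (rule groupI)
  fix x y assume "x \<in> carrier (free_group k)" "y \<in> carrier (free_group k)"
  then show "x \<otimes>\<^bsub>free_group k\<^esub> y \<in> carrier (free_group k)"
    using set_foldr[of x y] by (fastforce simp: free_group_def reduced_foldr)
next
  fix x assume x: "x \<in> carrier (free_group k)"
  let ?y = "foldr cons_reduce (rev (map letter_inv x)) []"
  have "set ?y \<subseteq> letter_inv ` set x" using set_foldr[of "rev (map letter_inv x)" "[]"] by auto
  moreover have "reduced_word ?y" by (simp add: reduced_foldr reduced_Nil)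
  ultimately have "?y \<in> carrier (free_group k)"
    using x by (fastforce simp: free_group_def letter_inv_def)
  moreover have "foldr cons_reduce ?y x = []"
    using left_inv[of "[]" x] x
    by (subst foldr_assoc) (auto simp: free_group_def foldr_cons_reduce_Nil reduced_Nil)
  ultimately show "\<exists>y\<in>carrier (free_group k). y \<otimes>\<^bsub>free_group k\<^esub> x = \<one>\<^bsub>free_group k\<^esub>"
    by (auto simp: free_group_def)
qed (auto simp: free_group_def foldr_assoc reduced_Nil)

definition free_gens :: "nat \<Rightarrow> word set" where
  "free_gens k = {[(i, b)] | i b. i < k}"

definition list_prod :: "'a monoid \<Rightarrow> 'a list \<Rightarrow> 'a" where
  "list_prod G xs = foldr (mult G) xs \<one>\<^bsub>G\<^esub>"

definition gen_products :: "nat \<Rightarrow> nat \<Rightarrow> word set" where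
  "gen_products k j = {list_prod (free_group k) ts | ts. length ts = j \<and> set ts \<subseteq> free_gens k}"

definition normal_closure :: "'a monoid \<Rightarrow> 'a set \<Rightarrow> 'a set" where
  "normal_closure G S = \<Inter> {N. N \<lhd> G \<and> S \<subseteq> N}"


section \<open>Random groups\<close>

definition sym_labellings ::
    "'a monoid \<Rightarrow> 'a set \<Rightarrow> ('v, 'e) pre_digraph \<Rightarrow> ('e \<Rightarrow> 'e) \<Rightarrow> ('e \<Rightarrow> 'a) set" where
  "sym_labellings F S G r =
     {\<alpha> \<in> PiE (arcs G) (\<lambda>_. S). \<forall>e\<in>arcs G. \<alpha> (r e) = inv\<^bsub>F\<^esub> (\<alpha> e)}"

text \<open>
  A labelling of the disjoint union of the graphs \<open>\<Omega> n\<close> is a family \<open>\<alpha>\<close> of labellings \<open>\<alpha> n\<close> of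
  \<open>\<Omega> n\<close>, and a closed path of the disjoint union is a closed path of one of the \<open>\<Omega> n\<close>.
\<close>

definition random_labelling ::
    "nat \<Rightarrow> nat \<Rightarrow> (nat \<Rightarrow> ('v, 'e) pre_digraph) \<Rightarrow> (nat \<Rightarrow> 'e \<Rightarrow> 'e) \<Rightarrow> (nat \<Rightarrow> 'e \<Rightarrow> word) measure" where
  "random_labelling k j \<Omega> r =
     PiM UNIV (\<lambda>n. uniform_count_measure
       (sym_labellings (free_group k) (gen_products k j) (\<Omega> n) (r n)))"

definition closed_path_labels ::
    "nat \<Rightarrow> (nat \<Rightarrow> ('v, 'e) pre_digraph) \<Rightarrow> (nat \<Rightarrow> 'e \<Rightarrow> word) \<Rightarrow> word set" where
  "closed_path_labels k \<Omega> \<alpha> =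
     {list_prod (free_group k) (map (\<alpha> n) p) | n p. \<exists>u. pre_digraph.awalk (\<Omega> n) u p u}"

definition monster_group ::
    "nat \<Rightarrow> (nat \<Rightarrow> ('v, 'e) pre_digraph) \<Rightarrow> (nat \<Rightarrow> 'e \<Rightarrow> word) \<Rightarrow> word set monoid" where
  "monster_group k \<Omega> \<alpha> =
     free_group k Mod normal_closure (free_group k) (closed_path_labels k \<Omega> \<alpha>)"

end

theory Submission
  imports Defs "HOL-Real_Asymp.Real_Asymp"
begin

text \<open>
  By properness of the given action of \<open>G\<close> on \<open>L\<^sup>p(M)\<close>, it suffices that every homomorphism from a
  finite index subgroup of \<open>\<Gamma>\<^sub>\<alpha>\<close> to \<open>G\<close> yields an action with a bounded orbit. Pulling back to
  the free group, fix a finite index subgroup \<open>H\<close> containing the kernel \<open>N\<close> of \<open>F\<^sub>k \<rightarrow> \<Gamma>\<^sub>\<alpha>\<close> and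
  consider the \<open>H\<close>-equivariant maps \<open>E\<close> from \<open>F\<^sub>k\<close> to \<open>L\<^sup>p(M)\<close>. Let \<open>energy m E\<close> be the mean \<open>p\<close>-th power
  of the displacement of \<open>E\<close> under \<open>m\<close> steps of the random walk with steps in \<open>T\<^sup>j\<close>, summed over a
  transversal of \<open>H\<close>.

  Two estimates for the energy compete. The expanders show that \<open>energy m E \<le> K * energy 1 E\<close> with a
  constant \<open>K\<close> independent of \<open>m\<close> and \<open>E\<close> (\<open>energy_le_of_equidistributed\<close>): a labelled graph is mapped to
  \<open>\<Gamma>\<^sub>\<alpha>\<close> because closed paths have trivial labels, and the Poincare inequality bounds the mean
  distance of the endpoints of walks of any length by the mean length of the images of the edges. For
  this it is needed that the labels of the walks of length \<open>m\<close> imitate the random walk on the group.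
  That holds for almost every \<open>\<alpha>\<close>, simultaneously for all \<open>m\<close>, by a second moment computation over
  non-backtracking walks (\<open>AE_exists_equidistributed\<close>); as the girth tends to infinity, such a
  walk repeats no edge, so its labels are independent.

  On the other hand, uniform convexity of \<open>L\<^sup>p\<close> makes the energy of an almost harmonic map grow
  linearly in \<open>m\<close> (\<open>energy_increment\<close>). Applied to a Cesaro average of the random walk operator, the two
  estimates force the energy of the average to be much smaller than that of the original map
  (\<open>energy_contraction\<close>). Iterating, one obtains equivariant maps of arbitrarily small energy at
  bounded distance from the original one, which bounds the displacement
  (\<open>bounded_displacement\<close>). Neither a fixed point nor completeness of \<open>L\<^sup>p\<close> is used.
\<close>

section \<open>Inequalities for \<open>p\<close>-th powers\<close>

lemma powr_abs_triangle:
  fixes a b p :: real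
  assumes "0 < p"
  shows "\<bar>a + b\<bar> powr p \<le> 2 powr p * (\<bar>a\<bar> powr p + \<bar>b\<bar> powr p)"
proof -
  have "\<bar>a + b\<bar> powr p \<le> (2 * max \<bar>a\<bar> \<bar>b\<bar>) powr p"
    using assms by (intro powr_mono2) auto
  also have "\<dots> = 2 powr p * (max \<bar>a\<bar> \<bar>b\<bar>) powr p"
    by (simp add: powr_mult)
  also have "\<dots> \<le> 2 powr p * (\<bar>a\<bar> powr p + \<bar>b\<bar> powr p)"
    by (intro mult_left_mono) (auto simp: max_def)
  finally show ?thesis .
qed

lemma powr_above_tangent:
  fixes t p :: real
  assumes "1 < p" "t \<noteq> 0"
  shows "1 + p * t < \<bar>1 + t\<bar> powr p"
proof (cases "1 + t > 0")
  case True
  show ?thesis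
  proof (cases "t > 0")
    case pos: True
    have "\<exists>z. 1 < z \<and> z < 1 + t \<and> (1 + t) powr p - 1 powr p = (1 + t - 1) * (p * z powr (p - 1))"
      using pos by (intro MVT2) (auto intro!: derivative_eq_intros)
    then obtain z where z: "1 < z" "(1 + t) powr p - 1 = t * (p * z powr (p - 1))" by auto
    have "z powr (p - 1) > 1" using z assms by (simp add: gr_one_powr)
    then have "t * p * z powr (p - 1) > t * p" using pos assms by simp
    then show ?thesis using z True by (simp add: algebra_simps)
  next
    case False
    then have neg: "t < 0" using assms by simp
    have "\<exists>z. 1 + t < z \<and> z < 1 \<and> 1 powr p - (1 + t) powr p = (1 - (1 + t)) * (p * z powr (p - 1))"
      using neg True by (intro MVT2) (auto intro!: derivative_eq_intros)
    then obtain z where z: "1 + t < z" "z < 1" "1 - (1 + t) powr p = - t * (p * z powr (p - 1))" by auto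
    have "z powr (p - 1) < 1 powr (p - 1)" using z assms True by (intro powr_less_mono2) auto
    then have "(- t) * p * z powr (p - 1) < (- t) * p" using neg assms by simp
    then show ?thesis using z True by (simp add: algebra_simps)
  qed
next
  case False
  then have "1 + p * t < 0" using assms
    by (smt (verit) mult_less_cancel_right2)
  then show ?thesis by (smt (verit) powr_ge_zero)
qed

text \<open>
  Uniform strict convexity of \<open>t \<mapsto> \<bar>1 + t\<bar> powr p\<close> away from \<open>t = 0\<close>. The gap above the tangent is
  positive for \<open>t \<noteq> 0\<close> and grows like \<open>\<bar>t\<bar> powr p\<close>, so a compactness argument bounds it below by a
  multiple of \<open>\<bar>t\<bar> powr p\<close> wherever \<open>\<bar>t\<bar> powr p \<ge> \<kappa>\<close>. Subtracting \<open>\<kappa>\<close> makes the estimate trivial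
  for the remaining \<open>t\<close>, and in this form it holds for all \<open>p > 1\<close>, not only for \<open>p \<ge> 2\<close>.
\<close>

lemma powr_tangent_gap:
  fixes p \<kappa> :: real
  assumes p: "1 < p" and \<kappa>: "0 < \<kappa>"
  shows "\<exists>c>0. \<forall>t::real. 1 + p * t + c * (\<bar>t\<bar> powr p - \<kappa>) \<le> \<bar>1 + t\<bar> powr p"
proof -
  define g where "g t = \<bar>1 + t\<bar> powr p - 1 - p * t" for t :: real
  have "\<forall>\<^sub>F t in at_top. t powr p / 2 \<le> (1 + t) powr p - 1 - p * t"
    using p by real_asymp
  then obtain R1 where R1: "\<And>t. t \<ge> R1 \<Longrightarrow> t powr p / 2 \<le> (1 + t) powr p - 1 - p * t"
    unfolding eventually_at_top_linorder by blast
  have "\<forall>\<^sub>F t in at_top. t powr p / 2 \<le> (t - 1) powr p - 1 + p * t"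
    using p by real_asymp
  then obtain R2 where R2: "\<And>t. t \<ge> R2 \<Longrightarrow> t powr p / 2 \<le> (t - 1) powr p - 1 + p * t"
    unfolding eventually_at_top_linorder by blast
  define R where "R = max (max R1 R2) 1"
  have far: "\<bar>t\<bar> powr p / 2 \<le> g t" if "\<bar>t\<bar> \<ge> R" for t
  proof (cases "t \<ge> 0")
    case True
    then show ?thesis using R1[of t] that by (simp add: R_def g_def)
  next
    case False
    then have "\<bar>1 + t\<bar> = - t - 1" using that by (simp add: R_def)
    then have "g t = (- t - 1) powr p - 1 + p * (- t)" by (simp add: g_def)
    then show ?thesis using R2[of "- t"] that False by (simp add: R_def)
  qed
  define \<delta> where "\<delta> = \<kappa> powr (1 / p)"
  have \<delta>: "\<delta> > 0" "\<delta> powr p = \<kappa>" using \<kappa> p by (auto simp: \<delta>_def powr_powr)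
  have gpos: "g t > 0" if "t \<noteq> 0" for t using powr_above_tangent[OF p that] by (simp add: g_def)
  have g0: "g t \<ge> 0" for t using gpos[of t] by (cases "t = 0") (auto simp: g_def)
  define I where "I = cball (0::real) R - ball 0 \<delta>"
  have "compact I" unfolding I_def by (intro compact_diff) auto
  have nz: "t \<noteq> 0" if "t \<in> I" for t using that \<delta> by (auto simp: I_def)
  have "continuous_on I (\<lambda>t. g t / \<bar>t\<bar> powr p)"
    unfolding g_def using p nz by (intro continuous_intros continuous_on_powr') auto
  have "\<exists>c>0. \<forall>t\<in>I. c \<le> g t / \<bar>t\<bar> powr p"
  proof (cases "I = {}")
    case False
    then obtain t0 where t0: "t0 \<in> I" "\<forall>t\<in>I. g t0 / \<bar>t0\<bar> powr p \<le> g t / \<bar>t\<bar> powr p"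
      using continuous_attains_inf[OF \<open>compact I\<close> False \<open>continuous_on I _\<close>] by blast
    moreover have "g t0 / \<bar>t0\<bar> powr p > 0" using gpos nz t0 by simp
    ultimately show ?thesis by blast
  qed (auto intro: exI[of _ 1])
  then obtain c where c: "c > 0" "\<And>t. t \<in> I \<Longrightarrow> c \<le> g t / \<bar>t\<bar> powr p" by blast
  define c' where "c' = min c (1/2)"
  have "c' > 0" using c by (simp add: c'_def)
  moreover have "c' * (\<bar>t\<bar> powr p - \<kappa>) \<le> g t" for t
  proof -
    consider "\<bar>t\<bar> < \<delta>" | "t \<in> I" | "\<bar>t\<bar> \<ge> R" by (force simp: I_def dist_real_def)
    then show ?thesis
    proof cases
      case 1
      then have "\<bar>t\<bar> powr p \<le> \<kappa>" using powr_mono2[of p "\<bar>t\<bar>" \<delta>] \<delta> p by simp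
      then have "c' * (\<bar>t\<bar> powr p - \<kappa>) \<le> 0" using \<open>c' > 0\<close> by (simp add: mult_nonneg_nonpos)
      then show ?thesis using g0[of t] by simp
    next
      case 2
      then have "c * \<bar>t\<bar> powr p \<le> g t" using c(2)[OF 2] nz[OF 2] by (simp add: field_simps)
      moreover have "c' * (\<bar>t\<bar> powr p - \<kappa>) \<le> c' * \<bar>t\<bar> powr p"
        using \<open>c' > 0\<close> \<kappa> by simp
      moreover have "c' * \<bar>t\<bar> powr p \<le> c * \<bar>t\<bar> powr p"
        by (intro mult_right_mono) (auto simp: c'_def)
      ultimately show ?thesis by linarith
    next
      case 3
      moreover have "c' * (\<bar>t\<bar> powr p - \<kappa>) \<le> c' * \<bar>t\<bar> powr p"
        using \<open>c' > 0\<close> \<kappa> by simp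
      moreover have "c' * \<bar>t\<bar> powr p \<le> 1/2 * \<bar>t\<bar> powr p"
        by (intro mult_right_mono) (auto simp: c'_def)
      ultimately show ?thesis using far[OF 3] by linarith
    qed
  qed
  ultimately show ?thesis unfolding g_def by (intro exI[of _ c']) (auto simp: algebra_simps)
qed

lemma powr_rescale:
  fixes p x t :: real
  assumes "x \<noteq> 0"
  shows "\<bar>x\<bar> powr p * \<bar>1 + t / x\<bar> powr p = \<bar>x + t\<bar> powr p"
    and "\<bar>x\<bar> powr p * (t / x) = sgn x * \<bar>x\<bar> powr (p - 1) * t"
proof -
  have "x * (1 + t / x) = x + t" using assms by (simp add: field_simps)
  then show "\<bar>x\<bar> powr p * \<bar>1 + t / x\<bar> powr p = \<bar>x + t\<bar> powr p"
    by (simp add: powr_mult[symmetric] abs_mult[symmetric])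
  show "\<bar>x\<bar> powr p * (t / x) = sgn x * \<bar>x\<bar> powr (p - 1) * t"
    using assms by (cases "x > 0") (auto simp: powr_diff field_simps)
qed

lemma powr_tangent_gap_scaled:
  fixes p \<kappa> :: real
  assumes p: "1 < p" and \<kappa>: "0 < \<kappa>"
  shows "\<exists>c>0. \<forall>x t::real. \<bar>x\<bar> powr p + p * sgn x * \<bar>x\<bar> powr (p - 1) * t
           + c * (\<bar>t\<bar> powr p - \<kappa> * \<bar>x\<bar> powr p) \<le> \<bar>x + t\<bar> powr p"
proof -
  obtain c0 where c0: "c0 > 0" "\<And>t::real. 1 + p * t + c0 * (\<bar>t\<bar> powr p - \<kappa>) \<le> \<bar>1 + t\<bar> powr p"
    using powr_tangent_gap[OF assms] by blast
  define c where "c = min c0 1"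
  have "\<bar>x\<bar> powr p + p * sgn x * \<bar>x\<bar> powr (p - 1) * t
           + c * (\<bar>t\<bar> powr p - \<kappa> * \<bar>x\<bar> powr p) \<le> \<bar>x + t\<bar> powr p" for x t :: real
  proof (cases "x = 0")
    case True
    have "c * \<bar>t\<bar> powr p \<le> 1 * \<bar>t\<bar> powr p" by (intro mult_right_mono) (auto simp: c_def)
    then show ?thesis using True by simp
  next
    case False
    have "1 + p * s + c * (\<bar>s\<bar> powr p - \<kappa>) \<le> \<bar>1 + s\<bar> powr p" for s :: real
    proof (cases "\<bar>s\<bar> powr p \<ge> \<kappa>")
      case True
      then have "c * (\<bar>s\<bar> powr p - \<kappa>) \<le> c0 * (\<bar>s\<bar> powr p - \<kappa>)"
        by (intro mult_right_mono) (auto simp: c_def)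
      then show ?thesis using c0(2)[of s] by linarith
    next
      case False
      then have "c * (\<bar>s\<bar> powr p - \<kappa>) \<le> 0" using c0 by (simp add: c_def mult_nonneg_nonpos)
      moreover have "1 + p * s \<le> \<bar>1 + s\<bar> powr p"
        using powr_above_tangent[OF p, of s] by (cases "s = 0") auto
      ultimately show ?thesis by linarith
    qed
    from mult_left_mono[OF this[of "t / x"], of "\<bar>x\<bar> powr p"]
    have *: "\<bar>x\<bar> powr p * (1 + p * (t / x) + c * (\<bar>t / x\<bar> powr p - \<kappa>))
               \<le> \<bar>x\<bar> powr p * \<bar>1 + t / x\<bar> powr p" by simp
    note powr_rescale[OF False, of p t]
    moreover have "\<bar>x\<bar> powr p * \<bar>t / x\<bar> powr p = \<bar>t\<bar> powr p"
      using False by (simp add: powr_mult[symmetric])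
    moreover have "\<bar>x\<bar> powr p * (1 + p * (t / x) + c * (\<bar>t / x\<bar> powr p - \<kappa>))
      = \<bar>x\<bar> powr p + p * (\<bar>x\<bar> powr p * (t / x)) + c * (\<bar>x\<bar> powr p * \<bar>t / x\<bar> powr p - \<kappa> * \<bar>x\<bar> powr p)"
      by (simp only: distrib_left right_diff_distrib mult_1_right mult_ac)
    ultimately show ?thesis using * by (simp only: mult.assoc)
  qed
  moreover have "c > 0" using c0 by (simp add: c_def)
  ultimately show ?thesis by blast
qed

lemma powr_young:
  fixes p \<epsilon> :: real
  assumes p: "1 < p" and \<epsilon>: "0 < \<epsilon>"
  shows "\<exists>C\<ge>0. \<forall>x y::real. p * \<bar>x\<bar> powr (p - 1) * \<bar>y\<bar> \<le> \<epsilon> * \<bar>x\<bar> powr p + C * \<bar>y\<bar> powr p"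
proof -
  define C where "C = p * (p / \<epsilon>) powr (p - 1)"
  have C0: "C \<ge> 0" using p by (simp add: C_def)
  have pw: "\<bar>z\<bar> powr (p - 1) * \<bar>z\<bar> = \<bar>z\<bar> powr p" for z :: real
    by (cases "z = 0") (auto simp: powr_diff)
  have "p * \<bar>x\<bar> powr (p - 1) * \<bar>y\<bar> \<le> \<epsilon> * \<bar>x\<bar> powr p + C * \<bar>y\<bar> powr p" for x y :: real
  proof (cases "p * \<bar>y\<bar> \<le> \<epsilon> * \<bar>x\<bar>")
    case True
    then have "\<bar>x\<bar> powr (p - 1) * (p * \<bar>y\<bar>) \<le> \<bar>x\<bar> powr (p - 1) * (\<epsilon> * \<bar>x\<bar>)"
      by (intro mult_left_mono) auto
    moreover have "0 \<le> C * \<bar>y\<bar> powr p" using C0 by simp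
    ultimately show ?thesis using pw[of x] by (simp add: mult_ac)
  next
    case False
    then have "\<bar>x\<bar> \<le> p / \<epsilon> * \<bar>y\<bar>" using \<epsilon> by (simp add: field_simps)
    then have "\<bar>x\<bar> powr (p - 1) \<le> (p / \<epsilon> * \<bar>y\<bar>) powr (p - 1)"
      using p by (intro powr_mono2) auto
    also have "\<dots> = (p / \<epsilon>) powr (p - 1) * \<bar>y\<bar> powr (p - 1)"
      using p \<epsilon> by (intro powr_mult)
    finally have "p * \<bar>x\<bar> powr (p - 1) * \<bar>y\<bar> \<le> p * ((p / \<epsilon>) powr (p - 1) * \<bar>y\<bar> powr (p - 1)) * \<bar>y\<bar>"
      using p by (intro mult_right_mono mult_left_mono) auto
    also have "\<dots> = C * \<bar>y\<bar> powr p" by (simp add: C_def mult.assoc pw)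
    finally show ?thesis using \<epsilon> by (smt (verit) mult_nonneg_nonneg powr_ge_zero)
  qed
  then show ?thesis using C0 by blast
qed

text \<open>
  The \<open>p\<close>-th power version of the identity \<open>mean (f\<^sup>2) = x\<^sup>2 + mean ((f - x)\<^sup>2)\<close> for \<open>mean f = x\<close>: moving
  from \<open>x\<close> to a random point with mean close to \<open>x\<close> increases the expected \<open>p\<close>-th power by a definite
  multiple of the \<open>p\<close>-th moment of the increment. The error terms are a small multiple of
  \<open>\<bar>x\<bar> powr p\<close> and the deviation of the mean from \<open>x\<close>.
\<close>

lemma powr_mean_increment:
  fixes p K :: real
  assumes p: "1 < p" and K: "0 < K"
  shows "\<exists>c>0. \<exists>C\<ge>0. \<forall>(S::'s set) f (x::real). finite S \<longrightarrow> S \<noteq> {} \<longrightarrow>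
           \<bar>x\<bar> powr p + c * ((\<Sum>s\<in>S. \<bar>f s - x\<bar> powr p) / card S)
             \<le> (\<Sum>s\<in>S. \<bar>f s\<bar> powr p) / card S + c / (2 * K) * \<bar>x\<bar> powr p
               + C * \<bar>(\<Sum>s\<in>S. f s) / card S - x\<bar> powr p"
proof -
  obtain c where c: "c > 0" "\<And>x t::real. \<bar>x\<bar> powr p + p * sgn x * \<bar>x\<bar> powr (p - 1) * t
           + c * (\<bar>t\<bar> powr p - 1 / (4 * K) * \<bar>x\<bar> powr p) \<le> \<bar>x + t\<bar> powr p"
    using powr_tangent_gap_scaled[OF p, of "1 / (4 * K)"] K by auto
  obtain C where C: "C \<ge> 0" "\<And>x y::real. p * \<bar>x\<bar> powr (p - 1) * \<bar>y\<bar> \<le> c / (4 * K) * \<bar>x\<bar> powr p + C * \<bar>y\<bar> powr p"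
    using powr_young[OF p, of "c / (4 * K)"] K c by auto
  have "\<bar>x\<bar> powr p + c * ((\<Sum>s\<in>S. \<bar>f s - x\<bar> powr p) / card S)
             \<le> (\<Sum>s\<in>S. \<bar>f s\<bar> powr p) / card S + c / (2 * K) * \<bar>x\<bar> powr p
               + C * \<bar>(\<Sum>s\<in>S. f s) / card S - x\<bar> powr p"
    if S: "finite S" "S \<noteq> {}" for S :: "'s set" and f and x :: real
  proof -
    define n where "n = real (card S)"
    have n: "n > 0" using S by (simp add: n_def card_gt_0_iff)
    define y where "y = (\<Sum>s\<in>S. f s) / n - x"
    define b where "b = p * sgn x * \<bar>x\<bar> powr (p - 1)"
    have "(\<Sum>s\<in>S. \<bar>x\<bar> powr p + b * (f s - x) + c * (\<bar>f s - x\<bar> powr p - 1 / (4 * K) * \<bar>x\<bar> powr p))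
            \<le> (\<Sum>s\<in>S. \<bar>x + (f s - x)\<bar> powr p)"
      unfolding b_def by (intro sum_mono c)
    also have "(\<Sum>s\<in>S. \<bar>x\<bar> powr p + b * (f s - x) + c * (\<bar>f s - x\<bar> powr p - 1 / (4 * K) * \<bar>x\<bar> powr p))
       = n * \<bar>x\<bar> powr p + b * (n * y) + c * (\<Sum>s\<in>S. \<bar>f s - x\<bar> powr p) - n * (c / (4 * K) * \<bar>x\<bar> powr p)"
      using n by (simp add: sum.distrib sum_subtractf sum_distrib_left[symmetric] n_def[symmetric] y_def algebra_simps)
    finally have "(n * \<bar>x\<bar> powr p + b * (n * y) + c * (\<Sum>s\<in>S. \<bar>f s - x\<bar> powr p) - n * (c / (4 * K) * \<bar>x\<bar> powr p)) / n
      \<le> (\<Sum>s\<in>S. \<bar>f s\<bar> powr p) / n" using n by (intro divide_right_mono) auto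
    also have "(n * \<bar>x\<bar> powr p + b * (n * y) + c * (\<Sum>s\<in>S. \<bar>f s - x\<bar> powr p) - n * (c / (4 * K) * \<bar>x\<bar> powr p)) / n
       = \<bar>x\<bar> powr p + b * y + c * ((\<Sum>s\<in>S. \<bar>f s - x\<bar> powr p) / n) - c / (4 * K) * \<bar>x\<bar> powr p"
      using n by (simp add: field_simps)
    finally have "\<bar>x\<bar> powr p + b * y + c * ((\<Sum>s\<in>S. \<bar>f s - x\<bar> powr p) / n) - c / (4 * K) * \<bar>x\<bar> powr p
      \<le> (\<Sum>s\<in>S. \<bar>f s\<bar> powr p) / n" .
    moreover have "- (b * y) \<le> c / (4 * K) * \<bar>x\<bar> powr p + C * \<bar>y\<bar> powr p"
    proof -
      have "- (b * y) \<le> \<bar>b * y\<bar>" by simp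
      also have "\<dots> \<le> p * \<bar>x\<bar> powr (p - 1) * \<bar>y\<bar>"
        using p by (auto simp: b_def abs_mult sgn_if)
      finally show ?thesis using C(2)[of x y] by linarith
    qed
    moreover have "c / (2 * K) * \<bar>x\<bar> powr p = c / (4 * K) * \<bar>x\<bar> powr p + c / (4 * K) * \<bar>x\<bar> powr p"
      by (simp add: field_simps)
    ultimately have "\<bar>x\<bar> powr p + c * ((\<Sum>s\<in>S. \<bar>f s - x\<bar> powr p) / n)
      \<le> (\<Sum>s\<in>S. \<bar>f s\<bar> powr p) / n + c / (2 * K) * \<bar>x\<bar> powr p + C * \<bar>y\<bar> powr p"
      by linarith
    then show ?thesis unfolding n_def y_def .
  qed
  then show ?thesis using c(1) C(1) by blast
qed

text \<open>
  Jensen's inequality for the convex function \<open>\<bar>\<cdot> - y\<bar> powr p\<close> and a finite uniform average.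
\<close>

lemma powr_mean_convex:
  fixes p :: real and f :: "'s \<Rightarrow> real"
  assumes p: "1 < p" and "finite S" "S \<noteq> {}"
  shows "\<bar>(\<Sum>s\<in>S. f s) / card S - y\<bar> powr p \<le> (\<Sum>s\<in>S. \<bar>f s - y\<bar> powr p) / card S"
proof -
  define n where "n = real (card S)"
  have n: "n > 0" using assms by (simp add: n_def card_gt_0_iff)
  define x where "x = (\<Sum>s\<in>S. f s) / n - y"
  define b where "b = p * sgn x * \<bar>x\<bar> powr (p - 1)"
  have tangent: "\<bar>x\<bar> powr p + b * t \<le> \<bar>x + t\<bar> powr p" for t
  proof (cases "x = 0")
    case False
    have "1 + p * (t / x) \<le> \<bar>1 + t / x\<bar> powr p"
      using powr_above_tangent[OF p, of "t / x"] False by (cases "t = 0") auto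
    from mult_left_mono[OF this, of "\<bar>x\<bar> powr p"]
    have *: "\<bar>x\<bar> powr p * (1 + p * (t / x)) \<le> \<bar>x\<bar> powr p * \<bar>1 + t / x\<bar> powr p" by simp
    note powr_rescale[OF False, of p t]
    moreover have "\<bar>x\<bar> powr p * (1 + p * (t / x)) = \<bar>x\<bar> powr p + p * (\<bar>x\<bar> powr p * (t / x))"
      by (simp add: distrib_left)
    ultimately show ?thesis using * by (simp only: b_def mult.assoc)
  qed (auto simp: b_def)
  have "(\<Sum>s\<in>S. \<bar>x\<bar> powr p + b * (f s - y - x)) \<le> (\<Sum>s\<in>S. \<bar>x + (f s - y - x)\<bar> powr p)"
    by (intro sum_mono tangent)
  also have "(\<Sum>s\<in>S. \<bar>x\<bar> powr p + b * (f s - y - x)) = n * \<bar>x\<bar> powr p"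
    using n by (simp add: sum.distrib sum_subtractf sum_distrib_left[symmetric] n_def[symmetric] x_def algebra_simps)
  finally have "n * \<bar>x\<bar> powr p \<le> (\<Sum>s\<in>S. \<bar>f s - y\<bar> powr p)" by simp
  then have "\<bar>x\<bar> powr p \<le> (\<Sum>s\<in>S. \<bar>f s - y\<bar> powr p) / n" using n by (simp add: field_simps)
  then show ?thesis unfolding x_def n_def .
qed

section \<open>Distances in \<open>L\<^sup>p\<close> and averages over random walks\<close>

text \<open>
  The \<open>p\<close>-th power of the \<open>L\<^sup>p\<close>-distance of two functions. Working with powers of distances
  replaces the triangle inequality by a version with the factor \<open>2 powr p\<close>, but makes every estimate
  below the integral of a pointwise inequality.
\<close>

definition Lp_pow :: "real \<Rightarrow> 'b measure \<Rightarrow> ('b \<Rightarrow> real) \<Rightarrow> ('b \<Rightarrow> real) \<Rightarrow> real" where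
  "Lp_pow p M f g = (LINT x|M. \<bar>f x - g x\<bar> powr p)"

lemma Lp_fun_lincomb:
  assumes "0 < p" "f \<in> Lp_fun p M" "g \<in> Lp_fun p M"
  shows "(\<lambda>x. a * f x + b * g x) \<in> Lp_fun p M"
proof -
  have [measurable]: "f \<in> borel_measurable M" "g \<in> borel_measurable M"
    and int: "integrable M (\<lambda>x. \<bar>f x\<bar> powr p)" "integrable M (\<lambda>x. \<bar>g x\<bar> powr p)"
    using assms by (auto simp: Lp_fun_def)
  have "integrable M (\<lambda>x. 2 powr p * (\<bar>a\<bar> powr p * \<bar>f x\<bar> powr p + \<bar>b\<bar> powr p * \<bar>g x\<bar> powr p))"
    using int by auto
  then have "integrable M (\<lambda>x. \<bar>a * f x + b * g x\<bar> powr p)"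
  proof (rule Bochner_Integration.integrable_bound)
    show "AE x in M. norm (\<bar>a * f x + b * g x\<bar> powr p)
            \<le> norm (2 powr p * (\<bar>a\<bar> powr p * \<bar>f x\<bar> powr p + \<bar>b\<bar> powr p * \<bar>g x\<bar> powr p))"
      using powr_abs_triangle[OF assms(1)]
      by (intro AE_I2) (simp add: powr_mult[symmetric] abs_mult[symmetric])
  qed measurable
  then show ?thesis by (simp add: Lp_fun_def)
qed

lemma Lp_pow_integrable:
  assumes "0 < p" "f \<in> Lp_fun p M" "g \<in> Lp_fun p M"
  shows "integrable M (\<lambda>x. \<bar>f x - g x\<bar> powr p)"
  using Lp_fun_lincomb[OF assms, of 1 "-1"] by (simp add: Lp_fun_def)

lemma Lp_pow_nonneg: "0 \<le> Lp_pow p M f g"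
  by (simp add: Lp_pow_def)

lemma Lp_pow_same: "Lp_pow p M f f = 0"
  by (simp add: Lp_pow_def)

lemma Lp_pow_commute: "Lp_pow p M f g = Lp_pow p M g f"
  by (simp add: Lp_pow_def abs_minus_commute)

lemma Lp_pow_triangle:
  assumes p: "0 < p" and fgh: "f \<in> Lp_fun p M" "g \<in> Lp_fun p M" "h \<in> Lp_fun p M"
  shows "Lp_pow p M f h \<le> 2 powr p * (Lp_pow p M f g + Lp_pow p M g h)"
proof -
  have int: "integrable M (\<lambda>x. \<bar>f x - g x\<bar> powr p)" "integrable M (\<lambda>x. \<bar>g x - h x\<bar> powr p)"
    "integrable M (\<lambda>x. \<bar>f x - h x\<bar> powr p)"
    using assms by (auto intro: Lp_pow_integrable)
  have "Lp_pow p M f h \<le> (LINT x|M. 2 powr p * (\<bar>f x - g x\<bar> powr p + \<bar>g x - h x\<bar> powr p))"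
    unfolding Lp_pow_def
    using int powr_abs_triangle[OF p, of "f x - g x" "g x - h x" for x]
    by (intro integral_mono) auto
  also have "\<dots> = 2 powr p * (Lp_pow p M f g + Lp_pow p M g h)"
    using int by (simp add: Lp_pow_def)
  finally show ?thesis .
qed

text \<open>
  The Markov operator of the random walk on \<open>G\<close> whose steps are right multiplications by uniformly
  chosen elements of \<open>S\<close>.
\<close>

definition step_avg :: "('a, 'c) monoid_scheme \<Rightarrow> 'a set \<Rightarrow> ('a \<Rightarrow> real) \<Rightarrow> 'a \<Rightarrow> real" where
  "step_avg G S \<phi> g = (\<Sum>s\<in>S. \<phi> (g \<otimes>\<^bsub>G\<^esub> s)) / card S"

text \<open>
  A finite set \<open>S\<close> of steps in a group. It need be neither symmetric nor generating.
\<close>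

locale walk = group G for G :: "'a monoid" (structure) +
  fixes S :: "'a set"
  assumes finS: "finite S" and neS: "S \<noteq> {}" and SG: "S \<subseteq> carrier G"
begin

abbreviation "P \<equiv> step_avg G S"

lemma cardS: "real (card S) > 0"
  using finS neS by (simp add: card_gt_0_iff)

lemma walk_Suc: "(P ^^ Suc m) \<phi> g = (\<Sum>s\<in>S. (P ^^ m) \<phi> (g \<otimes> s)) / card S"
  by (simp add: step_avg_def)

lemma step_mono:
  assumes "\<And>u. u \<in> carrier G \<Longrightarrow> \<phi> u \<le> \<psi> u" "g \<in> carrier G"
  shows "P \<phi> g \<le> P \<psi> g"
  unfolding step_avg_def using assms SG cardS by (intro divide_right_mono sum_mono) auto

lemma walk_mono:
  assumes "\<And>u. u \<in> carrier G \<Longrightarrow> \<phi> u \<le> \<psi> u" "g \<in> carrier G"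
  shows "(P ^^ m) \<phi> g \<le> (P ^^ m) \<psi> g"
  using assms(2)
proof (induction m arbitrary: g)
  case (Suc m)
  then show ?case by (auto intro: step_mono)
qed (use assms in auto)

lemma walk_lincomb:
  "(P ^^ m) (\<lambda>u. a * \<phi> u + b * \<psi> u) g = a * (P ^^ m) \<phi> g + b * (P ^^ m) \<psi> g"
proof (induction m arbitrary: g)
  case (Suc m)
  then show ?case
    by (simp add: step_avg_def sum.distrib sum_distrib_left[symmetric] add_divide_distrib)
qed simp

lemma walk_const: "(P ^^ m) (\<lambda>u. c) g = c"
proof (induction m arbitrary: g)
  case (Suc m)
  then show ?case using cardS by (simp add: step_avg_def)
qed simp

lemma walk_nonneg:
  assumes "\<And>u. u \<in> carrier G \<Longrightarrow> 0 \<le> \<phi> u" "g \<in> carrier G"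
  shows "0 \<le> (P ^^ m) \<phi> g"
  using walk_mono[of "\<lambda>_. 0" \<phi> g m] assms by (simp add: walk_const)

lemma walk_sum: "(P ^^ m) (\<lambda>u. \<Sum>i\<in>I. \<phi> i u) g = (\<Sum>i\<in>I. (P ^^ m) (\<phi> i) g)"
proof (induction m arbitrary: g)
  case (Suc m)
  have "(P ^^ Suc m) (\<lambda>u. \<Sum>i\<in>I. \<phi> i u) g = (\<Sum>s\<in>S. \<Sum>i\<in>I. (P ^^ m) (\<phi> i) (g \<otimes> s)) / card S"
    unfolding walk_Suc Suc ..
  also have "\<dots> = (\<Sum>i\<in>I. (P ^^ Suc m) (\<phi> i) g)"
    unfolding walk_Suc by (subst sum.swap) (rule sum_divide_distrib)
  finally show ?case .
qed simp

lemma walk_shift: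
  assumes "a \<in> carrier G" "g \<in> carrier G"
  shows "(P ^^ m) \<phi> (a \<otimes> g) = (P ^^ m) (\<lambda>u. \<phi> (a \<otimes> u)) g"
  using assms(2)
proof (induction m arbitrary: g)
  case (Suc m)
  have "(\<Sum>s\<in>S. (P ^^ m) \<phi> (a \<otimes> g \<otimes> s)) = (\<Sum>s\<in>S. (P ^^ m) (\<lambda>u. \<phi> (a \<otimes> u)) (g \<otimes> s))"
  proof (rule sum.cong)
    fix s assume "s \<in> S"
    then have "s \<in> carrier G" using SG by auto
    then show "(P ^^ m) \<phi> (a \<otimes> g \<otimes> s) = (P ^^ m) (\<lambda>u. \<phi> (a \<otimes> u)) (g \<otimes> s)"
      using Suc.IH[of "g \<otimes> s"] Suc.prems assms(1) by (simp add: m_assoc)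
  qed simp
  then show ?case unfolding walk_Suc by simp
qed simp

lemma walk_integral:
  assumes "\<And>u. u \<in> carrier G \<Longrightarrow> integrable M (f u)" "g \<in> carrier G"
  shows "integrable M (\<lambda>x. (P ^^ m) (\<lambda>u. f u x) g)"
    and "(LINT x|M. (P ^^ m) (\<lambda>u. f u x) g) = (P ^^ m) (\<lambda>u. LINT x|M. f u x) g"
proof -
  have "integrable M (\<lambda>x. (P ^^ m) (\<lambda>u. f u x) g) \<and>
     (LINT x|M. (P ^^ m) (\<lambda>u. f u x) g) = (P ^^ m) (\<lambda>u. LINT x|M. f u x) g"
    using assms(2)
  proof (induction m arbitrary: g)
    case (Suc m)
    have *: "g \<otimes> s \<in> carrier G" if "s \<in> S" for s using that SG Suc.prems by auto
    show ?case using Suc.IH[OF *] by (simp add: step_avg_def)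
  qed (use assms in auto)
  then show "integrable M (\<lambda>x. (P ^^ m) (\<lambda>u. f u x) g)"
    and "(LINT x|M. (P ^^ m) (\<lambda>u. f u x) g) = (P ^^ m) (\<lambda>u. LINT x|M. f u x) g" by auto
qed

lemma walk_convex:
  assumes "1 < p" "g \<in> carrier G"
  shows "\<bar>(P ^^ m) \<phi> g - y\<bar> powr p \<le> (P ^^ m) (\<lambda>u. \<bar>\<phi> u - y\<bar> powr p) g"
  using assms(2)
proof (induction m arbitrary: g)
  case (Suc m)
  have "\<bar>(P ^^ Suc m) \<phi> g - y\<bar> powr p \<le> P (\<lambda>h. \<bar>(P ^^ m) \<phi> h - y\<bar> powr p) g"
    using powr_mean_convex[OF assms(1) finS neS, of "\<lambda>s. (P ^^ m) \<phi> (g \<otimes> s)" y]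
    by (simp add: step_avg_def)
  also have "\<dots> \<le> P (\<lambda>h. (P ^^ m) (\<lambda>u. \<bar>\<phi> u - y\<bar> powr p) h) g"
    using Suc by (intro step_mono) auto
  finally show ?case by simp
qed simp

end

section \<open>Invariant families of maps from a group to \<open>L\<^sup>p\<close>\<close>

text \<open>
  A class \<open>\<C>\<close> of maps from \<open>G\<close> to \<open>L\<^sup>p(M)\<close>, closed under affine combinations and right translations.
  The functional \<open>\<Sum>t\<in>T. Lp_pow p M (F t) (F' t)\<close> is required to be invariant under right translation
  of both maps. For maps that are equivariant under a finite index subgroup with transversal \<open>T\<close>, it
  is the \<open>p\<close>-th power of the norm distance in the induced representation.
\<close>

locale Lp_maps = walk G S for G :: "'a monoid" (structure) and S +
  fixes p :: real and M :: "'b measure" and T :: "'a set" and \<C> :: "('a \<Rightarrow> 'b \<Rightarrow> real) set"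
  assumes p: "1 < p" and finT: "finite T" and TG: "T \<subseteq> carrier G"
    and Lp: "\<And>F g. F \<in> \<C> \<Longrightarrow> g \<in> carrier G \<Longrightarrow> F g \<in> Lp_fun p M"
    and affine: "\<And>F F' t. F \<in> \<C> \<Longrightarrow> F' \<in> \<C> \<Longrightarrow> (\<lambda>g x. (1 - t) * F g x + t * F' g x) \<in> \<C>"
    and translate: "\<And>F a. F \<in> \<C> \<Longrightarrow> a \<in> carrier G \<Longrightarrow> (\<lambda>g. F (g \<otimes> a)) \<in> \<C>"
    and invariance: "\<And>F F' a. F \<in> \<C> \<Longrightarrow> F' \<in> \<C> \<Longrightarrow> a \<in> carrier G \<Longrightarrow>
          (\<Sum>t\<in>T. Lp_pow p M (F (t \<otimes> a)) (F' (t \<otimes> a))) = (\<Sum>t\<in>T. Lp_pow p M (F t) (F' t))"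
begin

text \<open>
  The \<open>p\<close>-th power of the distance between two maps of the class.
\<close>

definition dpow :: "('a \<Rightarrow> 'b \<Rightarrow> real) \<Rightarrow> ('a \<Rightarrow> 'b \<Rightarrow> real) \<Rightarrow> real" where
  "dpow F F' = (\<Sum>t\<in>T. Lp_pow p M (F t) (F' t))"

text \<open>
  Right translation.
\<close>

definition rt :: "'a \<Rightarrow> ('a \<Rightarrow> 'b \<Rightarrow> real) \<Rightarrow> 'a \<Rightarrow> 'b \<Rightarrow> real" where
  "rt a F = (\<lambda>g. F (g \<otimes> a))"

text \<open>
  The displacement between the translates of \<open>F\<close> by \<open>a\<close> and \<open>b\<close>; it is invariant under left
  multiplication of \<open>a\<close> and \<open>b\<close> (\<open>\<Delta>_left\<close>).
\<close>

definition \<Delta> :: "('a \<Rightarrow> 'b \<Rightarrow> real) \<Rightarrow> 'a \<Rightarrow> 'a \<Rightarrow> real" where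
  "\<Delta> F a b = dpow (rt a F) (rt b F)"

text \<open>
  The expected displacement of \<open>F\<close> after \<open>m\<close> steps of the random walk.
\<close>

definition energy :: "nat \<Rightarrow> ('a \<Rightarrow> 'b \<Rightarrow> real) \<Rightarrow> real" where
  "energy m F = (P ^^ m) (\<lambda>u. \<Delta> F \<one> u) \<one>"

text \<open>
  The random walk operator acting on maps, pointwise on \<open>M\<close>.
\<close>

definition avg :: "('a \<Rightarrow> 'b \<Rightarrow> real) \<Rightarrow> 'a \<Rightarrow> 'b \<Rightarrow> real" where
  "avg F = (\<lambda>g x. P (\<lambda>h. F h x) g)"

lemma rt_closed: "F \<in> \<C> \<Longrightarrow> a \<in> carrier G \<Longrightarrow> rt a F \<in> \<C>"
  unfolding rt_def by (rule translate)

lemma Lp_T: "F \<in> \<C> \<Longrightarrow> t \<in> T \<Longrightarrow> F t \<in> Lp_fun p M"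
  using Lp TG by auto

lemma dpow_nonneg: "0 \<le> dpow F F'"
  by (simp add: dpow_def sum_nonneg Lp_pow_nonneg)

lemma dpow_same: "dpow F F = 0"
  by (simp add: dpow_def Lp_pow_same)

lemma dpow_commute: "dpow F F' = dpow F' F"
  by (simp add: dpow_def Lp_pow_commute)

lemma dpow_triangle:
  assumes "F \<in> \<C>" "F' \<in> \<C>" "F'' \<in> \<C>"
  shows "dpow F F'' \<le> 2 powr p * (dpow F F' + dpow F' F'')"
  unfolding dpow_def sum.distrib[symmetric] sum_distrib_left
  using assms Lp_T p by (intro sum_mono Lp_pow_triangle) auto

lemma dpow_rt: "F \<in> \<C> \<Longrightarrow> F' \<in> \<C> \<Longrightarrow> a \<in> carrier G \<Longrightarrow> dpow (rt a F) (rt a F') = dpow F F'"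
  using invariance by (simp add: dpow_def rt_def)

lemma rt_one_T: "t \<in> T \<Longrightarrow> rt \<one> F t = F t"
  using TG by (auto simp: rt_def)

lemma \<Delta>_nonneg: "0 \<le> \<Delta> F a b"
  by (simp add: \<Delta>_def dpow_nonneg)

lemma \<Delta>_one: "\<Delta> F \<one> b = dpow F (rt b F)"
  by (simp add: \<Delta>_def dpow_def rt_one_T cong: sum.cong)

lemma \<Delta>_left:
  assumes "F \<in> \<C>" "a \<in> carrier G" "b \<in> carrier G" "g \<in> carrier G"
  shows "\<Delta> F (g \<otimes> a) (g \<otimes> b) = \<Delta> F a b"
proof -
  have "dpow (rt (g \<otimes> a) F) (rt (g \<otimes> b) F) = dpow (rt g (rt a F)) (rt g (rt b F))"
    unfolding dpow_def using TG assms by (intro sum.cong) (auto simp: rt_def m_assoc subset_eq)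
  then show ?thesis using assms by (simp add: \<Delta>_def dpow_rt rt_closed)
qed

lemma \<Delta>_triangle:
  assumes "F \<in> \<C>" "a \<in> carrier G" "b \<in> carrier G" "c \<in> carrier G"
  shows "\<Delta> F a c \<le> 2 powr p * (\<Delta> F a b + \<Delta> F b c)"
  unfolding \<Delta>_def by (intro dpow_triangle rt_closed assms)

lemma energy_nonneg: "0 \<le> energy m F"
  unfolding energy_def by (intro walk_nonneg) (auto simp: \<Delta>_nonneg)

lemma energy_one: "energy 1 F = (\<Sum>s\<in>S. \<Delta> F \<one> s) / card S"
proof -
  have "(\<Sum>s\<in>S. \<Delta> F \<one> (\<one> \<otimes> s)) = (\<Sum>s\<in>S. \<Delta> F \<one> s)"
    using SG by (intro sum.cong) auto
  then show ?thesis by (simp add: energy_def step_avg_def)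
qed

lemma mean_closed:
  assumes "finite I" "I \<noteq> {}" "\<And>i. i \<in> I \<Longrightarrow> Fi i \<in> \<C>"
  shows "(\<lambda>g x. (\<Sum>i\<in>I. Fi i g x) / card I) \<in> \<C>"
  using assms
proof (induction I rule: finite_ne_induct)
  case (singleton i)
  then show ?case by simp
next
  case (insert i I)
  define n where "n = real (card I)"
  have n: "n > 0" using insert by (simp add: n_def card_gt_0_iff)
  have "(\<lambda>g x. (1 - n / (n + 1)) * Fi i g x + n / (n + 1) * ((\<Sum>i\<in>I. Fi i g x) / card I)) \<in> \<C>"
    using insert by (intro affine) auto
  also have "(\<lambda>g x. (1 - n / (n + 1)) * Fi i g x + n / (n + 1) * ((\<Sum>i\<in>I. Fi i g x) / card I))
      = (\<lambda>g x. (\<Sum>i\<in>insert i I. Fi i g x) / card (insert i I))"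
  proof (intro ext)
    fix g x
    have "1 - n / (n + 1) = 1 / (n + 1)" "n / (n + 1) * (y / n) = y / (n + 1)" for y
      using n by (auto simp: divide_simps)
    then show "(1 - n / (n + 1)) * Fi i g x + n / (n + 1) * ((\<Sum>i\<in>I. Fi i g x) / card I)
      = (\<Sum>i\<in>insert i I. Fi i g x) / card (insert i I)"
      using insert by (simp add: n_def[symmetric] add_divide_distrib add.commute)
  qed
  finally show ?case .
qed

lemma avg_closed: "F \<in> \<C> \<Longrightarrow> avg F \<in> \<C>"
  using mean_closed[OF finS neS, of "\<lambda>s. rt s F"] SG rt_closed
  by (auto simp: avg_def step_avg_def rt_def)

lemma avg_pow_closed: "F \<in> \<C> \<Longrightarrow> (avg ^^ m) F \<in> \<C>"
  by (induction m) (auto intro: avg_closed)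

lemma avg_pow_apply: "(avg ^^ m) F g x = (P ^^ m) (\<lambda>h. F h x) g"
  by (induction m arbitrary: g) (auto simp: avg_def)

lemma dpow_avg_pow:
  assumes F: "F \<in> \<C>"
  shows "dpow ((avg ^^ m) F) F \<le> energy m F"
proof -
  have "Lp_pow p M ((avg ^^ m) F t) (F t) \<le> (P ^^ m) (\<lambda>u. Lp_pow p M (F t) (F (t \<otimes> u))) \<one>"
    if t: "t \<in> T" for t
  proof -
    have tG: "t \<in> carrier G" using t TG by auto
    have int: "integrable M (\<lambda>x. \<bar>F u x - F t x\<bar> powr p)" if "u \<in> carrier G" for u
      using that p by (intro Lp_pow_integrable Lp F tG) auto
    have "Lp_pow p M ((avg ^^ m) F t) (F t)
            \<le> (LINT x|M. (P ^^ m) (\<lambda>u. \<bar>F u x - F t x\<bar> powr p) t)"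
      unfolding Lp_pow_def avg_pow_apply
    proof (rule integral_mono)
      show "integrable M (\<lambda>x. \<bar>(P ^^ m) (\<lambda>h. F h x) t - F t x\<bar> powr p)"
        using Lp_pow_integrable[of p "(avg ^^ m) F t" M "F t"] Lp[OF avg_pow_closed[OF F] tG]
          Lp[OF F tG] p by (simp add: avg_pow_apply)
      show "integrable M (\<lambda>x. (P ^^ m) (\<lambda>u. \<bar>F u x - F t x\<bar> powr p) t)"
        by (intro walk_integral int tG)
    qed (intro walk_convex p tG)
    also have "\<dots> = (P ^^ m) (\<lambda>u. Lp_pow p M (F u) (F t)) t"
      by (simp add: walk_integral(2)[OF int tG] Lp_pow_def)
    also have "\<dots> = (P ^^ m) (\<lambda>u. Lp_pow p M (F t) (F (t \<otimes> u))) \<one>"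
      using walk_shift[OF tG one_closed, of m "\<lambda>u. Lp_pow p M (F u) (F t)"] tG
      by (simp add: Lp_pow_commute)
    finally show ?thesis .
  qed
  then have "dpow ((avg ^^ m) F) F \<le> (\<Sum>t\<in>T. (P ^^ m) (\<lambda>u. Lp_pow p M (F t) (F (t \<otimes> u))) \<one>)"
    unfolding dpow_def by (rule sum_mono)
  also have "\<dots> = energy m F"
    by (simp add: walk_sum[symmetric] energy_def \<Delta>_one dpow_def rt_def)
  finally show ?thesis .
qed

text \<open>
  Uniform convexity of \<open>L\<^sup>p\<close>: if \<open>F\<close> is almost harmonic, in the sense that \<open>avg F\<close> is close to \<open>F\<close>,
  then each step of the walk increases the energy by a constant multiple of the energy of a single
  step, up to a loss which is at most half of this increase as long as \<open>energy m F \<le> K * energy 1 F\<close>. By invariance the conditional energy of the next step does not depend on the present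
  position, which is why \<open>energy 1 F\<close> appears on the left.
\<close>

lemma energy_increment:
  assumes "0 < K"
  shows "\<exists>c>0. \<exists>C\<ge>0. \<forall>F\<in>\<C>. \<forall>m. energy m F + c * energy 1 F
           \<le> energy (Suc m) F + c / (2 * K) * energy m F + C * dpow (avg F) F"
proof -
  obtain c C where c: "c > 0" "C \<ge> 0" and all: "\<forall>(S :: 'a set) f (x::real). finite S \<longrightarrow> S \<noteq> {} \<longrightarrow>
     \<bar>x\<bar> powr p + c * ((\<Sum>s\<in>S. \<bar>f s - x\<bar> powr p) / card S)
             \<le> (\<Sum>s\<in>S. \<bar>f s\<bar> powr p) / card S + c / (2 * K) * \<bar>x\<bar> powr p
               + C * \<bar>(\<Sum>s\<in>S. f s) / card S - x\<bar> powr p"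
    using powr_mean_increment[OF p assms, where 's='a] by blast
  note ineq = all[rule_format, OF finS neS]
  have "\<forall>F\<in>\<C>. \<forall>m. energy m F + c * energy 1 F
           \<le> energy (Suc m) F + c / (2 * K) * energy m F + C * dpow (avg F) F"
  proof (intro ballI allI)
    fix F m assume F: "F \<in> \<C>"
    have u: "\<Delta> F \<one> u + c * energy 1 F
              \<le> P (\<lambda>v. \<Delta> F \<one> v) u + c / (2 * K) * \<Delta> F \<one> u + C * dpow (avg F) F"
      if uG: "u \<in> carrier G" for u
    proof -
      have t: "Lp_pow p M (F t) (F (t \<otimes> u)) + c * ((\<Sum>s\<in>S. Lp_pow p M (F (t \<otimes> u)) (F (t \<otimes> (u \<otimes> s)))) / card S)
         \<le> (\<Sum>s\<in>S. Lp_pow p M (F t) (F (t \<otimes> (u \<otimes> s)))) / card S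
           + c / (2 * K) * Lp_pow p M (F t) (F (t \<otimes> u))
           + C * Lp_pow p M (avg F (t \<otimes> u)) (F (t \<otimes> u))" if t: "t \<in> T" for t
      proof -
        have tG: "t \<in> carrier G" using t TG by auto
        have sG: "s \<in> carrier G" if "s \<in> S" for s using SG that by auto
        note L = Lp[OF F]
        have int1: "integrable M (\<lambda>x. \<bar>F (t \<otimes> u) x - F t x\<bar> powr p)"
          using tG uG p L by (intro Lp_pow_integrable) auto
        have int2: "integrable M (\<lambda>x. \<bar>F (t \<otimes> (u \<otimes> s)) x - F t x\<bar> powr p)" if "s \<in> S" for s
          using tG uG p L sG[OF that] by (intro Lp_pow_integrable) auto
        have int3: "integrable M (\<lambda>x. \<bar>F (t \<otimes> (u \<otimes> s)) x - F (t \<otimes> u) x\<bar> powr p)" if "s \<in> S" for s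
          using tG uG p L sG[OF that] by (intro Lp_pow_integrable) auto
        have int4: "integrable M (\<lambda>x. \<bar>avg F (t \<otimes> u) x - F (t \<otimes> u) x\<bar> powr p)"
          using tG uG p L Lp[OF avg_closed[OF F]] by (intro Lp_pow_integrable) auto
        have av: "avg F (t \<otimes> u) x = (\<Sum>s\<in>S. F (t \<otimes> (u \<otimes> s)) x) / card S" for x
          unfolding avg_def step_avg_def using tG uG sG
          by (intro arg_cong2[of _ _ _ _ "(/)"] sum.cong refl) (auto simp: m_assoc)
        have "(LINT x|M. \<bar>F (t \<otimes> u) x - F t x\<bar> powr p + c * ((\<Sum>s\<in>S. \<bar>F (t \<otimes> (u \<otimes> s)) x - F (t \<otimes> u) x\<bar> powr p) / card S))
           \<le> (LINT x|M. (\<Sum>s\<in>S. \<bar>F (t \<otimes> (u \<otimes> s)) x - F t x\<bar> powr p) / card S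
              + c / (2 * K) * \<bar>F (t \<otimes> u) x - F t x\<bar> powr p + C * \<bar>avg F (t \<otimes> u) x - F (t \<otimes> u) x\<bar> powr p)"
        proof (rule integral_mono)
          fix x
          have drift: "(\<Sum>s\<in>S. F (t \<otimes> (u \<otimes> s)) x - F t x) / card S - (F (t \<otimes> u) x - F t x)
             = avg F (t \<otimes> u) x - F (t \<otimes> u) x"
            using cardS by (simp add: av sum_subtractf field_simps)
          have step: "F (t \<otimes> (u \<otimes> s)) x - F t x - (F (t \<otimes> u) x - F t x)
             = F (t \<otimes> (u \<otimes> s)) x - F (t \<otimes> u) x" for s by simp
          show "\<bar>F (t \<otimes> u) x - F t x\<bar> powr p + c * ((\<Sum>s\<in>S. \<bar>F (t \<otimes> (u \<otimes> s)) x - F (t \<otimes> u) x\<bar> powr p) / card S)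
            \<le> (\<Sum>s\<in>S. \<bar>F (t \<otimes> (u \<otimes> s)) x - F t x\<bar> powr p) / card S
              + c / (2 * K) * \<bar>F (t \<otimes> u) x - F t x\<bar> powr p + C * \<bar>avg F (t \<otimes> u) x - F (t \<otimes> u) x\<bar> powr p"
            using ineq[of "F (t \<otimes> u) x - F t x" "\<lambda>s. F (t \<otimes> (u \<otimes> s)) x - F t x"]
            unfolding drift step .
        qed (use int1 int2 int3 int4 in auto)
        then show ?thesis
          using int1 int2 int3 int4
          by (simp add: Lp_pow_def abs_minus_commute)
      qed
      have "(\<Sum>t\<in>T. Lp_pow p M (F t) (F (t \<otimes> u)) + c * ((\<Sum>s\<in>S. Lp_pow p M (F (t \<otimes> u)) (F (t \<otimes> (u \<otimes> s)))) / card S))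
         \<le> (\<Sum>t\<in>T. (\<Sum>s\<in>S. Lp_pow p M (F t) (F (t \<otimes> (u \<otimes> s)))) / card S
           + c / (2 * K) * Lp_pow p M (F t) (F (t \<otimes> u))
           + C * Lp_pow p M (avg F (t \<otimes> u)) (F (t \<otimes> u)))"
        by (intro sum_mono t)
      also have "(\<Sum>t\<in>T. Lp_pow p M (F t) (F (t \<otimes> u)) + c * ((\<Sum>s\<in>S. Lp_pow p M (F (t \<otimes> u)) (F (t \<otimes> (u \<otimes> s)))) / card S))
         = \<Delta> F \<one> u + c * ((\<Sum>s\<in>S. \<Delta> F u (u \<otimes> s)) / card S)"
        unfolding \<Delta>_one unfolding \<Delta>_def dpow_def rt_def sum.distrib
        by (subst sum.swap[where A=S and B=T]) (simp add: sum_distrib_left sum_divide_distrib)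
      also have "(\<Sum>s\<in>S. \<Delta> F u (u \<otimes> s)) / card S = energy 1 F"
        unfolding energy_one using \<Delta>_left[OF F one_closed _ uG] SG uG
        by (intro arg_cong2[of _ _ _ _ "(/)"] sum.cong refl) auto
      also have "(\<Sum>t\<in>T. (\<Sum>s\<in>S. Lp_pow p M (F t) (F (t \<otimes> (u \<otimes> s)))) / card S
           + c / (2 * K) * Lp_pow p M (F t) (F (t \<otimes> u))
           + C * Lp_pow p M (avg F (t \<otimes> u)) (F (t \<otimes> u)))
         = P (\<lambda>v. \<Delta> F \<one> v) u + c / (2 * K) * \<Delta> F \<one> u + C * dpow (rt u (avg F)) (rt u F)"
        unfolding \<Delta>_one unfolding step_avg_def dpow_def rt_def sum.distrib
        by (subst sum.swap[where A=S and B=T]) (simp add: sum_distrib_left sum_divide_distrib)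
      also have "dpow (rt u (avg F)) (rt u F) = dpow (avg F) F"
        by (intro dpow_rt avg_closed F uG)
      finally show ?thesis .
    qed
    have "(P ^^ m) (\<lambda>u. 1 * \<Delta> F \<one> u + c * energy 1 F * 1) \<one>
       \<le> (P ^^ m) (\<lambda>u. 1 * P (\<lambda>v. \<Delta> F \<one> v) u + 1 * (c / (2 * K) * \<Delta> F \<one> u + C * dpow (avg F) F * 1)) \<one>"
      using u by (intro walk_mono) (auto simp: add.assoc)
    then show "energy m F + c * energy 1 F
           \<le> energy (Suc m) F + c / (2 * K) * energy m F + C * dpow (avg F) F"
      unfolding walk_lincomb walk_const energy_def funpow_Suc_right o_def
      by (simp only: mult_1_left mult_1_right add.assoc)
  qed
  then show ?thesis by (intro exI[of _ c] conjI exI[of _ C] c)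
qed

end

section \<open>Bounded energy growth implies bounded displacement\<close>

text \<open>
  The energy of every map of the class after any number of steps is at most a fixed multiple of its
  one-step energy.
\<close>

locale expanding_Lp_maps = Lp_maps +
  fixes K :: real
  assumes K: "0 < K" and energy_bound: "\<And>F m. F \<in> \<C> \<Longrightarrow> energy m F \<le> K * energy 1 F"
begin

text \<open>
  A map can be replaced, at bounded cost, by one whose one-step energy is as small as desired. The
  replacement \<open>B\<close> is the Cesaro average of the first \<open>N\<close> images of \<open>F\<close> under \<open>avg\<close>: since
  \<open>avg B - B\<close> telescopes to \<open>1 / N\<close> times a bounded difference, \<open>B\<close> is almost harmonic. If its
  one-step energy were not small, its energy would grow linearly in the number of steps and violate
  \<open>energy_bound\<close>.
\<close>

lemma energy_contraction:
  assumes \<eta>: "0 < \<eta>" and F: "F \<in> \<C>"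
  shows "\<exists>F'\<in>\<C>. energy 1 F' \<le> \<eta> * energy 1 F \<and> dpow F F' \<le> K * energy 1 F"
proof -
  obtain c C where c: "c > 0" "C \<ge> 0" and inc': "\<forall>F\<in>\<C>. \<forall>m. energy m F + c * energy 1 F
           \<le> energy (Suc m) F + c / (2 * K) * energy m F + C * dpow (avg F) F"
    using energy_increment[OF K] by (elim exE conjE) (rule that)
  have inc: "energy m F + c * energy 1 F
           \<le> energy (Suc m) F + c / (2 * K) * energy m F + C * dpow (avg F) F" if "F \<in> \<C>" for F m
    by (rule inc'[rule_format, OF that])
  have "(\<lambda>N. C * (1 / real N) powr p * K) \<longlonglongrightarrow> 0"
    using p by real_asymp
  moreover have "0 < c * \<eta> / 4" using c \<eta> by simp
  ultimately have "\<forall>\<^sub>F N in sequentially. C * (1 / real N) powr p * K < c * \<eta> / 4"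
    by (simp only: order_tendstoD(2))
  then have "\<forall>\<^sub>F N in sequentially. C * (1 / real N) powr p * K < c * \<eta> / 4 \<and> N > 0"
    by (intro eventually_conj eventually_gt_at_top)
  from eventually_happens'[OF sequentially_bot this] obtain N where N: "C * (1 / real N) powr p * K < c * \<eta> / 4" "N > 0" by blast
  define B where "B = (\<lambda>g x. (\<Sum>i<N. (avg ^^ i) F g x) / card {..<N})"
  have B: "B \<in> \<C>" unfolding B_def using N F by (intro mean_closed avg_pow_closed) auto
  define e where "e = energy 1 F"
  have dF: "dpow F B \<le> K * e"
  proof -
    have "dpow B F \<le> (\<Sum>t\<in>T. (\<Sum>i<N. Lp_pow p M ((avg ^^ i) F t) (F t)) / N)"
      unfolding dpow_def
    proof (rule sum_mono)
      fix t assume t: "t \<in> T"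
      have int: "integrable M (\<lambda>x. \<bar>(avg ^^ i) F t x - F t x\<bar> powr p)" for i
        using t p F by (intro Lp_pow_integrable Lp_T avg_pow_closed) auto
      have "Lp_pow p M (B t) (F t) \<le> (LINT x|M. (\<Sum>i<N. \<bar>(avg ^^ i) F t x - F t x\<bar> powr p) / N)"
        unfolding Lp_pow_def
      proof (rule integral_mono)
        show "integrable M (\<lambda>x. \<bar>B t x - F t x\<bar> powr p)"
          using t p F B by (intro Lp_pow_integrable Lp_T) auto
        show "\<bar>B t x - F t x\<bar> powr p \<le> (\<Sum>i<N. \<bar>(avg ^^ i) F t x - F t x\<bar> powr p) / N" for x
          using powr_mean_convex[OF p, of "{..<N}" "\<lambda>i. (avg ^^ i) F t x" "F t x"] N
          by (auto simp: B_def)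
      qed (use int in auto)
      also have "\<dots> = (\<Sum>i<N. Lp_pow p M ((avg ^^ i) F t) (F t)) / N"
        using int by (simp add: Lp_pow_def)
      finally show "Lp_pow p M (B t) (F t) \<le> \<dots>" .
    qed
    also have "\<dots> = (\<Sum>i<N. dpow ((avg ^^ i) F) F) / N"
      unfolding dpow_def by (subst sum.swap[where A="{..<N}" and B=T]) (simp add: sum_divide_distrib)
    also have "\<dots> \<le> (\<Sum>i<N. K * e) / N"
      unfolding e_def using dpow_avg_pow[OF F] energy_bound[OF F]
      by (intro divide_right_mono sum_mono) (auto intro: order_trans)
    also have "\<dots> = K * e" using N by simp
    finally show ?thesis by (simp add: dpow_commute)
  qed
  have dB: "dpow (avg B) B \<le> (1 / N) powr p * (K * e)"
  proof -
    have tel: "avg B g x - B g x = 1 / N * ((avg ^^ N) F g x - F g x)" for g x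
    proof -
      have "avg B g x = (\<Sum>i<N. (avg ^^ Suc i) F g x) / N"
        unfolding avg_pow_apply unfolding avg_def B_def avg_pow_apply
        by (simp add: step_avg_def sum_divide_distrib[symmetric]) (subst sum.swap, simp add: sum_divide_distrib mult.commute)
      then have "avg B g x - B g x = (\<Sum>i<N. (avg ^^ Suc i) F g x - (avg ^^ i) F g x) / N"
        by (simp add: B_def sum_subtractf diff_divide_distrib)
      then show ?thesis by (subst (asm) sum_lessThan_telescope) simp
    qed
    have "dpow (avg B) B = (1 / N) powr p * dpow ((avg ^^ N) F) F"
      unfolding dpow_def Lp_pow_def tel abs_mult
      by (simp add: powr_mult sum_distrib_left powr_divide)
    also have "\<dots> \<le> (1 / N) powr p * (K * e)"
      using dpow_avg_pow[OF F, of N] energy_bound[OF F, of N] by (intro mult_left_mono) (auto simp: e_def)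
    finally show ?thesis .
  qed
  have "energy 1 B \<le> \<eta> * e"
  proof (rule ccontr)
    assume "\<not> ?thesis"
    then have gt: "\<eta> * e < energy 1 B" by simp
    define b where "b = energy 1 B"
    have e0: "e \<ge> 0" by (simp add: e_def energy_nonneg)
    then have b0: "b > 0" using gt \<eta> by (smt (verit) b_def mult_nonneg_nonneg)
    have "C * dpow (avg B) B \<le> C * (1 / N) powr p * K * e"
      using mult_left_mono[OF dB c(2)] by (simp add: mult.assoc)
    also have "\<dots> \<le> c * \<eta> / 4 * e" using N(1) e0 by (intro mult_right_mono) auto
    also have "\<dots> \<le> c / 4 * b" using gt c by (simp add: b_def)
    finally have drift: "C * dpow (avg B) B \<le> c / 4 * b" .
    have grow: "energy m B + c / 4 * b \<le> energy (Suc m) B" for m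
    proof -
      have "c / (2 * K) * energy m B \<le> c / (2 * K) * (K * b)"
        using energy_bound[OF B, of m] c K by (intro mult_left_mono) (auto simp: b_def)
      also have "\<dots> = c / 2 * b" using K by simp
      finally have *: "c / (2 * K) * energy m B \<le> c / 2 * b" .
      have "c * b = c / 2 * b + c / 4 * b + c / 4 * b" by (simp add: field_simps)
      then show ?thesis using inc[OF B, of m, folded b_def] drift * by linarith
    qed
    have lin: "real m * (c / 4 * b) \<le> energy m B" for m
    proof (induction m)
      case (Suc m)
      have "real (Suc m) * (c / 4 * b) = real m * (c / 4 * b) + c / 4 * b" by (simp add: distrib_right)
      then show ?case using grow[of m] Suc by linarith
    qed (simp add: energy_nonneg)
    obtain m where "real m > K * b / (c / 4 * b)" using reals_Archimedean2 by blast
    then have "real m * (c / 4 * b) > K * b" using c b0 by (simp add: field_simps)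
    then show False using lin[of m] energy_bound[OF B, of m] by (simp add: b_def)
  qed
  then show ?thesis using B dF unfolding e_def by blast
qed

text \<open>
  Iterated contraction. The contraction factor \<open>1 / (2 * 2 powr p)\<close> compensates the constant of the
  weak triangle inequality, so the total distance travelled stays bounded independently of the number
  \<open>i\<close> of iterations.
\<close>

lemma energy_arbitrarily_small:
  assumes "F \<in> \<C>"
  shows "\<exists>F'\<in>\<C>. energy 1 F' \<le> (1 / (2 * 2 powr p)) ^ i * energy 1 F \<and>
           dpow F F' \<le> 2 * 2 powr p * K * energy 1 F"
  using assms
proof (induction i arbitrary: F)
  case 0
  then show ?case using K by (intro bexI[of _ F]) (auto simp: dpow_same energy_nonneg)
next
  case (Suc i)
  define \<eta> where "\<eta> = 1 / (2 * 2 powr p)"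
  have \<eta>: "\<eta> > 0" "2 powr p * (\<eta> * 2) = 1" by (auto simp: \<eta>_def)
  obtain F1 where F1: "F1 \<in> \<C>" "energy 1 F1 \<le> \<eta> * energy 1 F" "dpow F F1 \<le> K * energy 1 F"
    using energy_contraction[OF \<eta>(1) Suc.prems] by blast
  obtain F2 where F2: "F2 \<in> \<C>" "energy 1 F2 \<le> \<eta> ^ i * energy 1 F1"
      "dpow F1 F2 \<le> 2 * 2 powr p * K * energy 1 F1"
    using Suc.IH[OF F1(1)] by (auto simp: \<eta>_def)
  have "\<eta> ^ i * energy 1 F1 \<le> \<eta> ^ i * (\<eta> * energy 1 F)"
    using F1 \<eta> by (intro mult_left_mono) auto
  then have "energy 1 F2 \<le> \<eta> ^ Suc i * energy 1 F" using F2 by (simp add: mult_ac)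
  moreover have "dpow F F2 \<le> 2 * 2 powr p * K * energy 1 F"
  proof -
    have "2 * 2 powr p * K * energy 1 F1 \<le> 2 * 2 powr p * K * (\<eta> * energy 1 F)"
      using F1 K by (intro mult_left_mono) auto
    also have "\<dots> = K * energy 1 F * (2 powr p * (\<eta> * 2))" by (simp add: mult_ac)
    finally have "dpow F1 F2 \<le> K * energy 1 F" using F2 \<eta> by simp
    then have "2 powr p * (dpow F F1 + dpow F1 F2) \<le> 2 powr p * (K * energy 1 F + K * energy 1 F)"
      using F1(3) by (intro mult_left_mono add_mono) auto
    also have "\<dots> = 2 * 2 powr p * K * energy 1 F" by (simp add: algebra_simps)
    finally show ?thesis using dpow_triangle[OF Suc.prems F1(1) F2(1)] by linarith
  qed
  ultimately show ?case using F2(1) unfolding \<eta>_def by blast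
qed

lemma displacement_le_energy:
  assumes "set w \<subseteq> S"
  shows "\<exists>C\<ge>0. \<forall>F\<in>\<C>. \<Delta> F \<one> (list_prod G w) \<le> C * energy 1 F"
  using assms
proof (induction w)
  case Nil
  then show ?case by (intro exI[of _ 0]) (auto simp: list_prod_def \<Delta>_def dpow_same)
next
  case (Cons s w)
  then obtain C where C: "C \<ge> 0" "\<And>F. F \<in> \<C> \<Longrightarrow> \<Delta> F \<one> (list_prod G w) \<le> C * energy 1 F" by auto
  have sG: "s \<in> carrier G" using Cons SG by auto
  have "set w \<subseteq> carrier G" using Cons SG by auto
  then have wG: "list_prod G w \<in> carrier G" unfolding list_prod_def by (induction w) auto
  have "\<Delta> F \<one> (list_prod G (s # w)) \<le> 2 powr p * (card S + C) * energy 1 F" if F: "F \<in> \<C>" for F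
  proof -
    have "\<Delta> F \<one> s \<le> (\<Sum>s\<in>S. \<Delta> F \<one> s)"
      using Cons.prems finS by (intro member_le_sum) (auto simp: \<Delta>_nonneg)
    also have "\<dots> = card S * energy 1 F" using cardS unfolding energy_one by simp
    finally have 1: "\<Delta> F \<one> s \<le> card S * energy 1 F" .
    have "\<Delta> F s (s \<otimes> list_prod G w) = \<Delta> F \<one> (list_prod G w)"
      using \<Delta>_left[OF F one_closed wG sG] sG by simp
    then have 2: "\<Delta> F s (s \<otimes> list_prod G w) \<le> C * energy 1 F" using C(2)[OF F] by simp
    have "\<Delta> F \<one> (s \<otimes> list_prod G w) \<le> 2 powr p * (\<Delta> F \<one> s + \<Delta> F s (s \<otimes> list_prod G w))"
      using sG wG by (intro \<Delta>_triangle F) auto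
    also have "\<dots> \<le> 2 powr p * (card S * energy 1 F + C * energy 1 F)"
      using 1 2 by (intro mult_left_mono add_mono) auto
    finally show ?thesis by (simp add: list_prod_def algebra_simps)
  qed
  moreover have "2 powr p * (card S + C) \<ge> 0" using C by simp
  ultimately show ?case by blast
qed

text \<open>
  The displacement of \<open>F\<close> is bounded on the submonoid generated by \<open>S\<close>: a fixed element displaces
  the maps of small energy by an arbitrarily small amount, and these maps stay at bounded distance
  from \<open>F\<close>. Since only boundedness is claimed, no limit of the iteration is needed.
\<close>

theorem bounded_displacement:
  assumes F: "F \<in> \<C>"
  shows "\<exists>R. \<forall>w. set w \<subseteq> S \<longrightarrow> \<Delta> F \<one> (list_prod G w) \<le> R"
proof -
  define c where "c = (2::real) powr p"
  define q where "q = 2 * 2 powr p * K"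
  define e where "e = energy 1 F"
  have c: "c > 0" by (simp add: c_def)
  have e: "e \<ge> 0" by (simp add: e_def energy_nonneg)
  have "\<Delta> F \<one> (list_prod G w) \<le> c * (q * e + c * (e + q * e))" if w: "set w \<subseteq> S" for w
  proof -
    obtain C where C: "C \<ge> 0" "\<And>F. F \<in> \<C> \<Longrightarrow> \<Delta> F \<one> (list_prod G w) \<le> C * energy 1 F"
      using displacement_le_energy[OF w] by auto
    define g where "g = list_prod G w"
    have "set w \<subseteq> carrier G" using w SG by auto
    then have g: "g \<in> carrier G" unfolding g_def list_prod_def by (induction w) auto
    have "(1::real) < 2 powr p" using p by (intro gr_one_powr) auto
    then have "(1::real) < 2 * 2 powr p" by linarith
    then have "(\<lambda>i. C * (1 / (2 * 2 powr p)) ^ i) \<longlonglongrightarrow> C * 0"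
      by (intro tendsto_mult tendsto_const LIMSEQ_realpow_zero) auto
    then have "\<forall>\<^sub>F i in sequentially. C * (1 / (2 * 2 powr p)) ^ i < 1"
      by (intro order_tendstoD(2)) auto
    from eventually_happens'[OF sequentially_bot this] obtain i where i: "C * (1 / (2 * 2 powr p)) ^ i < 1" by blast
    obtain F' where F': "F' \<in> \<C>" "energy 1 F' \<le> (1 / (2 * 2 powr p)) ^ i * e" "dpow F F' \<le> q * e"
      using energy_arbitrarily_small[OF F, of i] unfolding e_def q_def by blast
    have "dpow F' (rt g F') \<le> C * energy 1 F'" using C(2)[OF F'(1)] by (simp add: \<Delta>_one g_def)
    also have "\<dots> \<le> C * ((1 / (2 * 2 powr p)) ^ i * e)" using F' C by (intro mult_left_mono) auto
    also have "\<dots> \<le> 1 * e" unfolding mult.assoc[symmetric] using i e by (intro mult_right_mono) auto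
    finally have 1: "dpow F' (rt g F') \<le> e" by simp
    have 2: "dpow (rt g F') (rt g F) \<le> q * e" using F' F g by (simp add: dpow_rt dpow_commute)
    have "dpow F (rt g F) \<le> c * (dpow F F' + dpow F' (rt g F))"
      unfolding c_def by (intro dpow_triangle rt_closed F F' g)
    also have "\<dots> \<le> c * (dpow F F' + c * (dpow F' (rt g F') + dpow (rt g F') (rt g F)))"
      unfolding c_def by (intro mult_left_mono add_mono dpow_triangle rt_closed F F' g) auto
    also have "\<dots> \<le> c * (q * e + c * (e + q * e))"
      using 1 2 F' c by (intro mult_left_mono add_mono) auto
    finally show ?thesis by (simp add: \<Delta>_one g_def)
  qed
  then show ?thesis by blast
qed

end

section \<open>Non-backtracking walks in regular graphs\<close>

text \<open>
  Finite \<open>d\<close>-regular graphs, not necessarily connected, with the inversion \<open>r\<close> of oriented edges.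
\<close>

locale regular_graph = fin_digraph \<Omega> + bidirected_digraph \<Omega> r
  for \<Omega> :: "('v, 'e) pre_digraph" and r :: "'e \<Rightarrow> 'e" +
  fixes d :: nat
  assumes regular: "v \<in> verts \<Omega> \<Longrightarrow> out_degree \<Omega> v = d"
begin

text \<open>
  The arcs of the list are consecutive, and no arc is followed by its inverse.
\<close>

definition nonbacktracking :: "'e list \<Rightarrow> bool" where
  "nonbacktracking = successively (\<lambda>a b. head \<Omega> a = tail \<Omega> b \<and> b \<noteq> r a)"

text \<open>
  The non-backtracking walks with \<open>m\<close> arcs.
\<close>

definition nb_walks :: "nat \<Rightarrow> 'e list set" where
  "nb_walks m = {q. length q = m \<and> set q \<subseteq> arcs \<Omega> \<and> nonbacktracking q}"

lemma finite_nb_walks: "finite (nb_walks m)"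
  by (rule finite_subset[OF _ finite_lists_length_eq[OF finite_arcs, of m]])
     (auto simp: nb_walks_def)

lemma nonbacktracking_append:
  "nonbacktracking (xs @ ys) \<longleftrightarrow> nonbacktracking xs \<and> nonbacktracking ys \<and>
     (xs \<noteq> [] \<longrightarrow> ys \<noteq> [] \<longrightarrow> head \<Omega> (last xs) = tail \<Omega> (hd ys) \<and> hd ys \<noteq> r (last xs))"
  unfolding nonbacktracking_def by (auto simp: successively_append_iff)

lemma nonbacktracking_Cons:
  "nonbacktracking (x # ys) \<longleftrightarrow> nonbacktracking ys \<and>
     (ys \<noteq> [] \<longrightarrow> head \<Omega> x = tail \<Omega> (hd ys) \<and> hd ys \<noteq> r x)"
  using nonbacktracking_append[of "[x]" ys] by (auto simp: nonbacktracking_def)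

lemma nb_walk_awalk:
  assumes "nonbacktracking q" "set q \<subseteq> arcs \<Omega>" "q \<noteq> []"
  shows "awalk (tail \<Omega> (hd q)) q (head \<Omega> (last q))"
  using assms
proof (induction q)
  case (Cons a q)
  then show ?case by (cases "q = []") (auto simp: nonbacktracking_Cons awalk_simps)
qed simp

lemma nb_walks_rev: "q \<in> nb_walks m \<Longrightarrow> rev (map r q) \<in> nb_walks m"
proof -
  assume q: "q \<in> nb_walks m"
  have "nonbacktracking (rev (map r q))"
  proof -
    have "successively (\<lambda>x y. head \<Omega> (r y) = tail \<Omega> (r x) \<and> r x \<noteq> r (r y)) q"
      using q unfolding nb_walks_def nonbacktracking_def
      by (auto elim!: successively_mono simp: subset_eq)
    then show ?thesis by (simp add: nonbacktracking_def successively_rev successively_map)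
  qed
  then show ?thesis using q by (auto simp: nb_walks_def)
qed

lemma rev_map_r: "rev (map r (rev (map r q))) = q"
  by (simp add: rev_map o_def)

text \<open>
  In a regular graph every first arc has the same number of non-backtracking continuations. Together
  with reversal of walks this shows that both endpoints of a uniformly random non-backtracking walk are
  uniformly distributed (\<open>sum_nb_walks_start\<close>, \<open>sum_nb_walks_end\<close>).
\<close>

lemma card_nb_walks_hd:
  assumes "e \<in> arcs \<Omega>"
  shows "card {q \<in> nb_walks (Suc m). hd q = e} = (d - 1) ^ m"
  using assms
proof (induction m arbitrary: e)
  case 0
  have "{q \<in> nb_walks (Suc 0). hd q = e} = {[e]}"
    using 0 by (auto simp: nb_walks_def length_Suc_conv nonbacktracking_def)
  then show ?case by simp
next
  case (Suc m)
  define N where "N = out_arcs \<Omega> (head \<Omega> e) - {r e}"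
  have "{q \<in> nb_walks (Suc (Suc m)). hd q = e}
      = (#) e ` (\<Union>e'\<in>N. {q \<in> nb_walks (Suc m). hd q = e'})" (is "?L = ?R")
  proof
    show "?L \<subseteq> ?R"
    proof
      fix q assume "q \<in> ?L"
      then obtain q' where "q = e # q'" "length q' = Suc m" "nonbacktracking (e # q')" "set q' \<subseteq> arcs \<Omega>"
        by (cases q) (auto simp: nb_walks_def)
      moreover from this have "hd q' \<in> arcs \<Omega>" by (cases q') auto
      ultimately show "q \<in> ?R" by (auto simp: nb_walks_def nonbacktracking_Cons N_def)
    qed
    show "?R \<subseteq> ?L"
      using Suc.prems by (auto simp: nb_walks_def nonbacktracking_Cons N_def)
  qed
  then have "card ?L = card (\<Union>e'\<in>N. {q \<in> nb_walks (Suc m). hd q = e'})"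
    by (simp add: card_image)
  also have "\<dots> = (\<Sum>e'\<in>N. card {q \<in> nb_walks (Suc m). hd q = e'})"
    by (intro card_UN_disjoint) (auto simp: N_def finite_nb_walks)
  also have "\<dots> = (\<Sum>e'\<in>N. (d - 1) ^ m)"
    by (intro sum.cong refl Suc.IH) (auto simp: N_def)
  also have "\<dots> = (d - 1) ^ Suc m"
  proof -
    have "card N = card (out_arcs \<Omega> (head \<Omega> e)) - 1"
      unfolding N_def using Suc.prems by (intro card_Diff_singleton) auto
    then show ?thesis using regular[of "head \<Omega> e"] Suc.prems by (simp add: out_degree_def)
  qed
  finally show ?case .
qed

lemma card_nb_walks_start:
  assumes "v \<in> verts \<Omega>"
  shows "card {q \<in> nb_walks (Suc m). tail \<Omega> (hd q) = v} = d * (d - 1) ^ m"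
proof -
  have "{q \<in> nb_walks (Suc m). tail \<Omega> (hd q) = v} = (\<Union>e\<in>out_arcs \<Omega> v. {q \<in> nb_walks (Suc m). hd q = e})"
    by (auto simp: nb_walks_def length_Suc_conv)
  then have "card {q \<in> nb_walks (Suc m). tail \<Omega> (hd q) = v}
      = (\<Sum>e\<in>out_arcs \<Omega> v. card {q \<in> nb_walks (Suc m). hd q = e})"
    by (simp only:) (rule card_UN_disjoint, auto simp: finite_nb_walks)
  also have "\<dots> = (\<Sum>e\<in>out_arcs \<Omega> v. (d - 1) ^ m)"
    by (intro sum.cong refl card_nb_walks_hd) auto
  finally show ?thesis using regular[OF assms] by (simp add: out_degree_def)
qed

lemma bij_rev_nb_walks: "bij_betw (\<lambda>q. rev (map r q)) (nb_walks m) (nb_walks m)"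
  by (rule bij_betw_byWitness[of _ "\<lambda>q. rev (map r q)"]) (auto simp: rev_map_r nb_walks_rev)

lemma sum_nb_walks_start:
  fixes f :: "'v \<Rightarrow> real"
  shows "(\<Sum>q\<in>nb_walks (Suc m). f (tail \<Omega> (hd q))) = real (d * (d - 1) ^ m) * (\<Sum>v\<in>verts \<Omega>. f v)"
proof -
  have "(\<lambda>q. tail \<Omega> (hd q)) ` nb_walks (Suc m) \<subseteq> verts \<Omega>"
    by (auto simp: nb_walks_def length_Suc_conv)
  then have "(\<Sum>q\<in>nb_walks (Suc m). f (tail \<Omega> (hd q)))
     = (\<Sum>v\<in>verts \<Omega>. \<Sum>q\<in>{q \<in> nb_walks (Suc m). tail \<Omega> (hd q) = v}. f (tail \<Omega> (hd q)))"
    by (intro sum.group[symmetric] finite_nb_walks finite_verts)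
  also have "\<dots> = (\<Sum>v\<in>verts \<Omega>. real (d * (d - 1) ^ m) * f v)"
    by (intro sum.cong refl) (simp add: card_nb_walks_start)
  finally show ?thesis by (simp add: sum_distrib_left)
qed

lemma sum_nb_walks_end:
  fixes f :: "'v \<Rightarrow> real"
  shows "(\<Sum>q\<in>nb_walks (Suc m). f (head \<Omega> (last q))) = real (d * (d - 1) ^ m) * (\<Sum>v\<in>verts \<Omega>. f v)"
proof -
  have "(\<Sum>q\<in>nb_walks (Suc m). f (head \<Omega> (last q)))
      = (\<Sum>q\<in>nb_walks (Suc m). f (head \<Omega> (last (rev (map r q)))))"
    by (rule sum.reindex_bij_betw[OF bij_rev_nb_walks, symmetric])
  also have "\<dots> = (\<Sum>q\<in>nb_walks (Suc m). f (tail \<Omega> (hd q)))"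
    by (intro sum.cong refl) (auto simp: nb_walks_def length_Suc_conv last_rev)
  finally show ?thesis by (simp add: sum_nb_walks_start)
qed

lemma card_nb_walks: "card (nb_walks (Suc m)) = card (verts \<Omega>) * (d * (d - 1) ^ m)"
  using sum_nb_walks_start[of "\<lambda>_. 1" m]
  by (simp del: of_nat_mult of_nat_power add: of_nat_mult[symmetric] mult.commute)

text \<open>
  Since both endpoints of a random walk of any length are uniformly distributed, comparing each of them
  with an independent uniform vertex bounds the mean of \<open>D\<close> over endpoints by its mean over all pairs.
\<close>

lemma nb_walks_average_le:
  fixes D :: "'v \<Rightarrow> 'v \<Rightarrow> real"
  assumes tri: "\<And>u v w. u \<in> verts \<Omega> \<Longrightarrow> v \<in> verts \<Omega> \<Longrightarrow> w \<in> verts \<Omega> \<Longrightarrow> D u w \<le> c * (D u v + D v w)"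
    and ne: "verts \<Omega> \<noteq> {}" "d \<ge> 2"
  shows "(\<Sum>q\<in>nb_walks (Suc m). D (tail \<Omega> (hd q)) (head \<Omega> (last q))) / card (nb_walks (Suc m))
      \<le> 2 * c * ((\<Sum>u\<in>verts \<Omega>. \<Sum>v\<in>verts \<Omega>. D u v) / (real (card (verts \<Omega>)))\<^sup>2)"
proof -
  define n where "n = real (card (verts \<Omega>))"
  define \<kappa> where "\<kappa> = real (d * (d - 1) ^ m)"
  define Q where "Q = (\<Sum>q\<in>nb_walks (Suc m). D (tail \<Omega> (hd q)) (head \<Omega> (last q)))"
  define W where "W = (\<Sum>u\<in>verts \<Omega>. \<Sum>v\<in>verts \<Omega>. D u v)"
  have pos: "n > 0" "\<kappa> > 0" using ne by (auto simp: n_def \<kappa>_def card_gt_0_iff)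
  have ends: "tail \<Omega> (hd q) \<in> verts \<Omega>" "head \<Omega> (last q) \<in> verts \<Omega>" if "q \<in> nb_walks (Suc m)" for q
  proof -
    have "q \<noteq> []" "set q \<subseteq> arcs \<Omega>" using that by (auto simp: nb_walks_def)
    then have "hd q \<in> arcs \<Omega>" "last q \<in> arcs \<Omega>" using hd_in_set last_in_set by blast+
    then show "tail \<Omega> (hd q) \<in> verts \<Omega>" "head \<Omega> (last q) \<in> verts \<Omega>" by auto
  qed
  have "n * Q = (\<Sum>v\<in>verts \<Omega>. Q)" by (simp add: n_def)
  also have "\<dots> \<le> (\<Sum>v\<in>verts \<Omega>. \<Sum>q\<in>nb_walks (Suc m). c * (D (tail \<Omega> (hd q)) v + D v (head \<Omega> (last q))))"
    unfolding Q_def by (intro sum_mono tri ends)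
  also have "\<dots> = c * (\<Sum>v\<in>verts \<Omega>. (\<Sum>q\<in>nb_walks (Suc m). D (tail \<Omega> (hd q)) v)
                    + (\<Sum>q\<in>nb_walks (Suc m). D v (head \<Omega> (last q))))"
    by (simp add: sum_distrib_left sum.distrib distrib_left)
  also have "\<dots> = c * (\<kappa> * (\<Sum>v\<in>verts \<Omega>. \<Sum>u\<in>verts \<Omega>. D u v) + \<kappa> * W)"
    unfolding sum_nb_walks_start[of "\<lambda>u. D u v" for v] sum_nb_walks_end[of "\<lambda>u. D v u" for v]
    by (simp add: sum.distrib sum_distrib_left[symmetric] \<kappa>_def W_def)
  also have "(\<Sum>v\<in>verts \<Omega>. \<Sum>u\<in>verts \<Omega>. D u v) = W"
    unfolding W_def by (rule sum.swap)
  finally have "n * Q \<le> 2 * c * \<kappa> * W" by (simp add: algebra_simps)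
  moreover have "real (card (nb_walks (Suc m))) = n * \<kappa>"
    unfolding card_nb_walks n_def \<kappa>_def by (rule of_nat_mult)
  ultimately show ?thesis unfolding Q_def[symmetric] W_def[symmetric] n_def[symmetric]
    using pos by (simp add: field_simps power2_eq_square)
qed

text \<open>
  A closed non-backtracking walk contains a contiguous subwalk which is a cycle; being
  non-backtracking itself, this cycle is not of the form \<open>[e, r e]\<close>.
\<close>

lemma closed_nonbacktracking_girth:
  assumes "nonbacktracking q" "set q \<subseteq> arcs \<Omega>" "q \<noteq> []" "tail \<Omega> (hd q) = head \<Omega> (last q)"
  shows "girth \<Omega> r \<le> enat (length q)"
  using assms
proof (induction "length q" arbitrary: q rule: less_induct)
  case less
  define u where "u = tail \<Omega> (hd q)"
  have aw: "awalk u q u" using nb_walk_awalk[OF less.prems(1-3)] less.prems(4) by (simp add: u_def)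
  show ?case
  proof (cases "distinct (tl (awalk_verts u q))")
    case True
    then have "cycle q" using aw less.prems by (auto simp: cycle_def)
    moreover have "\<nexists>e. q = [e, r e]" using less.prems(1) by (auto simp: nonbacktracking_def)
    ultimately show ?thesis unfolding girth_def by (intro INF_lower) auto
  next
    case False
    then obtain e es where q: "q = e # es" using less.prems by (cases q) auto
    with aw False have es: "awalk (head \<Omega> e) es u" "\<not> distinct (awalk_verts (head \<Omega> e) es)"
      by (auto simp: awalk_Cons_iff)
    obtain a b c w where es_eq: "es = a @ b @ c" "awalk w b w" "b \<noteq> []"
      using awalk_not_distinct_decomp[OF es] by blast
    have len: "length b < length q" using q es_eq by auto
    have "nonbacktracking b"
      using less.prems(1) by (simp add: q es_eq nonbacktracking_append nonbacktracking_Cons)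
    moreover have "set b \<subseteq> arcs \<Omega>" using less.prems(2) by (simp add: q es_eq)
    moreover have "tail \<Omega> (hd b) = head \<Omega> (last b)"
      using es_eq(2,3) nb_walk_awalk[OF \<open>nonbacktracking b\<close> \<open>set b \<subseteq> arcs \<Omega>\<close> es_eq(3)]
      by (metis awalk_ends)
    ultimately have "girth \<Omega> r \<le> enat (length b)" using less.hyps[OF len] es_eq by blast
    then show ?thesis using len by (meson enat_ord_simps(1) less_imp_le order_trans)
  qed
qed

text \<open>
  No unoriented edge occurs twice.
\<close>

definition edge_distinct :: "'e list \<Rightarrow> bool" where
  "edge_distinct q \<longleftrightarrow> distinct q \<and> (\<forall>a\<in>set q. r a \<notin> set q)"

text \<open>
  If an edge is used twice by a non-backtracking walk, then the part of the walk between the two uses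
  is, possibly together with one of them, a closed non-backtracking walk, whose length bounds the girth
  from above.
\<close>

lemma nb_walks_edge_distinct:
  assumes q: "q \<in> nb_walks m" and girth: "enat m < girth \<Omega> r"
  shows "edge_distinct q"
proof (rule ccontr)
  have nb: "nonbacktracking q" "set q \<subseteq> arcs \<Omega>" "length q = m" using q by (auto simp: nb_walks_def)
  assume "\<not> edge_distinct q"
  then have "\<not> distinct q \<or> (\<exists>a\<in>set q. r a \<in> set q)" by (auto simp: edge_distinct_def)
  then have "\<exists>xs a ys b zs. q = xs @ a # ys @ b # zs \<and> (b = a \<or> b = r a)"
  proof
    assume "\<not> distinct q"
    then show ?thesis using not_distinct_decomp[of q] by fastforce
  next
    assume "\<exists>a\<in>set q. r a \<in> set q"
    then obtain a where a: "a \<in> set q" "r a \<in> set q" by auto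
    then obtain us vs where uv: "q = us @ a # vs" by (auto dest: split_list)
    have "r a \<noteq> a" using a nb arev_neq by auto
    then consider "r a \<in> set us" | "r a \<in> set vs" using a uv by auto
    then show ?thesis
    proof cases
      case 1
      then obtain xs ys where "us = xs @ r a # ys" by (auto dest: split_list)
      then have "q = xs @ r a # ys @ a # vs \<and> (a = r a \<or> a = r (r a))" using uv by simp
      then show ?thesis by blast
    next
      case 2
      then obtain ys zs where "vs = ys @ r a # zs" by (auto dest: split_list)
      then show ?thesis using uv by blast
    qed
  qed
  then obtain xs a ys b zs where dec: "q = xs @ a # ys @ b # zs" and ab: "b = a \<or> b = r a" by blast
  have aA: "a \<in> arcs \<Omega>" using nb dec by auto
  have "\<exists>c. c \<noteq> [] \<and> nonbacktracking c \<and> set c \<subseteq> arcs \<Omega> \<and> length c \<le> m \<and> tail \<Omega> (hd c) = head \<Omega> (last c)"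
  proof (cases "b = a")
    case True
    have "nonbacktracking ((a # ys) @ b # zs)" using nb dec by (simp add: nonbacktracking_append)
    then have "nonbacktracking (a # ys) \<and> head \<Omega> (last (a # ys)) = tail \<Omega> b"
      using nonbacktracking_append[of "a # ys" "b # zs"] by simp
    then show ?thesis using True nb dec by (intro exI[of _ "a # ys"]) auto
  next
    case False
    then have b: "b = r a" using ab by simp
    have 1: "nonbacktracking (a # ys @ b # zs)" using nb dec by (simp add: nonbacktracking_append)
    have ys: "ys \<noteq> []"
    proof
      assume "ys = []"
      then show False using 1 b by (simp add: nonbacktracking_Cons)
    qed
    have "nonbacktracking (ys @ b # zs)" "head \<Omega> a = tail \<Omega> (hd ys)"
      using 1 ys by (auto simp: nonbacktracking_Cons)
    then have "nonbacktracking ys" "head \<Omega> (last ys) = tail \<Omega> b"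
      using ys nonbacktracking_append[of ys "b # zs"] by auto
    then show ?thesis using b aA ys nb dec \<open>head \<Omega> a = tail \<Omega> (hd ys)\<close>
      by (intro exI[of _ ys]) auto
  qed
  then obtain c where "c \<noteq> []" "nonbacktracking c" "set c \<subseteq> arcs \<Omega>" "length c \<le> m"
    "tail \<Omega> (hd c) = head \<Omega> (last c)" by blast
  then have "girth \<Omega> r \<le> enat (length c)" "enat (length c) \<le> enat m"
    using closed_nonbacktracking_girth by auto
  then show False using girth by (meson leD order_trans)
qed

lemma card_nb_walks_through:
  assumes "e \<in> arcs \<Omega>" "i \<le> m"
  shows "card {q \<in> nb_walks (Suc m). q ! i = e} \<le> (d - 1) ^ m"
proof -
  define A where "A = {q \<in> nb_walks (Suc i). last q = e}"
  define B where "B = {q \<in> nb_walks (Suc (m - i)). hd q = e}"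
  have cB: "card B = (d - 1) ^ (m - i)" unfolding B_def by (rule card_nb_walks_hd[OF assms(1)])
  have "A \<subseteq> (\<lambda>q. rev (map r q)) ` {q \<in> nb_walks (Suc i). hd q = r e}"
  proof
    fix q assume q: "q \<in> A"
    then have "rev (map r q) \<in> {q \<in> nb_walks (Suc i). hd q = r e}"
      using nb_walks_rev[of q "Suc i"] last_map[of q r] by (cases "q = []") (auto simp: A_def hd_rev nb_walks_def)
    then show "q \<in> (\<lambda>q. rev (map r q)) ` {q \<in> nb_walks (Suc i). hd q = r e}"
      by (rule image_eqI[where x="rev (map r q)", rotated]) (rule rev_map_r[symmetric])
  qed
  then have "card A \<le> card {q \<in> nb_walks (Suc i). hd q = r e}"
    by (rule surj_card_le[rotated]) (simp add: finite_nb_walks)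
  then have cA: "card A \<le> (d - 1) ^ i" using card_nb_walks_hd[of "r e" i] assms by simp
  have inj: "inj_on (\<lambda>q. (take (Suc i) q, drop i q)) {q \<in> nb_walks (Suc m). q ! i = e}"
  proof (rule inj_onI)
    fix q q' assume eq: "(take (Suc i) q, drop i q) = (take (Suc i) q', drop i q')"
    then have "take i (take (Suc i) q) = take i (take (Suc i) q')" by simp
    then have "take i q = take i q'" by simp
    moreover have "drop i q = drop i q'" using eq by simp
    ultimately have "take i q @ drop i q = take i q' @ drop i q'" by (simp only:)
    then show "q = q'" by (simp only: append_take_drop_id)
  qed
  have "(\<lambda>q. (take (Suc i) q, drop i q)) ` {q \<in> nb_walks (Suc m). q ! i = e} \<subseteq> A \<times> B"
  proof (clarsimp simp: A_def B_def)
    fix q assume q: "q \<in> nb_walks (Suc m)" and e: "e = q ! i"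
    have len: "length q = Suc m" using q by (simp add: nb_walks_def)
    have "nonbacktracking (take (Suc i) q)" "nonbacktracking (drop i q)"
      using q nonbacktracking_append[of "take (Suc i) q" "drop (Suc i) q"]
        nonbacktracking_append[of "take i q" "drop i q"] by (auto simp: nb_walks_def)
    moreover have "set (take (Suc i) q) \<subseteq> arcs \<Omega>" "set (drop i q) \<subseteq> arcs \<Omega>"
      using q set_take_subset[of "Suc i" q] set_drop_subset[of i q] unfolding nb_walks_def by blast+
    ultimately show "take (Suc i) q \<in> nb_walks (Suc i) \<and> last (take (Suc i) q) = q ! i \<and>
        drop i q \<in> nb_walks (Suc (m - i)) \<and> hd (drop i q) = q ! i"
      using len assms(2) take_Suc_conv_app_nth[of i q] by (auto simp: nb_walks_def hd_drop_conv_nth)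
  qed
  then have "card {q \<in> nb_walks (Suc m). q ! i = e} \<le> card (A \<times> B)"
    by (rule card_inj_on_le[OF inj]) (simp add: A_def B_def finite_nb_walks)
  also have "\<dots> = card A * card B" by (rule card_cartesian_product)
  also have "\<dots> \<le> (d - 1) ^ i * (d - 1) ^ (m - i)" using cA cB by simp
  also have "\<dots> = (d - 1) ^ m" using assms(2) by (simp add: power_add[symmetric])
  finally show ?thesis .
qed

text \<open>
  The two lists have an unoriented edge in common.
\<close>

definition share_edge :: "'e list \<Rightarrow> 'e list \<Rightarrow> bool" where
  "share_edge q q' \<longleftrightarrow> (\<exists>a\<in>set q. a \<in> set q' \<or> r a \<in> set q')"

lemma card_share_edge_le:
  assumes q: "q \<in> nb_walks (Suc m)"
  shows "card {q' \<in> nb_walks (Suc m). share_edge q q'} \<le> 2 * Suc m * Suc m * (d - 1) ^ m"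
proof -
  define E where "E = set q \<union> r ` set q"
  have E: "E \<subseteq> arcs \<Omega>" "finite E" using q by (auto simp: E_def nb_walks_def)
  have "card E \<le> card (set q) + card (r ` set q)" unfolding E_def by (rule card_Un_le)
  also have "\<dots> \<le> Suc m + Suc m"
    using q card_length[of q] card_image_le[of "set q" r] by (intro add_mono) (auto simp: nb_walks_def)
  finally have cE: "card E \<le> 2 * Suc m" by simp
  have "{q' \<in> nb_walks (Suc m). share_edge q q'} \<subseteq> (\<Union>(e, i)\<in>E \<times> {..m}. {q' \<in> nb_walks (Suc m). q' ! i = e})"
    (is "?L \<subseteq> ?R")
  proof
    fix q' assume q': "q' \<in> ?L"
    then obtain e where "e \<in> E" "e \<in> set q'" by (auto simp: share_edge_def E_def)
    moreover from this obtain i where "i < length q'" "q' ! i = e" by (auto simp: in_set_conv_nth)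
    ultimately show "q' \<in> ?R" using q' by (auto simp: nb_walks_def less_Suc_eq_le intro!: bexI[of _ "(e, i)"])
  qed
  then have "card ?L \<le> card ?R"
    using E by (intro card_mono) (auto simp: finite_nb_walks)
  also have "\<dots> \<le> (\<Sum>(e, i)\<in>E \<times> {..m}. card {q' \<in> nb_walks (Suc m). q' ! i = e})"
    using card_UN_le[of "E \<times> {..m}" "\<lambda>(e, i). {q' \<in> nb_walks (Suc m). q' ! i = e}"] E
    by (simp add: case_prod_unfold)
  also have "\<dots> \<le> (\<Sum>(e, i)\<in>E \<times> {..m}. (d - 1) ^ m)"
  proof (rule sum_mono)
    fix x assume x: "x \<in> E \<times> {..m}"
    obtain e i where ei: "x = (e, i)" by (cases x)
    show "(case x of (e, i) \<Rightarrow> card {q' \<in> nb_walks (Suc m). q' ! i = e}) \<le> (case x of (e, i) \<Rightarrow> (d - 1) ^ m)"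
      unfolding ei prod.case using x E by (intro card_nb_walks_through) (auto simp: ei)
  qed
  also have "\<dots> = card E * Suc m * (d - 1) ^ m" by (simp add: card_cartesian_product)
  also have "\<dots> \<le> 2 * Suc m * Suc m * (d - 1) ^ m" using cE by (intro mult_right_mono) auto
  finally show ?thesis .
qed

end

section \<open>Random symmetric labellings\<close>

text \<open>
  The set \<open>S\<close> of labels is symmetric, so the labels of the unoriented edges can be chosen
  independently.
\<close>

locale labelled_graph = regular_graph \<Omega> r d + F: group F
  for \<Omega> :: "('v, 'e) pre_digraph" and r :: "'e \<Rightarrow> 'e" and d :: nat and F :: "'a monoid" +
  fixes S :: "'a set"
  assumes finS: "finite S" and neS: "S \<noteq> {}" and SF: "S \<subseteq> carrier F"
    and invS: "\<And>s. s \<in> S \<Longrightarrow> inv\<^bsub>F\<^esub> s \<in> S"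
begin

abbreviation "labellings \<equiv> sym_labellings F S \<Omega> r"

lemma finite_labellings: "finite labellings"
  by (rule finite_subset[OF _ finite_PiE[OF finite_arcs, of "\<lambda>_. S"]])
     (auto simp: sym_labellings_def finS)

lemma labellings_ne: "labellings \<noteq> {}"
proof -
  obtain s where s: "s \<in> S" using neS by auto
  \<comment> \<open>The choice \<open>c e\<close> depends only on the unoriented edge and thus orients it.\<close>
  define c where "c e = (SOME a. a \<in> {e, r e})" for e
  have c_mem: "c e \<in> {e, r e}" for e unfolding c_def by (rule someI[of _ e]) simp
  have c_r: "c (r e) = c e" for e
    unfolding c_def by (rule arg_cong[of _ _ Eps]) auto
  define \<alpha> where "\<alpha> = (\<lambda>e\<in>arcs \<Omega>. if c e = e then s else inv\<^bsub>F\<^esub> s)"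
  have "\<alpha> (r e) = inv\<^bsub>F\<^esub> (\<alpha> e)" if e: "e \<in> arcs \<Omega>" for e
  proof -
    have "c (r e) = r e \<longleftrightarrow> c e \<noteq> e"
      using c_mem[of e] arev_neq[OF e] by (auto simp: c_r)
    then show ?thesis using e s SF by (auto simp: \<alpha>_def)
  qed
  then have "\<alpha> \<in> labellings" using s invS by (auto simp: sym_labellings_def \<alpha>_def)
  then show ?thesis by auto
qed

text \<open>
  Replacing the label of \<open>e\<close>, and the inverse label of \<open>r e\<close>, is a bijection between the fibres.
\<close>

lemma card_fibre_of_arc:
  assumes e: "e \<in> arcs \<Omega>" and C: "C \<subseteq> labellings"
    and closed: "\<And>\<alpha> t. \<alpha> \<in> C \<Longrightarrow> t \<in> S \<Longrightarrow> \<alpha>(e := t, r e := inv\<^bsub>F\<^esub> t) \<in> C"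
    and s: "s \<in> S"
  shows "card {\<alpha> \<in> C. \<alpha> e = s} * card S = card C"
proof -
  have finC: "finite C" using C finite_labellings by (rule finite_subset)
  have re: "r e \<noteq> e" using e by (rule arev_neq)
  have le: "card {\<alpha> \<in> C. \<alpha> e = t} \<le> card {\<alpha> \<in> C. \<alpha> e = t'}" if t: "t \<in> S" "t' \<in> S" for t t'
  proof (rule card_inj_on_le)
    let ?u = "\<lambda>\<alpha>. \<alpha>(e := t', r e := inv\<^bsub>F\<^esub> t')"
    show "inj_on ?u {\<alpha> \<in> C. \<alpha> e = t}"
    proof (rule inj_onI)
      fix \<alpha> \<beta> assume a: "\<alpha> \<in> {\<alpha> \<in> C. \<alpha> e = t}" and b: "\<beta> \<in> {\<alpha> \<in> C. \<alpha> e = t}" and eq: "?u \<alpha> = ?u \<beta>"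
      show "\<alpha> = \<beta>"
      proof
        fix a'
        have "\<alpha> (r e) = inv\<^bsub>F\<^esub> t" "\<beta> (r e) = inv\<^bsub>F\<^esub> t"
          using a b C e by (auto simp: sym_labellings_def)
        then show "\<alpha> a' = \<beta> a'" using a b fun_cong[OF eq, of a'] by (auto split: if_splits)
      qed
    qed
    show "?u ` {\<alpha> \<in> C. \<alpha> e = t} \<subseteq> {\<alpha> \<in> C. \<alpha> e = t'}"
      using closed t re by auto
  qed (use finC in auto)
  have "card C = card (\<Union>t\<in>S. {\<alpha> \<in> C. \<alpha> e = t})"
  proof (rule arg_cong[where f=card])
    show "C = (\<Union>t\<in>S. {\<alpha> \<in> C. \<alpha> e = t})" using C e by (auto simp: sym_labellings_def)
  qed
  also have "\<dots> = (\<Sum>t\<in>S. card {\<alpha> \<in> C. \<alpha> e = t})"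
    by (rule card_UN_disjoint) (auto simp: finS finC)
  also have "\<dots> = (\<Sum>t\<in>S. card {\<alpha> \<in> C. \<alpha> e = s})"
    by (intro sum.cong refl antisym le s)
  finally show ?thesis by simp
qed

text \<open>
  The labels read along a list without repeated edges are independent and uniformly distributed.
\<close>

lemma card_fibre:
  assumes "edge_distinct q" "set q \<subseteq> arcs \<Omega>" "length w = length q" "set w \<subseteq> S"
  shows "card {\<alpha> \<in> labellings. map \<alpha> q = w} * card S ^ length q = card labellings"
  using assms
proof (induction q arbitrary: w)
  case (Cons e q)
  then obtain s w' where w: "w = s # w'" by (cases w) auto
  have e: "e \<in> arcs \<Omega>" "e \<notin> set q" "r e \<notin> set q"
    using Cons.prems by (auto simp: edge_distinct_def)
  define C where "C = {\<alpha> \<in> labellings. map \<alpha> q = w'}"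
  have upd: "\<alpha>(e := t, r e := inv\<^bsub>F\<^esub> t) \<in> C" if "\<alpha> \<in> C" "t \<in> S" for \<alpha> t
  proof -
    have "r a = e \<longleftrightarrow> a = r e" for a using arev_arev by metis
    then have "\<alpha>(e := t, r e := inv\<^bsub>F\<^esub> t) \<in> labellings"
      using that e SF invS[OF that(2)] arev_neq[OF e(1)]
      by (auto simp: C_def sym_labellings_def PiE_iff extensional_def arev_eq_iff)
    moreover have "map (\<alpha>(e := t, r e := inv\<^bsub>F\<^esub> t)) q = map \<alpha> q"
      using e by (intro map_cong) auto
    ultimately show ?thesis using that(1) by (simp only: C_def mem_Collect_eq)
  qed
  have "card {\<alpha> \<in> C. \<alpha> e = s} * card S = card C"
    using Cons.prems w upd by (intro card_fibre_of_arc e) (auto simp: C_def)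
  moreover have "{\<alpha> \<in> C. \<alpha> e = s} = {\<alpha> \<in> labellings. map \<alpha> (e # q) = w}"
    by (auto simp: C_def w)
  moreover have "card C * card S ^ length q = card labellings"
    unfolding C_def using Cons.prems w by (intro Cons.IH) (auto simp: edge_distinct_def)
  moreover have "card S ^ length (e # q) = card S * card S ^ length q" by simp
  ultimately show ?case by (simp only: mult.assoc[symmetric])
qed simp

text \<open>
  The number of non-backtracking walks whose label is the word \<open>w\<close>.
\<close>

definition word_count :: "('e \<Rightarrow> 'a) \<Rightarrow> 'a list \<Rightarrow> nat" where
  "word_count \<alpha> w = card {q \<in> nb_walks (length w). map \<alpha> q = w}"

text \<open>
  Chebyshev's inequality for \<open>word_count\<close>. Pairs of walks without a common edge are uncorrelated,
  and each walk shares an edge with a number of walks that is bounded independently of the number of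
  vertices.
\<close>

lemma card_underrepresented_le:
  assumes d: "d \<ge> 2" and ne: "verts \<Omega> \<noteq> {}"
    and ed: "\<And>q. q \<in> nb_walks (Suc m) \<Longrightarrow> edge_distinct q"
    and w: "length w = Suc m" "set w \<subseteq> S"
  shows "real (card {\<alpha> \<in> labellings. real (word_count \<alpha> w) < card (nb_walks (Suc m)) / (2 * card S ^ Suc m)})
    \<le> 4 * (2 * Suc m * Suc m * (d - 1) ^ m) * (real (card S) ^ Suc m)\<^sup>2 / card (nb_walks (Suc m)) * card labellings"
proof -
  define W where "W = nb_walks (Suc m)"
  define n where "n = real (card W)"
  define s where "s = real (card S) ^ Suc m"
  define N where "N = real (card labellings)"
  define B where "B = real (2 * Suc m * Suc m * (d - 1) ^ m)"
  define I where "I \<alpha> q = (if map \<alpha> q = w then 1 else 0 :: real)" for \<alpha> :: "'e \<Rightarrow> 'a" and q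
  define Y where "Y \<alpha> = (\<Sum>q\<in>W. I \<alpha> q)" for \<alpha>
  define \<mu> where "\<mu> = n / s"
  have fW: "finite W" by (simp add: W_def finite_nb_walks)
  have pos: "n > 0" "s > 0" "N \<ge> 0"
    using d ne finS neS finite_verts
    by (auto simp: n_def s_def N_def W_def card_nb_walks card_gt_0_iff simp del: power_Suc)
  have Y: "Y \<alpha> = real (word_count \<alpha> w)" for \<alpha>
    unfolding Y_def I_def word_count_def w(1) W_def[symmetric]
    using fW by (simp add: sum.If_cases Int_def)
  have one: "(\<Sum>\<alpha>\<in>labellings. I \<alpha> q) = N / s" if q: "q \<in> W" for q
  proof -
    have "card {\<alpha> \<in> labellings. map \<alpha> q = w} * card S ^ length q = card labellings"
      using q w ed by (intro card_fibre) (auto simp: W_def nb_walks_def)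
    then have "real (card {\<alpha> \<in> labellings. map \<alpha> q = w}) * s = N"
      unfolding s_def N_def using q by (simp only: of_nat_mult[symmetric] of_nat_power[symmetric] W_def nb_walks_def mem_Collect_eq)
    then show ?thesis using pos
      by (simp add: I_def sum.If_cases Int_def finite_labellings field_simps)
  qed
  have two: "(\<Sum>\<alpha>\<in>labellings. I \<alpha> q * I \<alpha> q') \<le> N / s\<^sup>2 + (if share_edge q q' then N else 0)"
    if q: "q \<in> W" "q' \<in> W" for q q'
  proof (cases "share_edge q q'")
    case True
    have "(\<Sum>\<alpha>\<in>labellings. I \<alpha> q * I \<alpha> q') \<le> (\<Sum>\<alpha>\<in>labellings. 1)"
      by (intro sum_mono) (auto simp: I_def)
    also have "\<dots> = N" by (simp add: N_def)
    finally have "(\<Sum>\<alpha>\<in>labellings. I \<alpha> q * I \<alpha> q') \<le> N" .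
    moreover have "0 \<le> N / s\<^sup>2" using pos by simp
    ultimately show ?thesis using True by simp
  next
    case False
    have len: "length q = Suc m" "length q' = Suc m" using q by (auto simp: W_def nb_walks_def)
    have rr: "r a \<in> set q \<Longrightarrow> a \<in> set q' \<Longrightarrow> share_edge q q'" for a
      unfolding share_edge_def by (metis arev_arev)
    have "edge_distinct q" "edge_distinct q'" using ed q by (auto simp: W_def)
    then have "edge_distinct (q @ q')"
      using False rr unfolding edge_distinct_def by (auto simp: share_edge_def)
    then have "card {\<alpha> \<in> labellings. map \<alpha> (q @ q') = w @ w} * card S ^ length (q @ q') = card labellings"
      using q w by (intro card_fibre) (auto simp: W_def nb_walks_def)
    then have "real (card {\<alpha> \<in> labellings. map \<alpha> (q @ q') = w @ w}) * s\<^sup>2 = N"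
      unfolding s_def N_def power2_eq_square power_add[symmetric]
      by (simp only: of_nat_mult[symmetric] of_nat_power[symmetric] length_append len)
    moreover have "(\<Sum>\<alpha>\<in>labellings. I \<alpha> q * I \<alpha> q') = real (card {\<alpha> \<in> labellings. map \<alpha> (q @ q') = w @ w})"
    proof -
      have "(\<Sum>\<alpha>\<in>labellings. I \<alpha> q * I \<alpha> q') = (\<Sum>\<alpha>\<in>labellings. if map \<alpha> (q @ q') = w @ w then 1 else 0)"
        using len w by (intro sum.cong) (auto simp: I_def)
      then show ?thesis by (simp add: sum.If_cases Int_def finite_labellings)
    qed
    ultimately show ?thesis using False pos by (simp add: field_simps)
  qed
  have first: "(\<Sum>\<alpha>\<in>labellings. Y \<alpha>) = \<mu> * N"
    unfolding Y_def by (subst sum.swap) (simp add: one \<mu>_def n_def)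
  have second: "(\<Sum>\<alpha>\<in>labellings. (Y \<alpha>)\<^sup>2) \<le> \<mu>\<^sup>2 * N + n * B * N"
  proof -
    have "(\<Sum>\<alpha>\<in>labellings. (Y \<alpha>)\<^sup>2) = (\<Sum>\<alpha>\<in>labellings. \<Sum>q\<in>W. \<Sum>q'\<in>W. I \<alpha> q * I \<alpha> q')"
      by (simp add: Y_def power2_eq_square sum_product)
    also have "\<dots> = (\<Sum>q\<in>W. \<Sum>\<alpha>\<in>labellings. \<Sum>q'\<in>W. I \<alpha> q * I \<alpha> q')" by (rule sum.swap)
    also have "\<dots> = (\<Sum>q\<in>W. \<Sum>q'\<in>W. \<Sum>\<alpha>\<in>labellings. I \<alpha> q * I \<alpha> q')"
      by (intro sum.cong refl sum.swap)
    also have "\<dots> \<le> (\<Sum>q\<in>W. \<Sum>q'\<in>W. N / s\<^sup>2 + (if share_edge q q' then N else 0))"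
      by (intro sum_mono two)
    also have "\<dots> = (\<Sum>q\<in>W. n * (N / s\<^sup>2) + card {q' \<in> W. share_edge q q'} * N)"
      using fW by (intro sum.cong refl) (simp add: sum.distrib n_def sum.If_cases Int_def)
    also have "\<dots> \<le> (\<Sum>q\<in>W. n * (N / s\<^sup>2) + B * N)"
    proof (intro sum_mono add_left_mono mult_right_mono)
      fix q assume "q \<in> W"
      then show "real (card {q' \<in> W. share_edge q q'}) \<le> B"
        unfolding W_def B_def by (intro of_nat_mono card_share_edge_le)
    qed (use pos in auto)
    also have "\<dots> = \<mu>\<^sup>2 * N + n * B * N"
      by (simp add: n_def[symmetric] \<mu>_def power2_eq_square algebra_simps)
    finally show ?thesis .
  qed
  have var: "(\<Sum>\<alpha>\<in>labellings. (Y \<alpha> - \<mu>)\<^sup>2) \<le> n * B * N"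
  proof -
    have "(\<Sum>\<alpha>\<in>labellings. (Y \<alpha> - \<mu>)\<^sup>2) = (\<Sum>\<alpha>\<in>labellings. (Y \<alpha>)\<^sup>2) - 2 * \<mu> * (\<Sum>\<alpha>\<in>labellings. Y \<alpha>) + N * \<mu>\<^sup>2"
      by (simp add: power2_diff sum.distrib sum_subtractf sum_distrib_left N_def mult_ac)
    also have "\<dots> \<le> n * B * N" using second by (simp add: first power2_eq_square algebra_simps)
    finally show ?thesis .
  qed
  define bad where "bad = {\<alpha> \<in> labellings. Y \<alpha> < n / (2 * s)}"
  have "real (card bad) * (\<mu>\<^sup>2 / 4) = (\<Sum>\<alpha>\<in>bad. (\<mu> / 2)\<^sup>2)" by (simp add: power_divide)
  also have "\<dots> \<le> (\<Sum>\<alpha>\<in>bad. (Y \<alpha> - \<mu>)\<^sup>2)"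
  proof (rule sum_mono)
    fix \<alpha> assume "\<alpha> \<in> bad"
    then have "\<mu> / 2 \<le> \<mu> - Y \<alpha>" by (simp add: bad_def \<mu>_def field_simps)
    moreover have "0 \<le> \<mu> / 2" using pos by (simp add: \<mu>_def)
    ultimately have "(\<mu> / 2)\<^sup>2 \<le> (\<mu> - Y \<alpha>)\<^sup>2" by (rule power_mono)
    then show "(\<mu> / 2)\<^sup>2 \<le> (Y \<alpha> - \<mu>)\<^sup>2" by (simp add: power2_commute)
  qed
  also have "\<dots> \<le> (\<Sum>\<alpha>\<in>labellings. (Y \<alpha> - \<mu>)\<^sup>2)"
    by (intro sum_mono2 finite_labellings) (auto simp: bad_def)
  finally have "real (card bad) * (\<mu>\<^sup>2 / 4) \<le> n * B * N" using var by linarith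
  then have "real (card bad) * n\<^sup>2 \<le> 4 * n * B * N * s\<^sup>2"
    using pos by (simp add: \<mu>_def power_divide field_simps)
  then have "real (card bad) * n \<le> 4 * B * N * s\<^sup>2"
    using pos by (simp add: power2_eq_square)
  then have "real (card bad) \<le> 4 * B * s\<^sup>2 / n * N"
    using pos by (simp add: field_simps)
  moreover have "bad = {\<alpha> \<in> labellings. real (word_count \<alpha> w) < card (nb_walks (Suc m)) / (2 * card S ^ Suc m)}"
    by (simp add: bad_def Y n_def W_def s_def)
  ultimately show ?thesis unfolding B_def s_def n_def N_def W_def by simp
qed

text \<open>
  Every word of length \<open>m\<close> in \<open>S\<close> labels at least half of the expected number of walks.
\<close>

definition equidistributed :: "nat \<Rightarrow> ('e \<Rightarrow> 'a) \<Rightarrow> bool" where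
  "equidistributed m \<alpha> \<longleftrightarrow> (\<forall>w. length w = m \<longrightarrow> set w \<subseteq> S \<longrightarrow>
      card (nb_walks m) / (2 * card S ^ m) \<le> word_count \<alpha> w)"

lemma card_not_equidistributed_le:
  assumes d: "d \<ge> 2" and ne: "verts \<Omega> \<noteq> {}" and girth: "enat (Suc m) < girth \<Omega> r"
  shows "real (card {\<alpha> \<in> labellings. \<not> equidistributed (Suc m) \<alpha>})
    \<le> 4 * (2 * Suc m * Suc m * (d - 1) ^ m) * real (card S) ^ (3 * Suc m) / card (verts \<Omega>) * card labellings"
proof -
  define b where "b = 4 * (2 * Suc m * Suc m * (d - 1) ^ m) * (real (card S) ^ Suc m)\<^sup>2 * card labellings"
  define L where "L = {w. set w \<subseteq> S \<and> length w = Suc m}"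
  have fL: "finite L" "card L = card S ^ Suc m"
    unfolding L_def by (rule finite_lists_length_eq[OF finS], rule card_lists_length_eq[OF finS])
  have "real (card {\<alpha> \<in> labellings. \<not> equidistributed (Suc m) \<alpha>})
     \<le> real (card (\<Union>w\<in>L. {\<alpha> \<in> labellings. real (word_count \<alpha> w) < card (nb_walks (Suc m)) / (2 * card S ^ Suc m)}))"
    using fL(1) finite_labellings
    by (intro of_nat_mono card_mono) (auto simp: equidistributed_def L_def not_le simp del: power_Suc)
  also have "\<dots> \<le> (\<Sum>w\<in>L. real (card {\<alpha> \<in> labellings. real (word_count \<alpha> w) < card (nb_walks (Suc m)) / (2 * card S ^ Suc m)}))"
    unfolding of_nat_sum[symmetric] using fL(1) by (intro of_nat_mono card_UN_le)
  also have "\<dots> \<le> (\<Sum>w\<in>L. b / card (nb_walks (Suc m)))"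
  proof (rule sum_mono)
    fix w assume "w \<in> L"
    then show "real (card {\<alpha> \<in> labellings. real (word_count \<alpha> w) < card (nb_walks (Suc m)) / (2 * card S ^ Suc m)})
       \<le> b / card (nb_walks (Suc m))"
      using card_underrepresented_le[OF d ne nb_walks_edge_distinct[OF _ girth], where w=w]
      unfolding b_def L_def by (simp only: times_divide_eq_left mem_Collect_eq)
  qed
  also have "\<dots> = real (card S) ^ Suc m * (b / card (nb_walks (Suc m)))" by (simp add: fL(2))
  also have "\<dots> \<le> real (card S) ^ Suc m * (b / card (verts \<Omega>))"
  proof (intro mult_left_mono divide_left_mono)
    have "1 \<le> d * (d - 1) ^ m" using d by (simp add: Suc_le_eq)
    then have "card (verts \<Omega>) * 1 \<le> card (nb_walks (Suc m))"
      unfolding card_nb_walks by (intro mult_le_mono2)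
    then show "real (card (verts \<Omega>)) \<le> real (card (nb_walks (Suc m)))" by simp
    then show "0 < real (card (nb_walks (Suc m))) * real (card (verts \<Omega>))"
      using ne finite_verts by (auto simp: card_gt_0_iff intro!: mult_pos_pos)
  qed (auto simp: b_def)
  also have "\<dots> = 4 * (2 * Suc m * Suc m * (d - 1) ^ m) * real (card S) ^ (3 * Suc m) / card (verts \<Omega>) * card labellings"
  proof -
    have "real (card S) ^ (3 * Suc m) = real (card S) ^ Suc m * (real (card S) ^ Suc m)\<^sup>2"
    proof -
      have "3 * Suc m = Suc m + Suc m * 2" by simp
      then show ?thesis by (simp only: power_add power_mult)
    qed
    then show ?thesis by (simp only: b_def times_divide_eq_left times_divide_eq_right mult_ac)
  qed
  finally show ?thesis .
qed

end

text \<open>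
  For each length \<open>m\<close> the probability that the labelling of \<open>\<Omega> n\<close> is not equidistributed tends to
  \<open>0\<close> as \<open>n\<close> grows, so almost surely it is equidistributed for at least one \<open>n\<close>. Only countably many
  \<open>m\<close> occur, hence a single null set serves all lengths.
\<close>

lemma AE_exists_equidistributed:
  fixes \<Omega> :: "nat \<Rightarrow> ('v, 'e) pre_digraph" and F :: "'a monoid"
  assumes graph: "\<And>n. labelled_graph (\<Omega> n) (r n) d F S" and d: "d \<ge> 2"
    and ne: "\<And>n. verts (\<Omega> n) \<noteq> {}"
    and large: "filterlim (\<lambda>n. card (verts (\<Omega> n))) at_top sequentially"
    and girth: "\<And>m. \<forall>\<^sub>F n in sequentially. enat m < girth (\<Omega> n) (r n)"
  shows "AE \<alpha> in PiM UNIV (\<lambda>n. uniform_count_measure (sym_labellings F S (\<Omega> n) (r n))).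
           (\<forall>n. \<alpha> n \<in> sym_labellings F S (\<Omega> n) (r n)) \<and>
           (\<forall>m. \<exists>n. labelled_graph.equidistributed (\<Omega> n) (r n) S (Suc m) (\<alpha> n))"
proof -
  define A where "A n = sym_labellings F S (\<Omega> n) (r n)" for n
  define U where "U n = uniform_count_measure (A n)" for n
  have A: "finite (A n)" "A n \<noteq> {}" for n
    unfolding A_def using labelled_graph.finite_labellings[OF graph] labelled_graph.labellings_ne[OF graph] by auto
  have prob: "prob_space (U n)" for n
    unfolding U_def using A by (rule prob_space_uniform_count_measure)
  interpret product_prob_space U UNIV
    using prob by (simp add: product_prob_space_def product_prob_space_axioms_def product_sigma_finite_def prob_space_imp_sigma_finite)
  have "AE \<alpha> in PiM UNIV U. \<exists>n. labelled_graph.equidistributed (\<Omega> n) (r n) S (Suc m) (\<alpha> n)" for m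
  proof -
    define E where "E n = {\<beta> \<in> A n. \<not> labelled_graph.equidistributed (\<Omega> n) (r n) S (Suc m) \<beta>}" for n
    define b where "b = 4 * real (2 * Suc m * Suc m * (d - 1) ^ m) * real (card S) ^ (3 * Suc m)"
    define Z where "Z = {\<alpha> \<in> space (PiM UNIV U). \<forall>n. \<alpha> n \<in> E n}"
    have sp: "space (U n) = A n" "sets (U n) = Pow (A n)" for n
      by (auto simp: U_def space_uniform_count_measure sets_uniform_count_measure)
    have E: "E n \<in> sets (U n)" for n by (auto simp: sp E_def)
    have Zm: "Z \<in> sets (PiM UNIV U)"
      unfolding Z_def by (intro sets.sets_Collect_countable_All) (use E in \<open>auto intro: sets_Collect_single\<close>)
    have le: "\<forall>\<^sub>F n in sequentially. measure (PiM UNIV U) Z \<le> b / card (verts (\<Omega> n))"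
      using girth[of "Suc m"]
    proof eventually_elim
      case (elim n)
      have "emeasure (PiM UNIV U) Z \<le> emeasure (PiM UNIV U) {\<alpha> \<in> space (PiM UNIV U). \<alpha> n \<in> E n}"
        by (rule emeasure_mono) (use E in \<open>auto simp: Z_def intro: sets_Collect_single\<close>)
      also have "\<dots> = emeasure (U n) (E n)" using E by (intro emeasure_PiM_Collect_single) auto
      finally have "measure (PiM UNIV U) Z \<le> measure (U n) (E n)"
        by (simp add: emeasure_eq_measure M.emeasure_eq_measure)
      also have "\<dots> = card (E n) / card (A n)"
        unfolding U_def using A by (intro measure_uniform_count_measure) (auto simp: E_def)
      also have "\<dots> \<le> (b / card (verts (\<Omega> n)) * card (A n)) / card (A n)"
        using labelled_graph.card_not_equidistributed_le[OF graph d ne elim]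
        unfolding b_def E_def A_def by (intro divide_right_mono) auto
      also have "\<dots> = b / card (verts (\<Omega> n))" using A by (simp add: card_gt_0_iff)
      finally show ?case .
    qed
    have "(\<lambda>n. b / card (verts (\<Omega> n))) \<longlonglongrightarrow> 0"
      by (intro tendsto_divide_0[OF tendsto_const] filterlim_at_top_imp_at_infinity
          filterlim_compose[OF filterlim_real_sequentially large])
    then have "measure (PiM UNIV U) Z \<le> 0"
      using le by (rule tendsto_lowerbound) simp
    then have "emeasure (PiM UNIV U) Z = 0"
      by (simp add: emeasure_eq_measure measure_le_0_iff)
    then have "Z \<in> null_sets (PiM UNIV U)" using Zm by auto
    then show ?thesis
      by (rule AE_I') (auto simp: Z_def E_def space_PiM sp)
  qed
  then have "AE \<alpha> in PiM UNIV U. \<forall>m. \<exists>n. labelled_graph.equidistributed (\<Omega> n) (r n) S (Suc m) (\<alpha> n)"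
    by (simp add: AE_all_countable)
  moreover have "AE \<alpha> in PiM UNIV U. \<forall>n. \<alpha> n \<in> A n"
    by (rule AE_I2) (auto simp: space_PiM U_def space_uniform_count_measure)
  ultimately show ?thesis unfolding U_def A_def by auto
qed

section \<open>Points of \<open>L\<^sup>p\<close>-spaces and the scalar Poincare inequality\<close>

text \<open>
  The point of \<open>L\<^sup>p(M)\<close> represented by the function \<open>f\<close>.
\<close>

abbreviation Lp_class :: "real \<Rightarrow> 'b measure \<Rightarrow> ('b \<Rightarrow> real) \<Rightarrow> ('b \<Rightarrow> real) set" where
  "Lp_class p M f \<equiv> Lp_rel p M `` {f}"

lemma equiv_Lp_rel: "equiv (Lp_fun p M) (Lp_rel p M)"
proof (rule equivI)
  show "refl_on (Lp_fun p M) (Lp_rel p M)" by (auto simp: refl_on_def Lp_rel_def)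
  show "sym (Lp_rel p M)"
  proof (rule symI)
    fix f g assume fg: "(f, g) \<in> Lp_rel p M"
    then have "AE x in M. f x = g x" by (simp add: Lp_rel_def)
    then have "AE x in M. g x = f x" by eventually_elim simp
    then show "(g, f) \<in> Lp_rel p M" using fg by (simp add: Lp_rel_def)
  qed
  show "trans (Lp_rel p M)"
  proof (rule transI)
    fix f g h assume "(f, g) \<in> Lp_rel p M" "(g, h) \<in> Lp_rel p M"
    then have fh: "f \<in> Lp_fun p M" "h \<in> Lp_fun p M" and fgh: "AE x in M. f x = g x" "AE x in M. g x = h x"
      by (auto simp: Lp_rel_def)
    from fgh have "AE x in M. f x = h x" by eventually_elim simp
    then show "(f, h) \<in> Lp_rel p M" using fh by (simp add: Lp_rel_def)
  qed
  show "Lp_rel p M \<subseteq> Lp_fun p M \<times> Lp_fun p M" by (auto simp: Lp_rel_def)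
qed

lemma Lp_class_in: "f \<in> Lp_fun p M \<Longrightarrow> Lp_class p M f \<in> Lp_space p M"
  unfolding Lp_space_def by (rule quotientI)

lemma Lp_class_eq_iff:
  assumes "f \<in> Lp_fun p M" "g \<in> Lp_fun p M"
  shows "Lp_class p M f = Lp_class p M g \<longleftrightarrow> (AE x in M. f x = g x)"
  using eq_equiv_class_iff[OF equiv_Lp_rel assms] assms by (simp add: Lp_rel_def)

lemma Lp_rep_in:
  assumes "A \<in> Lp_space p M"
  shows "Lp_rep A \<in> Lp_fun p M" and "Lp_class p M (Lp_rep A) = A"
proof -
  obtain f where f: "f \<in> Lp_fun p M" "A = Lp_class p M f"
    using assms unfolding Lp_space_def by (rule quotientE)
  have "f \<in> A" using f equiv_class_self[OF equiv_Lp_rel f(1)] by simp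
  then have rep: "Lp_rep A \<in> A" unfolding Lp_rep_def by (rule someI[of "\<lambda>f. f \<in> A"])
  then show "Lp_rep A \<in> Lp_fun p M" using f by (auto simp: Lp_rel_def)
  show "Lp_class p M (Lp_rep A) = A"
    using equiv_class_eq[OF equiv_Lp_rel, of f "Lp_rep A" p M] rep f by auto
qed

lemma Lp_rep_class:
  assumes "f \<in> Lp_fun p M"
  shows "AE x in M. Lp_rep (Lp_class p M f) x = f x"
  using Lp_rep_in[OF Lp_class_in[OF assms]] Lp_class_eq_iff[of "Lp_rep (Lp_class p M f)" p M f] assms
  by simp

lemma Lp_pow_cong:
  assumes "f \<in> Lp_fun p M" "g \<in> Lp_fun p M" "f' \<in> Lp_fun p M" "g' \<in> Lp_fun p M"
    and "AE x in M. f x = f' x" "AE x in M. g x = g' x"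
  shows "Lp_pow p M f g = Lp_pow p M f' g'"
proof -
  have [measurable]: "f \<in> borel_measurable M" "g \<in> borel_measurable M"
    "f' \<in> borel_measurable M" "g' \<in> borel_measurable M"
    using assms by (auto simp: Lp_fun_def)
  have "AE x in M. \<bar>f x - g x\<bar> powr p = \<bar>f' x - g' x\<bar> powr p"
    using assms(5,6) by eventually_elim simp
  then show ?thesis unfolding Lp_pow_def by (intro integral_cong_AE) measurable
qed

lemma Lp_dist_powr:
  assumes "0 < p" "f \<in> Lp_fun p M" "g \<in> Lp_fun p M"
  shows "Lp_dist p M (Lp_class p M f) (Lp_class p M g) powr p = Lp_pow p M f g"
proof -
  have "Lp_pow p M (Lp_rep (Lp_class p M f)) (Lp_rep (Lp_class p M g)) = Lp_pow p M f g"
    using assms by (intro Lp_pow_cong Lp_rep_in Lp_class_in Lp_rep_class)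
  moreover have "0 \<le> Lp_pow p M (Lp_rep (Lp_class p M f)) (Lp_rep (Lp_class p M g))"
    by (rule Lp_pow_nonneg)
  ultimately show ?thesis using assms(1)
    by (simp add: Lp_dist_def Lp_pow_def powr_powr)
qed

lemma Lp_line_class:
  assumes "0 < p" "f \<in> Lp_fun p M" "g \<in> Lp_fun p M"
  shows "Lp_line p M t (Lp_class p M f) (Lp_class p M g) = Lp_class p M (\<lambda>x. (1 - t) * f x + t * g x)"
  unfolding Lp_line_def
proof (subst Lp_class_eq_iff)
  show "AE x in M. (1 - t) * Lp_rep (Lp_class p M f) x + t * Lp_rep (Lp_class p M g) x = (1 - t) * f x + t * g x"
    using Lp_rep_class[OF assms(2)] Lp_rep_class[OF assms(3)] by eventually_elim simp
qed (use assms in \<open>auto intro!: Lp_fun_lincomb Lp_rep_in Lp_class_in\<close>)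

text \<open>
  The Poincare inequality for real-valued functions is the case of the one-point measure space, whose
  \<open>L\<^sup>p\<close>-space is the real line.
\<close>

lemma expander_scalar_poincare:
  fixes \<Omega> :: "nat \<Rightarrow> ('v, 'e) pre_digraph"
  assumes p: "0 < p" and exp: "p_expander_Lp p \<Omega>"
  shows "\<exists>C\<ge>0. \<forall>n. \<forall>f :: 'v \<Rightarrow> real.
     1 / (real (card (verts (\<Omega> n))))\<^sup>2 * (\<Sum>u\<in>verts (\<Omega> n). \<Sum>v\<in>verts (\<Omega> n). \<bar>f u - f v\<bar> powr p)
     \<le> C / real (card (arcs (\<Omega> n))) * (\<Sum>e\<in>arcs (\<Omega> n). \<bar>f (tail (\<Omega> n) e) - f (head (\<Omega> n) e)\<bar> powr p)"
proof -
  define M where "M = count_space {0::real}"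
  obtain C where C: "\<And>n f. f ` verts (\<Omega> n) \<subseteq> Lp_space p M \<Longrightarrow>
        1 / (real (card (verts (\<Omega> n))))\<^sup>2 *
          (\<Sum>u\<in>verts (\<Omega> n). \<Sum>v\<in>verts (\<Omega> n). Lp_dist p M (f u) (f v) powr p)
        \<le> C / real (card (arcs (\<Omega> n))) *
          (\<Sum>e\<in>arcs (\<Omega> n). Lp_dist p M (f (tail (\<Omega> n) e)) (f (head (\<Omega> n) e)) powr p)"
    using exp unfolding p_expander_Lp_def p_expander_def by blast
  have fn: "f \<in> Lp_fun p M" for f
    by (simp add: Lp_fun_def M_def integrable_count_space)
  have "1 / (real (card (verts (\<Omega> n))))\<^sup>2 * (\<Sum>u\<in>verts (\<Omega> n). \<Sum>v\<in>verts (\<Omega> n). \<bar>f u - f v\<bar> powr p)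
     \<le> \<bar>C\<bar> / real (card (arcs (\<Omega> n))) * (\<Sum>e\<in>arcs (\<Omega> n). \<bar>f (tail (\<Omega> n) e) - f (head (\<Omega> n) e)\<bar> powr p)"
    for n and f :: "'v \<Rightarrow> real"
  proof -
    define g where "g v = Lp_class p M (\<lambda>_. f v)" for v
    have g: "Lp_dist p M (g u) (g v) powr p = \<bar>f u - f v\<bar> powr p" for u v
      unfolding g_def Lp_dist_powr[OF p fn fn]
      by (simp add: Lp_pow_def M_def lebesgue_integral_count_space_finite)
    have "1 / (real (card (verts (\<Omega> n))))\<^sup>2 * (\<Sum>u\<in>verts (\<Omega> n). \<Sum>v\<in>verts (\<Omega> n). \<bar>f u - f v\<bar> powr p)
       \<le> C / real (card (arcs (\<Omega> n))) * (\<Sum>e\<in>arcs (\<Omega> n). \<bar>f (tail (\<Omega> n) e) - f (head (\<Omega> n) e)\<bar> powr p)"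
      using C[of g n] Lp_class_in[OF fn] unfolding g by (auto simp: g_def)
    also have "\<dots> \<le> \<bar>C\<bar> / real (card (arcs (\<Omega> n))) * (\<Sum>e\<in>arcs (\<Omega> n). \<bar>f (tail (\<Omega> n) e) - f (head (\<Omega> n) e)\<bar> powr p)"
      by (intro mult_right_mono divide_right_mono sum_nonneg) auto
    finally show ?thesis .
  qed
  then show ?thesis by (intro exI[of _ "\<bar>C\<bar>"]) auto
qed

section \<open>Energy bounds from equidistributed labellings of expanders\<close>

lemma list_prod_simps:
  "list_prod G [] = \<one>\<^bsub>G\<^esub>" "list_prod G (x # xs) = x \<otimes>\<^bsub>G\<^esub> list_prod G xs"
  by (auto simp: list_prod_def)

lemma list_prod_closed:
  fixes G :: "'a monoid" (structure)
  assumes "group G" "set xs \<subseteq> carrier G"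
  shows "list_prod G xs \<in> carrier G"
proof -
  interpret group G by fact
  show ?thesis using assms(2) by (induction xs) (auto simp: list_prod_simps)
qed

lemma list_prod_append:
  fixes G :: "'a monoid" (structure)
  assumes "group G" "set xs \<subseteq> carrier G" "set ys \<subseteq> carrier G"
  shows "list_prod G (xs @ ys) = list_prod G xs \<otimes> list_prod G ys"
proof -
  interpret group G by fact
  show ?thesis using assms(2,3)
    by (induction xs) (auto simp: list_prod_simps list_prod_closed[OF assms(1)] m_assoc)
qed

lemma list_prod_rev_inv:
  fixes G :: "'a monoid" (structure)
  assumes "group G" "set xs \<subseteq> carrier G"
  shows "list_prod G (rev (map (m_inv G) xs)) = inv (list_prod G xs)"
proof -
  interpret group G by fact
  show ?thesis using assms(2)
  proof (induction xs)
    case (Cons x xs)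
    then have "set (rev (map (m_inv G) xs)) \<subseteq> carrier G" by auto
    then show ?case using Cons
      by (simp add: list_prod_simps list_prod_append[OF assms(1)] list_prod_closed[OF assms(1)] inv_mult_group)
  qed (simp add: list_prod_simps)
qed

lemma (in walk) walk_lists:
  assumes "g \<in> carrier G"
  shows "(P ^^ m) \<phi> g = (\<Sum>w | set w \<subseteq> S \<and> length w = m. \<phi> (g \<otimes> list_prod G w)) / card S ^ m"
  using assms
proof (induction m arbitrary: g)
  case 0
  have "{w. set w \<subseteq> S \<and> length w = 0} = {[]}" by auto
  then show ?case using 0 by (simp add: list_prod_simps)
next
  case (Suc m)
  define L where "L = {w. set w \<subseteq> S \<and> length w = m}"
  have fL: "finite L" unfolding L_def by (rule finite_lists_length_eq[OF finS])
  have L: "{w. set w \<subseteq> S \<and> length w = Suc m} = (\<lambda>(s, w). s # w) ` (S \<times> L)"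
    by (auto simp: L_def length_Suc_conv)
  have "(\<Sum>w | set w \<subseteq> S \<and> length w = Suc m. \<phi> (g \<otimes> list_prod G w))
      = (\<Sum>(s, w)\<in>S \<times> L. \<phi> (g \<otimes> list_prod G (s # w)))"
    unfolding L by (subst sum.reindex) (auto simp: inj_on_def case_prod_unfold)
  also have "\<dots> = (\<Sum>s\<in>S. \<Sum>w\<in>L. \<phi> (g \<otimes> s \<otimes> list_prod G w))"
  proof (subst sum.cartesian_product[symmetric], intro sum.cong refl)
    fix s w assume "s \<in> S" "w \<in> L"
    then have "s \<in> carrier G" "list_prod G w \<in> carrier G"
      using SG list_prod_closed[OF is_group, of w] by (auto simp: L_def)
    then show "\<phi> (g \<otimes> list_prod G (s # w)) = \<phi> (g \<otimes> s \<otimes> list_prod G w)"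
      using Suc.prems by (simp add: list_prod_simps m_assoc)
  qed
  also have "\<dots> / card S ^ Suc m = (\<Sum>s\<in>S. (\<Sum>w\<in>L. \<phi> (g \<otimes> s \<otimes> list_prod G w)) / card S ^ m) / card S"
    by (simp add: sum_divide_distrib mult.commute)
  also have "\<dots> = (\<Sum>s\<in>S. (P ^^ m) \<phi> (g \<otimes> s)) / card S"
    using Suc SG by (intro arg_cong2[of _ _ _ _ "(/)"] sum.cong refl) (auto simp: L_def)
  finally show ?case unfolding walk_Suc by simp
qed

text \<open>
  The geometric input. Sending a vertex \<open>v\<close> to \<open>g v\<close>, the label of a path from a base point to
  \<open>v\<close>, is well defined up to \<open>N\<close>, so \<open>F \<circ> g\<close> is a map from the graph to \<open>L\<^sup>p\<close>; integrating the scalar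
  inequality gives the Poincare inequality for it. By left invariance the distance of the images of the
  endpoints of a walk depends only on the label of the walk. For a single arc it is at most a
  multiple of \<open>energy 1 F\<close>. For walks of length \<open>Suc m\<close>, equidistribution of the labels makes the mean
  distance comparable to \<open>energy (Suc m) F\<close>, with a constant that does not depend on \<open>m\<close>.
\<close>

lemma (in Lp_maps) energy_le_of_equidistributed:
  fixes \<Omega> :: "('v, 'e) pre_digraph"
  assumes graph: "labelled_graph \<Omega> r d G S" and d: "d \<ge> 2"
    and conn: "strongly_connected \<Omega>"
    and \<alpha>: "\<alpha> \<in> sym_labellings G S \<Omega> r"
    and equi: "labelled_graph.equidistributed \<Omega> r S (Suc m) \<alpha>"
    and closed: "\<And>u q. pre_digraph.awalk \<Omega> u q u \<Longrightarrow> list_prod G (map \<alpha> q) \<in> N"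
    and invN: "\<And>F g n. F \<in> \<C> \<Longrightarrow> g \<in> carrier G \<Longrightarrow> n \<in> N \<Longrightarrow> AE x in M. F (g \<otimes> n) x = F g x"
    and C: "C \<ge> 0"
    and poincare: "\<And>f :: 'v \<Rightarrow> real. 1 / (real (card (verts \<Omega>)))\<^sup>2 * (\<Sum>u\<in>verts \<Omega>. \<Sum>v\<in>verts \<Omega>. \<bar>f u - f v\<bar> powr p)
     \<le> C / real (card (arcs \<Omega>)) * (\<Sum>e\<in>arcs \<Omega>. \<bar>f (tail \<Omega> e) - f (head \<Omega> e)\<bar> powr p)"
    and F: "F \<in> \<C>"
  shows "energy (Suc m) F \<le> 4 * 2 powr p * C * card S * energy 1 F"
proof -
  interpret \<Omega>: labelled_graph \<Omega> r d G S by (rule graph)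
  have \<alpha>S: "\<alpha> e \<in> S" and \<alpha>r: "\<alpha> (r e) = inv (\<alpha> e)" if "e \<in> arcs \<Omega>" for e
    using \<alpha> that by (auto simp: sym_labellings_def)
  define lab where "lab q = list_prod G (map \<alpha> q)" for q
  have mapG: "set (map \<alpha> q) \<subseteq> carrier G" if "set q \<subseteq> arcs \<Omega>" for q
    using that \<alpha>S SG by auto
  have labG: "lab q \<in> carrier G" if "set q \<subseteq> arcs \<Omega>" for q
    unfolding lab_def by (intro list_prod_closed is_group mapG that)
  have lab_append: "lab (q @ q') = lab q \<otimes> lab q'" if "set q \<subseteq> arcs \<Omega>" "set q' \<subseteq> arcs \<Omega>" for q q'
    unfolding lab_def map_append by (intro list_prod_append is_group mapG that)
  have lab_rev: "lab (rev (map r q)) = inv (lab q)" if "set q \<subseteq> arcs \<Omega>" for q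
  proof -
    have "map \<alpha> (rev (map r q)) = rev (map (m_inv G) (map \<alpha> q))"
      using that \<alpha>r by (auto simp: rev_map subset_eq)
    then show ?thesis unfolding lab_def using list_prod_rev_inv[OF is_group mapG[OF that]] by simp
  qed
  obtain u0 where u0: "u0 \<in> verts \<Omega>" using conn by (auto simp: strongly_connected_def)
  have "\<exists>q. \<Omega>.awalk u0 q v" if "v \<in> verts \<Omega>" for v
    using conn u0 that \<Omega>.reachable_awalk by (auto simp: strongly_connected_def)
  then obtain pth where pth: "\<And>v. v \<in> verts \<Omega> \<Longrightarrow> \<Omega>.awalk u0 (pth v) v" by metis
  have pthA: "set (pth v) \<subseteq> arcs \<Omega>" if "v \<in> verts \<Omega>" for v
    using pth[OF that] by (simp add: \<Omega>.awalk_def)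
  have rev_walk: "\<Omega>.awalk v (rev (map r q)) u" if "\<Omega>.awalk u q v" for u v q
    using that
  proof (induction q arbitrary: u)
    case Nil
    then show ?case by (auto simp: \<Omega>.awalk_Nil_iff)
  next
    case (Cons e q)
    then have e: "e \<in> arcs \<Omega>" "u = tail \<Omega> e" "\<Omega>.awalk (head \<Omega> e) q v"
      by (auto simp: \<Omega>.awalk_Cons_iff)
    then have "\<Omega>.awalk v (rev (map r q)) (head \<Omega> e)" by (intro Cons.IH)
    moreover have "\<Omega>.awalk (head \<Omega> e) [r e] u" using e by (simp add: \<Omega>.awalk_Cons_iff \<Omega>.awalk_Nil_iff)
    ultimately show ?case using \<Omega>.awalk_appendI by simp
  qed
  define g where "g v = lab (pth v)" for v
  have gG: "g v \<in> carrier G" if "v \<in> verts \<Omega>" for v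
    unfolding g_def by (intro labG pthA that)
  define D where "D u v = (\<Sum>t\<in>T. Lp_pow p M (F (t \<otimes> g u)) (F (t \<otimes> g v)))" for u v
  have LpF: "F (t \<otimes> a) \<in> Lp_fun p M" if "t \<in> T" "a \<in> carrier G" for t a
    using that TG F by (auto intro!: Lp)
  have D: "D v w = \<Delta> F \<one> (lab q)" if q: "\<Omega>.awalk v q w" for v q w
  proof -
    have qA: "set q \<subseteq> arcs \<Omega>" and vw: "v \<in> verts \<Omega>" "w \<in> verts \<Omega>"
      using q \<Omega>.awalk_last_in_verts[OF q] by (auto simp: \<Omega>.awalk_def)
    have rev_arcs: "set (rev (map r (pth w))) \<subseteq> arcs \<Omega>" using pthA[OF vw(2)] by auto
    define n where "n = lab (rev (map r (pth w)) @ pth v @ q)"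
    \<comment> \<open>The closed path through the base point is based at \<open>w\<close>, so that its label multiplies
      \<open>g w\<close> on the right.\<close>
    have "\<Omega>.awalk w (rev (map r (pth w)) @ pth v @ q) w"
      using rev_walk[OF pth[OF vw(2)]] pth[OF vw(1)] q by auto
    then have n: "n \<in> N" unfolding n_def lab_def by (rule closed)
    have n_eq: "n = inv (g w) \<otimes> (g v \<otimes> lab q)"
      unfolding n_def g_def using rev_arcs pthA[OF vw(1)] pthA[OF vw(2)] qA by (simp add: lab_append lab_rev)
    then have nG: "n \<in> carrier G" using gG vw labG[OF qA] by simp
    have eq: "g w \<otimes> n = g v \<otimes> lab q"
      unfolding n_eq using gG vw labG[OF qA] by (simp add: m_assoc[symmetric])
    have "Lp_pow p M (F (t \<otimes> g v)) (F (t \<otimes> g w)) = Lp_pow p M (F (t \<otimes> g v)) (F (t \<otimes> (g v \<otimes> lab q)))"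
      if t: "t \<in> T" for t
    proof (intro Lp_pow_cong LpF t gG vw)
      have tG: "t \<in> carrier G" using t TG by auto
      have "AE x in M. F (t \<otimes> g w \<otimes> n) x = F (t \<otimes> g w) x"
        using tG gG vw n by (intro invN F) auto
      moreover have "t \<otimes> g w \<otimes> n = t \<otimes> (g v \<otimes> lab q)"
        using tG gG vw nG by (simp add: m_assoc eq)
      ultimately have "AE x in M. F (t \<otimes> (g v \<otimes> lab q)) x = F (t \<otimes> g w) x" by simp
      then show "AE x in M. F (t \<otimes> g w) x = F (t \<otimes> (g v \<otimes> lab q)) x"
        by eventually_elim simp
    qed (use gG vw labG[OF qA] in auto)
    then have "D v w = \<Delta> F (g v) (g v \<otimes> lab q)"
      unfolding D_def \<Delta>_def dpow_def rt_def by (intro sum.cong) auto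
    also have "\<dots> = \<Delta> F \<one> (lab q)"
      using \<Delta>_left[OF F one_closed labG[OF qA] gG[OF vw(1)]] gG[OF vw(1)] by simp
    finally show ?thesis .
  qed
  have triangle: "D u w \<le> 2 powr p * (D u v + D v w)"
    if "u \<in> verts \<Omega>" "v \<in> verts \<Omega>" "w \<in> verts \<Omega>" for u v w
    unfolding D_def sum.distrib[symmetric] sum_distrib_left
    using that p by (intro sum_mono Lp_pow_triangle LpF gG) auto
  have D_nonneg: "0 \<le> D u v" for u v
    unfolding D_def by (intro sum_nonneg Lp_pow_nonneg)
  have D_poincare: "(\<Sum>u\<in>verts \<Omega>. \<Sum>v\<in>verts \<Omega>. D u v) / (real (card (verts \<Omega>)))\<^sup>2
      \<le> C / real (card (arcs \<Omega>)) * (\<Sum>e\<in>arcs \<Omega>. D (tail \<Omega> e) (head \<Omega> e))"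
  proof -
    have t: "1 / (real (card (verts \<Omega>)))\<^sup>2 * (\<Sum>u\<in>verts \<Omega>. \<Sum>v\<in>verts \<Omega>. Lp_pow p M (F (t \<otimes> g u)) (F (t \<otimes> g v)))
        \<le> C / real (card (arcs \<Omega>)) * (\<Sum>e\<in>arcs \<Omega>. Lp_pow p M (F (t \<otimes> g (tail \<Omega> e))) (F (t \<otimes> g (head \<Omega> e))))"
      if t: "t \<in> T" for t
    proof -
      have int: "integrable M (\<lambda>x. \<bar>F (t \<otimes> g u) x - F (t \<otimes> g v) x\<bar> powr p)"
        if "u \<in> verts \<Omega>" "v \<in> verts \<Omega>" for u v
        using that t p by (intro Lp_pow_integrable LpF gG) auto
      have "(LINT x|M. 1 / (real (card (verts \<Omega>)))\<^sup>2 * (\<Sum>u\<in>verts \<Omega>. \<Sum>v\<in>verts \<Omega>. \<bar>F (t \<otimes> g u) x - F (t \<otimes> g v) x\<bar> powr p))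
         \<le> (LINT x|M. C / real (card (arcs \<Omega>)) * (\<Sum>e\<in>arcs \<Omega>. \<bar>F (t \<otimes> g (tail \<Omega> e)) x - F (t \<otimes> g (head \<Omega> e)) x\<bar> powr p))"
      proof (rule integral_mono)
        fix x
        show "1 / (real (card (verts \<Omega>)))\<^sup>2 * (\<Sum>u\<in>verts \<Omega>. \<Sum>v\<in>verts \<Omega>. \<bar>F (t \<otimes> g u) x - F (t \<otimes> g v) x\<bar> powr p)
         \<le> C / real (card (arcs \<Omega>)) * (\<Sum>e\<in>arcs \<Omega>. \<bar>F (t \<otimes> g (tail \<Omega> e)) x - F (t \<otimes> g (head \<Omega> e)) x\<bar> powr p)"
          by (rule poincare[of "\<lambda>v. F (t \<otimes> g v) x"])
      qed (use int in auto)
      then show ?thesis using int by (simp add: Lp_pow_def)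
    qed
    have "(\<Sum>t\<in>T. 1 / (real (card (verts \<Omega>)))\<^sup>2 * (\<Sum>u\<in>verts \<Omega>. \<Sum>v\<in>verts \<Omega>. Lp_pow p M (F (t \<otimes> g u)) (F (t \<otimes> g v))))
        \<le> (\<Sum>t\<in>T. C / real (card (arcs \<Omega>)) * (\<Sum>e\<in>arcs \<Omega>. Lp_pow p M (F (t \<otimes> g (tail \<Omega> e))) (F (t \<otimes> g (head \<Omega> e)))))"
      by (intro sum_mono t)
    moreover have "(\<Sum>u\<in>verts \<Omega>. \<Sum>v\<in>verts \<Omega>. D u v)
      = (\<Sum>t\<in>T. \<Sum>u\<in>verts \<Omega>. \<Sum>v\<in>verts \<Omega>. Lp_pow p M (F (t \<otimes> g u)) (F (t \<otimes> g v)))"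
      unfolding D_def by (subst sum.swap[where A=T], intro sum.cong refl, rule sum.swap)
    moreover have "(\<Sum>e\<in>arcs \<Omega>. D (tail \<Omega> e) (head \<Omega> e))
      = (\<Sum>t\<in>T. \<Sum>e\<in>arcs \<Omega>. Lp_pow p M (F (t \<otimes> g (tail \<Omega> e))) (F (t \<otimes> g (head \<Omega> e))))"
      unfolding D_def by (rule sum.swap)
    ultimately show ?thesis by (simp add: sum_divide_distrib[symmetric] sum_distrib_left[symmetric])
  qed
  define W where "W = \<Omega>.nb_walks (Suc m)"
  define n where "n = real (card W)"
  define L where "L = {w. set w \<subseteq> S \<and> length w = Suc m}"
  define s where "s = real (card S) ^ Suc m"
  have "verts \<Omega> \<noteq> {}" using u0 by auto
  have "card (verts \<Omega>) > 0" using u0 \<Omega>.finite_verts by (auto simp: card_gt_0_iff)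
  then have "card W > 0" unfolding W_def \<Omega>.card_nb_walks using d by simp
  then have pos: "n > 0" "s > 0" unfolding n_def s_def using cardS by auto
  have fW: "finite W" unfolding W_def by (rule \<Omega>.finite_nb_walks)
  have fL: "finite L" unfolding L_def by (rule finite_lists_length_eq[OF finS])
  have Wwalk: "\<Omega>.awalk (tail \<Omega> (hd q)) q (head \<Omega> (last q))" if "q \<in> W" for q
    using that by (intro \<Omega>.nb_walk_awalk) (auto simp: W_def \<Omega>.nb_walks_def)
  have "energy (Suc m) F = (\<Sum>w\<in>L. \<Delta> F \<one> (list_prod G w)) / s"
  proof -
    have "(\<Sum>w\<in>L. \<Delta> F \<one> (\<one> \<otimes> list_prod G w)) = (\<Sum>w\<in>L. \<Delta> F \<one> (list_prod G w))"
      using SG by (intro sum.cong refl) (auto simp: L_def subset_eq l_one[OF list_prod_closed[OF is_group]])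
    then show ?thesis
      unfolding energy_def walk_lists[OF one_closed] L_def[symmetric] s_def by simp
  qed
  also have "\<dots> = (\<Sum>w\<in>L. \<Delta> F \<one> (list_prod G w) * (1 / s))"
    by (simp add: sum_divide_distrib)
  also have "\<dots> \<le> (\<Sum>w\<in>L. \<Delta> F \<one> (list_prod G w) * (2 / n * card {q \<in> W. map \<alpha> q = w}))"
  proof (intro sum_mono mult_left_mono \<Delta>_nonneg)
    fix w assume "w \<in> L"
    then have "n / (2 * s) \<le> card {q \<in> W. map \<alpha> q = w}"
      using equi unfolding \<Omega>.equidistributed_def \<Omega>.word_count_def L_def n_def W_def s_def by auto
    then show "1 / s \<le> 2 / n * card {q \<in> W. map \<alpha> q = w}"
      using pos by (simp add: field_simps)
  qed
  also have "\<dots> = 2 / n * (\<Sum>w\<in>L. \<Sum>q\<in>{q \<in> W. map \<alpha> q = w}. \<Delta> F \<one> (list_prod G (map \<alpha> q)))"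
    by (simp add: sum_distrib_left mult_ac)
  also have "(\<Sum>w\<in>L. \<Sum>q\<in>{q \<in> W. map \<alpha> q = w}. \<Delta> F \<one> (list_prod G (map \<alpha> q)))
      = (\<Sum>q\<in>W. \<Delta> F \<one> (list_prod G (map \<alpha> q)))"
    using \<alpha>S by (intro sum.group fW fL) (auto simp: W_def L_def \<Omega>.nb_walks_def subset_eq)
  also have "\<dots> = (\<Sum>q\<in>W. D (tail \<Omega> (hd q)) (head \<Omega> (last q)))"
    by (intro sum.cong refl) (simp add: D[OF Wwalk] lab_def)
  also have "2 / n * \<dots> = 2 * ((\<Sum>q\<in>W. D (tail \<Omega> (hd q)) (head \<Omega> (last q))) / n)" by simp
  also have "\<dots> \<le> 2 * (2 * 2 powr p * ((\<Sum>u\<in>verts \<Omega>. \<Sum>v\<in>verts \<Omega>. D u v) / (real (card (verts \<Omega>)))\<^sup>2))"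
    unfolding W_def n_def
    by (intro mult_left_mono \<Omega>.nb_walks_average_le triangle d \<open>verts \<Omega> \<noteq> {}\<close>) auto
  also have "\<dots> \<le> 2 * (2 * 2 powr p * (C / real (card (arcs \<Omega>)) * (\<Sum>e\<in>arcs \<Omega>. D (tail \<Omega> e) (head \<Omega> e))))"
    by (intro mult_left_mono D_poincare) auto
  also have "\<dots> \<le> 2 * (2 * 2 powr p * (C / real (card (arcs \<Omega>)) * (\<Sum>e\<in>arcs \<Omega>. card S * energy 1 F)))"
  proof (intro mult_left_mono sum_mono)
    fix e assume e: "e \<in> arcs \<Omega>"
    have "\<Omega>.awalk (tail \<Omega> e) [e] (head \<Omega> e)" using e by (simp add: \<Omega>.awalk_Cons_iff \<Omega>.awalk_Nil_iff)
    then have "D (tail \<Omega> e) (head \<Omega> e) = \<Delta> F \<one> (lab [e])" by (rule D)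
    also have "lab [e] = \<alpha> e" using \<alpha>S[OF e] SG by (auto simp: lab_def list_prod_simps)
    also have "\<Delta> F \<one> (\<alpha> e) \<le> (\<Sum>s\<in>S. \<Delta> F \<one> s)"
      using \<alpha>S[OF e] finS by (intro member_le_sum) (auto simp: \<Delta>_nonneg)
    also have "\<dots> = card S * energy 1 F" using cardS unfolding energy_one by simp
    finally show "D (tail \<Omega> e) (head \<Omega> e) \<le> card S * energy 1 F" .
  qed (use C in auto)
  also have "\<dots> \<le> 4 * 2 powr p * C * card S * energy 1 F"
  proof -
    have "C / real (card (arcs \<Omega>)) * (\<Sum>e\<in>arcs \<Omega>. card S * energy 1 F) \<le> C * card S * energy 1 F"
      using C energy_nonneg[of 1 F] by (cases "card (arcs \<Omega>) = 0") auto
    then have "4 * 2 powr p * (C / real (card (arcs \<Omega>)) * (\<Sum>e\<in>arcs \<Omega>. card S * energy 1 F))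
      \<le> 4 * 2 powr p * (C * card S * energy 1 F)" by (rule mult_left_mono) auto
    then show ?thesis by (simp only: mult.assoc) 
  qed
  finally show ?thesis .
qed

section \<open>Equivariant maps of a finite index subgroup\<close>

text \<open>
  A homomorphism \<open>\<psi>\<close> from a finite index subgroup \<open>H\<close> of \<open>F\<close> to a group acting by affine isometries
  on \<open>L\<^sup>p(M)\<close>, together with a finite set \<open>S\<close> of steps of a random walk on \<open>F\<close>.
\<close>

locale equivariant_maps = walk F S for F :: "'a monoid" (structure) and S +
  fixes p :: real and M :: "'b measure" and G :: "'g monoid"
    and \<phi> :: "'g \<Rightarrow> ('b \<Rightarrow> real) set \<Rightarrow> ('b \<Rightarrow> real) set"
    and H :: "'a set" and \<psi> :: "'a \<Rightarrow> 'g"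
  assumes p: "1 < p" and action: "affine_isometric_action p M G \<phi>" and groupG: "group G"
    and H: "subgroup H F" and fin: "finite (rcosets H)" and \<psi>: "\<psi> \<in> hom (F\<lparr>carrier := H\<rparr>) G"
begin

lemma \<psi>_closed: "h \<in> H \<Longrightarrow> \<psi> h \<in> carrier G"
  using \<psi> by (auto simp: hom_def)

lemma \<psi>_mult: "h \<in> H \<Longrightarrow> h' \<in> H \<Longrightarrow> \<psi> (h \<otimes> h') = \<psi> h \<otimes>\<^bsub>G\<^esub> \<psi> h'"
  using \<psi> by (auto simp: hom_def)

lemma HF: "h \<in> H \<Longrightarrow> h \<in> carrier F"
  using subgroup.mem_carrier[OF H] .

lemma group_action: "group_action G (Lp_space p M) \<phi>"
  using action by (simp add: affine_isometric_action_def)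

lemma act_closed: "g \<in> carrier G \<Longrightarrow> x \<in> Lp_space p M \<Longrightarrow> \<phi> g x \<in> Lp_space p M"
  by (rule group_action.element_image[OF group_action]) auto

lemma act_mult:
  "g \<in> carrier G \<Longrightarrow> g' \<in> carrier G \<Longrightarrow> x \<in> Lp_space p M \<Longrightarrow> \<phi> (g \<otimes>\<^bsub>G\<^esub> g') x = \<phi> g (\<phi> g' x)"
  by (rule group_action.composition_rule[OF group_action])

text \<open>
  A representative of the right coset of \<open>g\<close>, chosen as a function of the coset, and the resulting
  transversal.
\<close>

definition rep :: "'a \<Rightarrow> 'a" where
  "rep g = (SOME a. a \<in> H #> g)"

definition T :: "'a set" where
  "T = rep ` carrier F"

lemma rep_in: "g \<in> carrier F \<Longrightarrow> rep g \<in> H #> g"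
  unfolding rep_def by (rule someI[of _ g]) (rule rcos_self[OF _ H])

lemma rep_carrier: "g \<in> carrier F \<Longrightarrow> rep g \<in> carrier F"
  using rep_in[of g] HF by (auto simp: r_coset_def)

lemma rep_coset: "g \<in> carrier F \<Longrightarrow> H #> rep g = H #> g"
  using repr_independence[OF rep_in _ H] by simp

lemma rep_left: "h \<in> H \<Longrightarrow> g \<in> carrier F \<Longrightarrow> rep (h \<otimes> g) = rep g"
proof -
  assume h: "h \<in> H" and g: "g \<in> carrier F"
  have "H #> (h \<otimes> g) = (H #> h) #> g"
    using coset_mult_assoc[of H h g] subgroup.subset[OF H] HF[OF h] g by simp
  also have "H #> h = H" using coset_join2[OF HF[OF h] H h] .
  finally show ?thesis by (simp add: rep_def)
qed

lemma cocycle: "g \<in> carrier F \<Longrightarrow> g \<otimes> inv (rep g) \<in> H"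
proof -
  assume g: "g \<in> carrier F"
  obtain h where h: "h \<in> H" "rep g = h \<otimes> g" using rep_in[OF g] by (auto simp: r_coset_def)
  have "g \<otimes> inv (rep g) = inv h"
    using h g HF[OF h(1)] by (simp add: inv_mult_group m_assoc[symmetric])
  then show ?thesis using h H by (simp add: subgroup.m_inv_closed)
qed

lemma finite_T: "finite T"
proof -
  have "T = (\<lambda>A. SOME a. a \<in> A) ` (rcosets H)"
    by (auto simp: T_def rep_def RCOSETS_def)
  then show ?thesis using fin by simp
qed

lemma T_carrier: "T \<subseteq> carrier F"
  by (auto simp: T_def rep_carrier)

lemma rep_T: "t \<in> T \<Longrightarrow> rep t = t"
  unfolding T_def using rep_coset by (auto simp: rep_def)

lemma bij_rep_right:
  assumes a: "a \<in> carrier F"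
  shows "bij_betw (\<lambda>t. rep (t \<otimes> a)) T T"
proof -
  have "inj_on (\<lambda>t. rep (t \<otimes> a)) T"
  proof (rule inj_onI)
    fix t t' assume t: "t \<in> T" "t' \<in> T" and eq: "rep (t \<otimes> a) = rep (t' \<otimes> a)"
    have tF: "t \<in> carrier F" "t' \<in> carrier F" using t T_carrier by auto
    have HsF: "H \<subseteq> carrier F" using subgroup.subset[OF H] .
    have coset: "H #> u = (H #> (u \<otimes> a)) #> inv a" if "u \<in> carrier F" for u
      using that a HsF by (simp add: coset_mult_assoc m_assoc)
    have "H #> (t \<otimes> a) = H #> (t' \<otimes> a)"
      using rep_coset[of "t \<otimes> a"] rep_coset[of "t' \<otimes> a"] eq tF a by simp
    then have "H #> t = H #> t'" using coset[OF tF(1)] coset[OF tF(2)] by simp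
    then have "rep t = rep t'" by (simp add: rep_def)
    then show "t = t'" using rep_T t by simp
  qed
  moreover have "(\<lambda>t. rep (t \<otimes> a)) ` T \<subseteq> T" using T_carrier a by (auto simp: T_def)
  ultimately show ?thesis using finite_T by (simp add: bij_betw_def endo_inj_surj)
qed

text \<open>
  Maps \<open>E\<close> with \<open>E (h \<otimes> g) = \<psi> h \<cdot> E g\<close> in \<open>L\<^sup>p(M)\<close>. They are the points of the space of the action
  induced from \<open>H\<close> to \<open>F\<close>.
\<close>

definition equivariant :: "('a \<Rightarrow> 'b \<Rightarrow> real) set" where
  "equivariant = {E. \<forall>g\<in>carrier F. E g \<in> Lp_fun p M \<and>
     (\<forall>h\<in>H. Lp_class p M (E (h \<otimes> g)) = \<phi> (\<psi> h) (Lp_class p M (E g)))}"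

lemma equivariant_Lp: "E \<in> equivariant \<Longrightarrow> g \<in> carrier F \<Longrightarrow> E g \<in> Lp_fun p M"
  by (auto simp: equivariant_def)

lemma equivariant_act:
  "E \<in> equivariant \<Longrightarrow> g \<in> carrier F \<Longrightarrow> h \<in> H \<Longrightarrow>
     Lp_class p M (E (h \<otimes> g)) = \<phi> (\<psi> h) (Lp_class p M (E g))"
  by (auto simp: equivariant_def)

lemma equivariant_affine:
  assumes E: "E \<in> equivariant" "E' \<in> equivariant"
  shows "(\<lambda>g x. (1 - t) * E g x + t * E' g x) \<in> equivariant"
  unfolding equivariant_def
proof (intro CollectI ballI conjI)
  fix g assume g: "g \<in> carrier F"
  show "(\<lambda>x. (1 - t) * E g x + t * E' g x) \<in> Lp_fun p M"
    using p g E by (intro Lp_fun_lincomb equivariant_Lp) auto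
  fix h assume h: "h \<in> H"
  have hg: "h \<otimes> g \<in> carrier F" using h g HF by simp
  have line: "Lp_class p M (\<lambda>x. (1 - t) * E a x + t * E' a x)
      = Lp_line p M t (Lp_class p M (E a)) (Lp_class p M (E' a))" if "a \<in> carrier F" for a
    using p that E by (intro Lp_line_class[symmetric] equivariant_Lp) auto
  show "Lp_class p M (\<lambda>x. (1 - t) * E (h \<otimes> g) x + t * E' (h \<otimes> g) x)
      = \<phi> (\<psi> h) (Lp_class p M (\<lambda>x. (1 - t) * E g x + t * E' g x))"
    unfolding line[OF hg] line[OF g] equivariant_act[OF E(1) g h] equivariant_act[OF E(2) g h]
    using action \<psi>_closed[OF h] Lp_class_in[OF equivariant_Lp[OF E(1) g]] Lp_class_in[OF equivariant_Lp[OF E(2) g]]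
    by (simp add: affine_isometric_action_def)
qed

lemma equivariant_translate:
  assumes "E \<in> equivariant" "a \<in> carrier F"
  shows "(\<lambda>g. E (g \<otimes> a)) \<in> equivariant"
  unfolding equivariant_def
proof (intro CollectI ballI conjI)
  fix g assume g: "g \<in> carrier F"
  then show "E (g \<otimes> a) \<in> Lp_fun p M" using assms by (intro equivariant_Lp) auto
  fix h assume h: "h \<in> H"
  then show "Lp_class p M (E (h \<otimes> g \<otimes> a)) = \<phi> (\<psi> h) (Lp_class p M (E (g \<otimes> a)))"
    using equivariant_act[OF assms(1) _ h, of "g \<otimes> a"] g assms(2) HF[OF h] by (simp add: m_assoc)
qed

lemma Lp_pow_equivariant:
  assumes E: "E \<in> equivariant" "E' \<in> equivariant" and g: "g \<in> carrier F" and h: "h \<in> H"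
  shows "Lp_pow p M (E (h \<otimes> g)) (E' (h \<otimes> g)) = Lp_pow p M (E g) (E' g)"
proof -
  have p0: "0 < p" using p by simp
  have hg: "h \<otimes> g \<in> carrier F" using h g HF by simp
  have "Lp_dist p M (\<phi> (\<psi> h) (Lp_class p M (E g))) (\<phi> (\<psi> h) (Lp_class p M (E' g)))
      = Lp_dist p M (Lp_class p M (E g)) (Lp_class p M (E' g))"
    using action \<psi>_closed[OF h] Lp_class_in[OF equivariant_Lp[OF E(1) g]] Lp_class_in[OF equivariant_Lp[OF E(2) g]]
    by (simp add: affine_isometric_action_def)
  then show ?thesis
    using Lp_dist_powr[OF p0 equivariant_Lp[OF E(1) g] equivariant_Lp[OF E(2) g]]
      Lp_dist_powr[OF p0 equivariant_Lp[OF E(1) hg] equivariant_Lp[OF E(2) hg]]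
    unfolding equivariant_act[OF E(1) g h] equivariant_act[OF E(2) g h] by simp
qed

lemma equivariant_Lp_maps: "Lp_maps F S p M T equivariant"
proof unfold_locales
  fix E E' a assume E: "E \<in> equivariant" "E' \<in> equivariant" and a: "a \<in> carrier F"
  have "(\<Sum>t\<in>T. Lp_pow p M (E (t \<otimes> a)) (E' (t \<otimes> a)))
      = (\<Sum>t\<in>T. Lp_pow p M (E (rep (t \<otimes> a))) (E' (rep (t \<otimes> a))))"
  proof (rule sum.cong)
    fix t assume "t \<in> T"
    then have ta: "t \<otimes> a \<in> carrier F" using T_carrier a by auto
    have "t \<otimes> a = t \<otimes> a \<otimes> inv (rep (t \<otimes> a)) \<otimes> rep (t \<otimes> a)"
      using ta rep_carrier[OF ta] by (simp add: m_assoc)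
    then show "Lp_pow p M (E (t \<otimes> a)) (E' (t \<otimes> a)) = Lp_pow p M (E (rep (t \<otimes> a))) (E' (rep (t \<otimes> a)))"
      using Lp_pow_equivariant[OF E rep_carrier[OF ta] cocycle[OF ta]] by simp
  qed simp
  also have "\<dots> = (\<Sum>t\<in>T. Lp_pow p M (E t) (E' t))"
    by (rule sum.reindex_bij_betw[OF bij_rep_right[OF a]])
  finally show "(\<Sum>t\<in>T. Lp_pow p M (E (t \<otimes> a)) (E' (t \<otimes> a))) = (\<Sum>t\<in>T. Lp_pow p M (E t) (E' t))" .
qed (use p finite_T T_carrier equivariant_Lp equivariant_affine equivariant_translate in auto)

text \<open>
  The equivariant map with the value \<open>x\<close> on the transversal, which shows that equivariant maps exist.
\<close>

definition orbit_map :: "('b \<Rightarrow> real) set \<Rightarrow> 'a \<Rightarrow> 'b \<Rightarrow> real" where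
  "orbit_map x g = Lp_rep (\<phi> (\<psi> (g \<otimes> inv (rep g))) x)"

lemma orbit_map_equivariant:
  assumes x: "x \<in> Lp_space p M"
  shows "orbit_map x \<in> equivariant"
proof -
  have in_space: "\<phi> (\<psi> (g \<otimes> inv (rep g))) x \<in> Lp_space p M" if "g \<in> carrier F" for g
    by (intro act_closed \<psi>_closed cocycle that x)
  have cls: "Lp_class p M (orbit_map x g) = \<phi> (\<psi> (g \<otimes> inv (rep g))) x" if "g \<in> carrier F" for g
    unfolding orbit_map_def by (rule Lp_rep_in(2)[OF in_space[OF that]])
  show ?thesis unfolding equivariant_def
  proof (intro CollectI ballI conjI)
    fix g assume g: "g \<in> carrier F"
    show "orbit_map x g \<in> Lp_fun p M"
      unfolding orbit_map_def by (rule Lp_rep_in(1)[OF in_space[OF g]])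
    fix h assume h: "h \<in> H"
    have hg: "h \<otimes> g \<in> carrier F" using h g HF by simp
    have "h \<otimes> g \<otimes> inv (rep (h \<otimes> g)) = h \<otimes> (g \<otimes> inv (rep g))"
      using rep_left[OF h g] HF[OF h] g rep_carrier[OF g] by (simp add: m_assoc)
    then show "Lp_class p M (orbit_map x (h \<otimes> g)) = \<phi> (\<psi> h) (Lp_class p M (orbit_map x g))"
      unfolding cls[OF hg] cls[OF g]
      using \<psi>_mult[OF h cocycle[OF g]] act_mult[OF \<psi>_closed[OF h] \<psi>_closed[OF cocycle[OF g]] x] by simp
  qed
qed

lemma equivariant_kernel:
  assumes E: "E \<in> equivariant" and g: "g \<in> carrier F" and n: "n \<in> carrier F"
    and conj: "g \<otimes> n \<otimes> inv g \<in> H" "\<psi> (g \<otimes> n \<otimes> inv g) = \<one>\<^bsub>G\<^esub>"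
  shows "AE x in M. E (g \<otimes> n) x = E g x"
proof -
  have gn: "g \<otimes> n \<in> carrier F" using g n by simp
  have "g \<otimes> n = g \<otimes> n \<otimes> inv g \<otimes> g" using g n by (simp add: m_assoc)
  then have "Lp_class p M (E (g \<otimes> n)) = \<phi> \<one>\<^bsub>G\<^esub> (Lp_class p M (E g))"
    using equivariant_act[OF E g conj(1)] conj(2) by simp
  also have "\<dots> = Lp_class p M (E g)"
    using Lp_class_in[OF equivariant_Lp[OF E g]]
    unfolding group_action.id_eq_one[OF group_action, symmetric] by simp
  finally show ?thesis
    using Lp_class_eq_iff[OF equivariant_Lp[OF E gn] equivariant_Lp[OF E g]] by simp
qed

text \<open>
  Bounded displacement of an equivariant map bounds the \<open>H\<close>-orbit of one of its values, and properness
  of the action turns this into finiteness of the image of \<open>\<psi>\<close>. The set \<open>S\<close> need not generate \<open>F\<close>;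
  it suffices that finitely many right translates \<open>b\<close> bring every element into the submonoid generated
  by \<open>S\<close>.
\<close>

theorem finite_image:
  assumes expanding: "expanding_Lp_maps F S p M T equivariant K"
    and proper: "proper_action p M G \<phi>"
    and gen: "finite B" "B \<subseteq> carrier F"
      "\<And>g. g \<in> carrier F \<Longrightarrow> \<exists>b\<in>B. \<exists>w. set w \<subseteq> S \<and> g \<otimes> b = list_prod F w"
  shows "finite (\<psi> ` H)"
proof -
  interpret L: expanding_Lp_maps F S p M T equivariant K by (rule expanding)
  have "(\<lambda>_. 0) \<in> Lp_fun p M" by (simp add: Lp_fun_def)
  then have "Lp_class p M (\<lambda>_. 0) \<in> Lp_space p M" by (rule Lp_class_in)
  then obtain E where E: "E \<in> equivariant" using orbit_map_equivariant by blast
  obtain R where R: "\<And>w. set w \<subseteq> S \<Longrightarrow> L.\<Delta> E \<one> (list_prod F w) \<le> R"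
    using L.bounded_displacement[OF E] by blast
  define R' where "R' = 2 powr p * (R + (\<Sum>b\<in>B. L.\<Delta> E b \<one>))"
  have bounded: "L.\<Delta> E \<one> g \<le> R'" if g: "g \<in> carrier F" for g
  proof -
    obtain b w where bw: "b \<in> B" "set w \<subseteq> S" "g \<otimes> b = list_prod F w" using gen(3)[OF g] by blast
    have b: "b \<in> carrier F" using bw gen by auto
    have "L.\<Delta> E \<one> g \<le> 2 powr p * (L.\<Delta> E \<one> (g \<otimes> b) + L.\<Delta> E (g \<otimes> b) g)"
      using g b by (intro L.\<Delta>_triangle E) auto
    also have "L.\<Delta> E (g \<otimes> b) g = L.\<Delta> E b \<one>" using L.\<Delta>_left[OF E b one_closed g] g by simp
    also have "2 powr p * (L.\<Delta> E \<one> (g \<otimes> b) + L.\<Delta> E b \<one>) \<le> R'"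
      unfolding R'_def using R[OF bw(2)] bw gen(1)
      by (intro mult_left_mono add_mono member_le_sum) (auto simp: L.\<Delta>_nonneg)
    finally show ?thesis .
  qed
  \<comment> \<open>Conjugating by an element \<open>t\<close> of the transversal turns the right translation by \<open>g\<close> at \<open>t\<close>
    into the left translation by \<open>h\<close>.\<close>
  define t where "t = rep \<one>"
  have t: "t \<in> T" "t \<in> carrier F" using rep_carrier by (auto simp: t_def T_def)
  define y where "y = Lp_class p M (E t)"
  have y: "y \<in> Lp_space p M" unfolding y_def by (intro Lp_class_in equivariant_Lp E t)
  have "Lp_dist p M (\<phi> (\<psi> h) y) y \<le> R' powr (1 / p)" if h: "h \<in> H" for h
  proof -
    define g where "g = inv t \<otimes> h \<otimes> t"
    have g: "g \<in> carrier F" and tg: "t \<otimes> g = h \<otimes> t"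
      using t HF[OF h] by (auto simp: g_def m_assoc[symmetric])
    have ht: "h \<otimes> t \<in> carrier F" using t HF[OF h] by simp
    have "Lp_dist p M (\<phi> (\<psi> h) y) y powr p = Lp_pow p M (E (h \<otimes> t)) (E t)"
      unfolding y_def equivariant_act[OF E t(2) h, symmetric]
      using p by (intro Lp_dist_powr equivariant_Lp E t ht) auto
    also have "\<dots> = Lp_pow p M (E t) (E (t \<otimes> g))" unfolding tg by (rule Lp_pow_commute)
    also have "\<dots> \<le> (\<Sum>t\<in>T. Lp_pow p M (E t) (E (t \<otimes> g)))"
      using t(1) finite_T by (intro member_le_sum) (auto simp: Lp_pow_nonneg)
    also have "\<dots> = L.\<Delta> E \<one> g" by (simp add: L.\<Delta>_one L.dpow_def L.rt_def)
    also have "\<dots> \<le> R'" by (rule bounded[OF g])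
    finally have "(Lp_dist p M (\<phi> (\<psi> h) y) y powr p) powr (1 / p) \<le> R' powr (1 / p)"
      using p by (intro powr_mono2) auto
    then show ?thesis using p by (simp add: powr_powr Lp_dist_def)
  qed
  then have "\<psi> ` H \<subseteq> {g \<in> carrier G. Lp_dist p M (\<phi> g y) y \<le> R' powr (1 / p)}"
    using \<psi>_closed by auto
  then show ?thesis using proper y unfolding proper_action_def by (meson finite_subset)
qed

end

section \<open>Preimages, normal closures and free groups\<close>

lemma (in group_hom) subgroup_preimage:
  assumes "subgroup K H"
  shows "subgroup {g \<in> carrier G. h g \<in> K} G"
proof (rule G.subgroupI)
  have "\<one> \<in> {g \<in> carrier G. h g \<in> K}" using subgroup.one_closed[OF assms] by simp
  then show "{g \<in> carrier G. h g \<in> K} \<noteq> {}" by blast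
qed (auto simp: subgroup.m_closed[OF assms] subgroup.m_inv_closed[OF assms])

lemma (in group_hom) finite_rcosets_preimage:
  assumes K: "subgroup K H" and fin: "finite (rcosets\<^bsub>H\<^esub> K)"
  shows "finite (rcosets {g \<in> carrier G. h g \<in> K})"
proof (rule finite_subset)
  let ?L = "{g \<in> carrier G. h g \<in> K}"
  show "rcosets ?L \<subseteq> (\<lambda>A. {g \<in> carrier G. h g \<in> A}) ` (rcosets\<^bsub>H\<^esub> K)"
  proof
    fix A assume "A \<in> rcosets ?L"
    then obtain a where a: "a \<in> carrier G" "A = ?L #> a" by (auto simp: RCOSETS_def)
    have "A = {g \<in> carrier G. h g \<in> K #>\<^bsub>H\<^esub> h a}"
    proof (intro equalityI subsetI)
      fix g assume "g \<in> A"
      then show "g \<in> {g \<in> carrier G. h g \<in> K #>\<^bsub>H\<^esub> h a}" using a by (auto simp: r_coset_def)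
    next
      fix g assume "g \<in> {g \<in> carrier G. h g \<in> K #>\<^bsub>H\<^esub> h a}"
      then obtain k where g: "g \<in> carrier G" "k \<in> K" "h g = k \<otimes>\<^bsub>H\<^esub> h a" by (auto simp: r_coset_def)
      have "k \<in> carrier H" using subgroup.mem_carrier[OF K g(2)] .
      then have "h (g \<otimes> inv a) = k" using g a by (simp add: H.m_assoc)
      then have "g \<otimes> inv a \<in> ?L" using g a by simp
      moreover have "g = g \<otimes> inv a \<otimes> a" using g a by (simp add: G.m_assoc)
      ultimately show "g \<in> A" using a unfolding r_coset_def by blast
    qed
    moreover have "K #>\<^bsub>H\<^esub> h a \<in> rcosets\<^bsub>H\<^esub> K" using a by (auto simp: RCOSETS_def)
    ultimately show "A \<in> (\<lambda>A. {g \<in> carrier G. h g \<in> A}) ` (rcosets\<^bsub>H\<^esub> K)" by blast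
  qed
qed (use fin in simp)

lemma normal_closure_normal:
  fixes G :: "'a monoid" (structure)
  assumes "group G" and S: "S \<subseteq> carrier G"
  shows "normal_closure G S \<lhd> G" and "S \<subseteq> normal_closure G S"
proof -
  interpret group G by fact
  have "carrier G \<lhd> G" unfolding normal_inv_iff using subgroup_self by auto
  then have ne: "{N. N \<lhd> G \<and> S \<subseteq> N} \<noteq> {}" using S by auto
  show "normal_closure G S \<lhd> G"
    unfolding normal_closure_def
  proof (rule normal_inv_iff[THEN iffD2], intro conjI ballI)
    show "subgroup (\<Inter> {N. N \<lhd> G \<and> S \<subseteq> N}) G"
      using ne by (intro subgroups_Inter) (auto dest: normal_imp_subgroup)
    show "x \<otimes> h \<otimes> inv x \<in> \<Inter> {N. N \<lhd> G \<and> S \<subseteq> N}"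
      if "x \<in> carrier G" "h \<in> \<Inter> {N. N \<lhd> G \<and> S \<subseteq> N}" for x h
      using that normal_inv_iff by blast
  qed
  show "S \<subseteq> normal_closure G S" by (auto simp: normal_closure_def)
qed

lemma free_gens_carrier: "free_gens k \<subseteq> carrier (free_group k)"
  by (auto simp: free_gens_def free_group_def reduced_word_def)

lemma inv_free_gen:
  assumes "i < k"
  shows "inv\<^bsub>free_group k\<^esub> [(i, b)] = [(i, \<not> b)]"
proof -
  interpret group "free_group k" by (rule group_free_group)
  show ?thesis
    using assms by (intro inv_equality) (auto simp: free_group_def reduced_word_def letter_inv_def)
qed

lemma list_prod_letters:
  assumes "w \<in> carrier (free_group k)"
  shows "list_prod (free_group k) (map (\<lambda>x. [x]) w) = w"
proof -
  have "list_prod (free_group k) (map (\<lambda>x. [x]) v) = foldr cons_reduce v []" for v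
    by (induction v) (auto simp: list_prod_def free_group_def)
  then show ?thesis using assms by (simp add: foldr_cons_reduce_Nil free_group_def)
qed

lemma gen_products_carrier: "gen_products k j \<subseteq> carrier (free_group k)"
  using free_gens_carrier by (auto simp: gen_products_def intro!: list_prod_closed[OF group_free_group])

lemma finite_gen_products: "finite (gen_products k j)"
proof -
  have "free_gens k = (\<lambda>(i, b). [(i, b)]) ` ({..<k} \<times> UNIV)" by (auto simp: free_gens_def)
  then have "finite (free_gens k)" by simp
  then have "finite {ts. set ts \<subseteq> free_gens k \<and> length ts = j}" by (rule finite_lists_length_eq)
  moreover have "gen_products k j = list_prod (free_group k) ` {ts. set ts \<subseteq> free_gens k \<and> length ts = j}"
    by (auto simp: gen_products_def)
  ultimately show ?thesis by simp
qed

lemma gen_products_ne: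
  assumes "0 < k"
  shows "gen_products k j \<noteq> {}"
proof -
  have "list_prod (free_group k) (replicate j [(0, True)]) \<in> gen_products k j"
    unfolding gen_products_def using assms
    by (intro CollectI exI[of _ "replicate j [(0, True)]"]) (auto simp: free_gens_def)
  then show ?thesis by auto
qed

lemma inv_gen_products:
  assumes "s \<in> gen_products k j"
  shows "inv\<^bsub>free_group k\<^esub> s \<in> gen_products k j"
proof -
  obtain ts where ts: "s = list_prod (free_group k) ts" "length ts = j" "set ts \<subseteq> free_gens k"
    using assms by (auto simp: gen_products_def)
  let ?us = "rev (map (m_inv (free_group k)) ts)"
  have "inv\<^bsub>free_group k\<^esub> s = list_prod (free_group k) ?us"
    unfolding ts using list_prod_rev_inv[OF group_free_group, of ts k] ts free_gens_carrier[of k] by auto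
  moreover have "set ?us \<subseteq> free_gens k"
  proof
    fix u assume "u \<in> set ?us"
    then obtain a where a: "a \<in> free_gens k" "u = inv\<^bsub>free_group k\<^esub> a" using ts(3) by auto
    then show "u \<in> free_gens k" by (auto simp: free_gens_def inv_free_gen)
  qed
  moreover have "length ?us = j" using ts by simp
  ultimately show ?thesis unfolding gen_products_def by blast
qed

lemma list_prod_blocks:
  assumes "length ts = j * l" "set ts \<subseteq> free_gens k"
  shows "\<exists>w. set w \<subseteq> gen_products k j \<and> list_prod (free_group k) ts = list_prod (free_group k) w"
  using assms
proof (induction l arbitrary: ts)
  case 0
  then show ?case by (intro exI[of _ "[]"]) simp
next
  case (Suc l)
  have sub: "set (take j ts) \<subseteq> free_gens k" "set (drop j ts) \<subseteq> free_gens k"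
    using Suc.prems(2) set_take_subset[of j ts] set_drop_subset[of j ts] by auto
  have "length (drop j ts) = j * l" using Suc.prems(1) by simp
  then obtain w where w: "set w \<subseteq> gen_products k j"
      "list_prod (free_group k) (drop j ts) = list_prod (free_group k) w"
    using Suc.IH sub(2) by blast
  have "list_prod (free_group k) ts = list_prod (free_group k) (take j ts @ drop j ts)" by simp
  also have "\<dots> = list_prod (free_group k) (list_prod (free_group k) (take j ts) # w)"
    using sub free_gens_carrier[of k]
    by (subst list_prod_append[OF group_free_group]) (auto simp: w list_prod_simps)
  finally have "list_prod (free_group k) ts = list_prod (free_group k) (list_prod (free_group k) (take j ts) # w)" .
  moreover have "list_prod (free_group k) (take j ts) \<in> gen_products k j"
    unfolding gen_products_def using sub(1) Suc.prems(1)
    by (intro CollectI exI[of _ "take j ts"]) auto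
  ultimately show ?case using w(1) by (intro exI[of _ "list_prod (free_group k) (take j ts) # w"]) auto
qed

text \<open>
  For even \<open>j\<close> the products of \<open>j\<close> generators generate a proper subgroup. A word becomes a product of
  blocks of length \<open>j\<close> after appending at most \<open>j\<close> copies of one generator.
\<close>

lemma gen_products_cofinite:
  assumes "0 < k" "0 < j"
  shows "\<exists>B. finite B \<and> B \<subseteq> carrier (free_group k) \<and> (\<forall>g\<in>carrier (free_group k).
     \<exists>b\<in>B. \<exists>w. set w \<subseteq> gen_products k j \<and> g \<otimes>\<^bsub>free_group k\<^esub> b = list_prod (free_group k) w)"
proof -
  define a where "a = [(0::nat, True)]"
  define B where "B = (\<lambda>i. list_prod (free_group k) (replicate i a)) ` {..j}"
  have a: "a \<in> free_gens k" using assms by (auto simp: a_def free_gens_def)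
  have rep: "set (replicate i a) \<subseteq> free_gens k" for i using a by auto
  have "\<exists>b\<in>B. \<exists>w. set w \<subseteq> gen_products k j \<and> g \<otimes>\<^bsub>free_group k\<^esub> b = list_prod (free_group k) w"
    if g: "g \<in> carrier (free_group k)" for g
  proof -
    define ts where "ts = map (\<lambda>x. [x]) g"
    have ts: "set ts \<subseteq> free_gens k" using g by (auto simp: ts_def free_gens_def free_group_def)
    define i where "i = j - length ts mod j"
    have "length ts = j * (length ts div j) + length ts mod j" by simp
    moreover have "length ts mod j < j" using assms by simp
    ultimately have "length ts + (j - length ts mod j) = j * (length ts div j) + j" by linarith
    then have len: "length (ts @ replicate i a) = j * (length ts div j + 1)"
      by (simp add: i_def)
    have "set (ts @ replicate i a) \<subseteq> free_gens k" using ts rep[of i] by simp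
    from list_prod_blocks[OF len this] obtain w where w: "set w \<subseteq> gen_products k j"
        "list_prod (free_group k) (ts @ replicate i a) = list_prod (free_group k) w"
      by blast
    have "list_prod (free_group k) (ts @ replicate i a)
        = g \<otimes>\<^bsub>free_group k\<^esub> list_prod (free_group k) (replicate i a)"
      using list_prod_append[OF group_free_group, of ts k "replicate i a"]
        subset_trans[OF ts free_gens_carrier] subset_trans[OF rep free_gens_carrier]
        list_prod_letters[OF g, folded ts_def] by simp
    moreover have "list_prod (free_group k) (replicate i a) \<in> B" by (auto simp: B_def i_def)
    ultimately show ?thesis using w
      by (intro bexI[of _ "list_prod (free_group k) (replicate i a)"] exI[of _ w]) simp_all
  qed
  moreover have "B \<subseteq> carrier (free_group k)"
    using rep free_gens_carrier[of k]
    by (auto simp: B_def intro!: list_prod_closed[OF group_free_group])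
  ultimately show ?thesis by (intro exI[of _ B]) (auto simp: B_def)
qed

section \<open>Super-rigidity of random monster groups\<close>

lemma logarithmic_girth_tends_to_infinity:
  assumes "logarithmic_girth \<Omega> r"
    and "filterlim (\<lambda>n. card (verts (\<Omega> n))) at_top sequentially"
  shows "\<forall>\<^sub>F n in sequentially. enat m < girth (\<Omega> n) (r n)"
proof -
  obtain C where C: "C > 0"
    "\<And>n. ereal (C * ln (real (card (verts (\<Omega> n))))) \<le> ereal_of_enat (girth (\<Omega> n) (r n))"
    using assms(1) by (auto simp: logarithmic_girth_def)
  have "filterlim (\<lambda>n. C * ln (real (card (verts (\<Omega> n))))) at_top sequentially"
    by (intro filterlim_tendsto_pos_mult_at_top[OF tendsto_const C(1)] filterlim_compose[OF ln_at_top]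
        filterlim_compose[OF filterlim_real_sequentially assms(2)])
  then have "\<forall>\<^sub>F n in sequentially. real m < C * ln (real (card (verts (\<Omega> n))))"
    by (simp add: filterlim_at_top_dense)
  then show ?thesis
  proof eventually_elim
    case (elim n)
    then have "ereal (real m) < ereal (C * ln (real (card (verts (\<Omega> n)))))" by simp
    also note C(2)[of n]
    finally have "ereal_of_enat (enat m) < ereal_of_enat (girth (\<Omega> n) (r n))" by simp
    then show ?case by (simp only: ereal_of_enat_less_iff)
  qed
qed

theorem corollary1p8:
  fixes d k j :: nat
    and p :: real
    and \<Omega> :: "nat \<Rightarrow> ('v, 'e) pre_digraph"
    and r :: "nat \<Rightarrow> 'e \<Rightarrow> 'e"
    and G :: "'g monoid"
  assumes "d \<ge> 3" and "k \<ge> 2" and "j \<ge> 1"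
    and "\<And>n. fin_conn_regular d (\<Omega> n) (r n)"
    and "logarithmic_girth \<Omega> r"
    and "\<And>q::real. 1 < q \<Longrightarrow> p_expander_Lp q \<Omega>"
    and "1 < p"
    and "a_FLp_menable TYPE('b) p G"
  shows "AE \<alpha> in random_labelling k j \<Omega> r.
           hereditary_super_rigidity (monster_group k \<Omega> \<alpha>) G"
proof -
  define F where "F = free_group k"
  define S where "S = gen_products k j"
  have groupF: "group F" unfolding F_def by (rule group_free_group)
  have S: "finite S" "S \<noteq> {}" "S \<subseteq> carrier F" "\<And>s. s \<in> S \<Longrightarrow> inv\<^bsub>F\<^esub> s \<in> S"
    unfolding F_def S_def using \<open>k \<ge> 2\<close>
    by (auto simp: finite_gen_products gen_products_ne inv_gen_products intro: subsetD[OF gen_products_carrier])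
  have graph: "labelled_graph (\<Omega> n) (r n) d F S" for n
  proof -
    have "fin_digraph (\<Omega> n)" "bidirected_digraph (\<Omega> n) (r n)" "\<forall>v\<in>verts (\<Omega> n). out_degree (\<Omega> n) v = d"
      using assms(4)[of n] by (auto simp: fin_conn_regular_def)
    then have "regular_graph (\<Omega> n) (r n) d"
      by (simp add: regular_graph_def regular_graph_axioms_def)
    then show ?thesis
      using groupF S by (simp add: labelled_graph_def labelled_graph_axioms_def)
  qed
  have conn: "strongly_connected (\<Omega> n)" for n
  proof -
    interpret labelled_graph "\<Omega> n" "r n" d F S by (rule graph)
    have "Digraph_Component.connected (\<Omega> n)" using assms(4)[of n] by (simp add: fin_conn_regular_def)
    then show ?thesis using symmetric_connected_imp_strongly_connected sym_arcs by blast
  qed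
  have ne: "verts (\<Omega> n) \<noteq> {}" for n using conn[of n] by (simp add: strongly_connected_def)
  have exp: "p_expander_Lp p \<Omega>" using assms by simp
  then have large: "filterlim (\<lambda>n. card (verts (\<Omega> n))) at_top sequentially"
    by (simp add: p_expander_Lp_def p_expander_def)
  have "0 < p" using \<open>1 < p\<close> by simp
  obtain C where C: "C \<ge> 0" and poincare: "\<And>n (f :: 'v \<Rightarrow> real).
     1 / (real (card (verts (\<Omega> n))))\<^sup>2 * (\<Sum>u\<in>verts (\<Omega> n). \<Sum>v\<in>verts (\<Omega> n). \<bar>f u - f v\<bar> powr p)
     \<le> C / real (card (arcs (\<Omega> n))) * (\<Sum>e\<in>arcs (\<Omega> n). \<bar>f (tail (\<Omega> n) e) - f (head (\<Omega> n) e)\<bar> powr p)"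
    using expander_scalar_poincare[OF \<open>0 < p\<close> exp] by blast
  obtain M :: "'b measure" and \<phi> where groupG: "group G"
    and action: "affine_isometric_action p M G \<phi>" and proper: "proper_action p M G \<phi>"
    using assms(8) unfolding a_FLp_menable_def by blast
  obtain B where B: "finite B" "B \<subseteq> carrier F"
      "\<And>g. g \<in> carrier F \<Longrightarrow> \<exists>b\<in>B. \<exists>w. set w \<subseteq> S \<and> g \<otimes>\<^bsub>F\<^esub> b = list_prod F w"
    using gen_products_cofinite[of k j] \<open>k \<ge> 2\<close> \<open>j \<ge> 1\<close> unfolding F_def S_def by auto
  define K where "K = 4 * 2 powr p * C * card S + 1"
  have K: "K > 0" unfolding K_def using C by (intro add_nonneg_pos) auto
  have rigid: "hereditary_super_rigidity (monster_group k \<Omega> \<alpha>) G"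
    if lab: "\<And>n. \<alpha> n \<in> sym_labellings F S (\<Omega> n) (r n)"
      and equi: "\<And>m. \<exists>n. labelled_graph.equidistributed (\<Omega> n) (r n) S (Suc m) (\<alpha> n)"
    for \<alpha> :: "nat \<Rightarrow> 'e \<Rightarrow> word"
  proof -
    define N where "N = normal_closure F (closed_path_labels k \<Omega> \<alpha>)"
    have "closed_path_labels k \<Omega> \<alpha> \<subseteq> carrier F"
    proof
      fix x assume "x \<in> closed_path_labels k \<Omega> \<alpha>"
      then obtain n q u where x: "x = list_prod F (map (\<alpha> n) q)" "pre_digraph.awalk (\<Omega> n) u q u"
        unfolding closed_path_labels_def F_def by blast
      have "set q \<subseteq> arcs (\<Omega> n)" using x(2) by (simp add: pre_digraph.awalk_def)
      then have "set (map (\<alpha> n) q) \<subseteq> carrier F"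
        using lab[of n] S(3) by (auto simp: sym_labellings_def)
      then show "x \<in> carrier F" unfolding x by (rule list_prod_closed[OF groupF])
    qed
    note N = normal_closure_normal[OF groupF this, folded N_def]
    interpret N: normal N F by (rule N(1))
    have quot: "monster_group k \<Omega> \<alpha> = F Mod N" by (simp add: monster_group_def F_def N_def)
    interpret \<pi>: group_hom F "F Mod N" "\<lambda>g. N #>\<^bsub>F\<^esub> g"
      by (intro group_hom.intro group_hom_axioms.intro groupF N.factorgroup_is_group N.r_coset_hom_Mod)
    show ?thesis unfolding quot hereditary_super_rigidity_def
    proof (intro allI impI ballI)
      fix H h assume "subgroup H (F Mod N) \<and> finite (rcosets\<^bsub>F Mod N\<^esub> H)"
        and h: "h \<in> hom ((F Mod N)\<lparr>carrier := H\<rparr>) G"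
      then have sub: "subgroup H (F Mod N)" "finite (rcosets\<^bsub>F Mod N\<^esub> H)" by auto
      \<comment> \<open>Pull the subgroup and the homomorphism back to the free group.\<close>
      define H' where "H' = {g \<in> carrier F. N #>\<^bsub>F\<^esub> g \<in> H}"
      define \<psi> where "\<psi> g = h (N #>\<^bsub>F\<^esub> g)" for g
      have \<psi>: "\<psi> \<in> hom (F\<lparr>carrier := H'\<rparr>) G"
      proof (rule homI)
        fix x y assume "x \<in> carrier (F\<lparr>carrier := H'\<rparr>)" "y \<in> carrier (F\<lparr>carrier := H'\<rparr>)"
        then have xy: "x \<in> carrier F" "N #>\<^bsub>F\<^esub> x \<in> H" "y \<in> carrier F" "N #>\<^bsub>F\<^esub> y \<in> H" by (auto simp: H'_def)
        show "\<psi> x \<in> carrier G" using h xy by (auto simp: \<psi>_def hom_def)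
        show "\<psi> (x \<otimes>\<^bsub>F\<lparr>carrier := H'\<rparr>\<^esub> y) = \<psi> x \<otimes>\<^bsub>G\<^esub> \<psi> y"
          using h xy \<pi>.hom_mult[OF xy(1,3)] by (simp add: \<psi>_def hom_def)
      qed
      interpret equivariant_maps F S p M G \<phi> H' \<psi>
      proof (intro equivariant_maps.intro walk.intro walk_axioms.intro equivariant_maps_axioms.intro)
        show "subgroup H' F" unfolding H'_def by (rule \<pi>.subgroup_preimage[OF sub(1)])
        show "finite (rcosets\<^bsub>F\<^esub> H')" unfolding H'_def by (rule \<pi>.finite_rcosets_preimage[OF sub])
      qed (use groupF S \<open>1 < p\<close> action groupG \<psi> in auto)
      interpret L: Lp_maps F S p M T equivariant by (rule equivariant_Lp_maps)
      have \<psi>_one: "\<psi> n = \<one>\<^bsub>G\<^esub>" and N_sub: "n \<in> H'" if n: "n \<in> N" for n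
      proof -
        have coset: "N #>\<^bsub>F\<^esub> n = \<one>\<^bsub>F Mod N\<^esub>"
          using N.coset_join2[OF N.mem_carrier[OF n] N.subgroup_axioms n] by (simp add: FactGroup_def)
        then show "n \<in> H'" using n subgroup.one_closed[OF sub(1)] by (simp add: H'_def)
        have "group ((F Mod N)\<lparr>carrier := H\<rparr>)"
          by (rule \<pi>.H.subgroup_imp_group[OF sub(1)])
        then have "h \<one>\<^bsub>F Mod N\<^esub> = \<one>\<^bsub>G\<^esub>"
          using hom_one[OF h _ groupG] by simp
        then show "\<psi> n = \<one>\<^bsub>G\<^esub>" by (simp add: \<psi>_def coset)
      qed
      have invN: "AE x in M. E (g \<otimes>\<^bsub>F\<^esub> n) x = E g x" if "E \<in> equivariant" "g \<in> carrier F" "n \<in> N" for E g n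
      proof -
        have "g \<otimes>\<^bsub>F\<^esub> n \<otimes>\<^bsub>F\<^esub> inv\<^bsub>F\<^esub> g \<in> N" using N(1) that N.normal_inv_iff by blast
        then show ?thesis
          using that N.mem_carrier[OF that(3)] by (intro equivariant_kernel N_sub \<psi>_one) auto
      qed
      have "expanding_Lp_maps F S p M T equivariant K"
      proof unfold_locales
        fix E m assume E: "E \<in> equivariant"
        show "L.energy m E \<le> K * L.energy 1 E"
        proof (cases m)
          case 0
          then show ?thesis using K L.energy_nonneg[of 1 E] by (simp add: L.energy_def L.\<Delta>_def L.dpow_same)
        next
          case (Suc m')
          obtain n where n: "labelled_graph.equidistributed (\<Omega> n) (r n) S (Suc m') (\<alpha> n)"
            using equi by blast
          have "L.energy (Suc m') E \<le> 4 * 2 powr p * C * card S * L.energy 1 E"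
          proof (rule L.energy_le_of_equidistributed[OF graph _ conn lab n _ _ C poincare E])
            show "2 \<le> d" using \<open>d \<ge> 3\<close> by simp
            show "list_prod F (map (\<alpha> n) q) \<in> N" if "pre_digraph.awalk (\<Omega> n) u q u" for u q
              using N(2) that unfolding closed_path_labels_def F_def by blast
          qed (rule invN)
          also have "\<dots> \<le> K * L.energy 1 E"
            using L.energy_nonneg[of 1 E] unfolding K_def by (intro mult_right_mono) auto
          finally show ?thesis using Suc by simp
        qed
      qed (rule K)
      then have "finite (\<psi> ` H')" by (rule finite_image[OF _ proper B])
      moreover have "h ` H \<subseteq> \<psi> ` H'"
      proof
        fix y assume "y \<in> h ` H"
        then obtain c where c: "c \<in> H" "y = h c" by auto
        then have "c \<in> carrier (F Mod N)" using subgroup.mem_carrier[OF sub(1)] by blast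
        then obtain g where "g \<in> carrier F" "c = N #>\<^bsub>F\<^esub> g" by (auto simp: FactGroup_def RCOSETS_def)
        then show "y \<in> \<psi> ` H'" using c by (auto simp: H'_def \<psi>_def)
      qed
      ultimately show "finite (h ` H)" by (rule rev_finite_subset)
    qed
  qed
  have girth: "\<forall>\<^sub>F n in sequentially. enat m < girth (\<Omega> n) (r n)" for m
    by (rule logarithmic_girth_tends_to_infinity[OF assms(5) large])
  have "d \<ge> 2" using \<open>d \<ge> 3\<close> by simp
  from AE_exists_equidistributed[OF graph this ne large girth]
  have "AE \<alpha> in random_labelling k j \<Omega> r. (\<forall>n. \<alpha> n \<in> sym_labellings F S (\<Omega> n) (r n)) \<and>
      (\<forall>m. \<exists>n. labelled_graph.equidistributed (\<Omega> n) (r n) S (Suc m) (\<alpha> n))"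
    unfolding random_labelling_def F_def S_def .
  then show ?thesis by (rule AE_mp) (intro AE_I2 impI rigid, auto)
qed

end
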